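(* Let $q>3$ be an odd prime power and $G=\mathbf{SL}(2,\mathbb{F}_q)$. Let $I$ be the identity matrix and let $\rho$ be an irreducible representation of $G$ over $k$ (note that $\mathcal{Z}_{I}=\mathcal{Z}_{-I}=G$). Then: \begin{enumerate} \item $\dim\mathfrak{B}(V(I,\rho))=\infty$. \item If $\dim\mathfrak{B}(V(-I,\rho))<\infty$, then $\mathfrak{B}(V(-I,\rho))$ is the exterior algebra of the vector space $V(-I,\rho)$. \end{enumerate}
   Context: $k$ is an algebraically closed field of characteristic $0$. For a finite group $G$, a Yetter-Drinfeld module over $kG$ is a $G$-graded $k$-vector space $V=\bigoplus_{h\in G}V_h$ with a linear $G$-action such that $g\cdot V_h\subseteq V_{ghg^{-1}}$. It is a braided vector space with braiding $c(v\otimes w)=h\cdot w\otimes v$ for $v\in V_h$, $w\in V$. For $g\in G$, $\mathcal{Z}_g$ is the centralizer of $g$ in $G$. For a representation $\rho$ of $\mathcal{Z}_g$ on $W$, $V(g,\rho)=kG\otimes_{k\mathcal{Z}_g}W$, graded so that $h\otimes w$ has degree $hgh^{-1}$. The Nichols algebra of a braided vector space $(V,c)$ is $\mathfrak{B}(V)=T(V)/\bigoplus_{n\ge2}\ker(\mathfrak{S}_n)$, where $\mathfrak{S}_n=\sum_{\sigma\in\mathbb{S}_n}c_\sigma$ acts on $V^{\otimes n}$ and $c_\sigma$ is obtained from a reduced expression of $\sigma$ by replacing each transposition $(i\ i{+}1)$ with $c$ acting on the factors $i,i+1$. *)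

theory Defs
  imports
    "HOL-Library.Poly_Mapping"
    "HOL-Combinatorics.Permutations"
    "HOL-Number_Theory.Prime_Powers"
    "HOL-Algebra.QuotRing"
    "Jordan_Normal_Form.VS_Connect"
begin

text \<open>
  Vector spaces over a field \<open>'k\<close> are records satisfying \<open>vectorspace class_ring\<close>. Since the record
  type \<open>module\<close> extends \<open>ring\<close>, the same type also carries (noncommutative) algebras over \<open>'k\<close>;
  for a mere vector space the fields \<open>mult\<close> and \<open>one\<close> are meaningless.
\<close>

section \<open>Linear algebra\<close>

definition linear_maps ::
  "('k::field, 'v, 'm) module_scheme \<Rightarrow> ('k, 'w, 'n) module_scheme \<Rightarrow> ('v \<Rightarrow> 'w) set"
  where "linear_maps V W = module_hom class_ring V W \<inter> extensional (carrier V)"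

definition free_space :: "'x set \<Rightarrow> ('k::field, 'x \<Rightarrow>\<^sub>0 'k) module"
  where "free_space X =
    \<lparr>carrier = {p. Poly_Mapping.keys p \<subseteq> X}, mult = undefined, one = undefined,
     zero = 0, add = (+), smult = (\<lambda>c. Poly_Mapping.map ((*) c))\<rparr>"

definition monoid_algebra :: "('g, 'b) monoid_scheme \<Rightarrow> ('k::field, 'g \<Rightarrow>\<^sub>0 'k) module"
  where "monoid_algebra M = (free_space (carrier M))
    \<lparr>mult := (\<lambda>p q. \<Sum>x\<in>Poly_Mapping.keys p. \<Sum>y\<in>Poly_Mapping.keys q.
        Poly_Mapping.single (x \<otimes>\<^bsub>M\<^esub> y) (Poly_Mapping.lookup p x * Poly_Mapping.lookup q y)),
     one := Poly_Mapping.single \<one>\<^bsub>M\<^esub> 1\<rparr>"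

text \<open>The quotient of a vector space by a subspace, and of an algebra by a two-sided ideal
  (compare \<open>FactRing\<close>).\<close>

definition quotient_module ::
  "('k, 'v, 'm) module_scheme \<Rightarrow> 'v set \<Rightarrow> ('k, 'v set) module"
  where "quotient_module V U =
    \<lparr>carrier = a_rcosets\<^bsub>V\<^esub> U, mult = rcoset_mult V U, one = U +>\<^bsub>V\<^esub> \<one>\<^bsub>V\<^esub>,
     zero = U, add = set_add V, smult = (\<lambda>c X. \<Union>x\<in>X. U +>\<^bsub>V\<^esub> (c \<odot>\<^bsub>V\<^esub> x))\<rparr>"

text \<open>
  The tensor product over an algebra \<open>A\<close> (only its underlying set is needed) of a right module
  \<open>M\<close> and a left module \<open>N\<close>, as the quotient of the free space on \<open>M \<times> N\<close> by the relations of
  \<open>'k\<close>-bilinearity and \<open>A\<close>-balancedness.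
\<close>

definition balanced_relations ::
  "'a set \<Rightarrow> ('k::field, 'm, 'b) module_scheme \<Rightarrow> ('m \<Rightarrow> 'a \<Rightarrow> 'm) \<Rightarrow>
   ('k, 'n, 'c) module_scheme \<Rightarrow> ('a \<Rightarrow> 'n \<Rightarrow> 'n) \<Rightarrow> ('m \<times> 'n \<Rightarrow>\<^sub>0 'k) set"
  where "balanced_relations A M ract N lact =
    (let e = (\<lambda>m n. Poly_Mapping.single (m, n) 1) in
     module.span class_ring (free_space (carrier M \<times> carrier N))
      ({e (m \<oplus>\<^bsub>M\<^esub> m') n - e m n - e m' n | m m' n.
          m \<in> carrier M \<and> m' \<in> carrier M \<and> n \<in> carrier N} \<union>
       {e m (n \<oplus>\<^bsub>N\<^esub> n') - e m n - e m n' | m n n'.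
          m \<in> carrier M \<and> n \<in> carrier N \<and> n' \<in> carrier N} \<union>
       {e (c \<odot>\<^bsub>M\<^esub> m) n - Poly_Mapping.single (m, n) c | c m n.
          m \<in> carrier M \<and> n \<in> carrier N} \<union>
       {e m (c \<odot>\<^bsub>N\<^esub> n) - Poly_Mapping.single (m, n) c | c m n.
          m \<in> carrier M \<and> n \<in> carrier N} \<union>
       {e (ract m a) n - e m (lact a n) | m a n.
          m \<in> carrier M \<and> a \<in> A \<and> n \<in> carrier N}))"

definition balanced_tensor ::
  "'a set \<Rightarrow> ('k::field, 'm, 'b) module_scheme \<Rightarrow> ('m \<Rightarrow> 'a \<Rightarrow> 'm) \<Rightarrow>
   ('k, 'n, 'c) module_scheme \<Rightarrow> ('a \<Rightarrow> 'n \<Rightarrow> 'n) \<Rightarrow> ('k, ('m \<times> 'n \<Rightarrow>\<^sub>0 'k) set) module"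
  where "balanced_tensor A M ract N lact =
    quotient_module (free_space (carrier M \<times> carrier N)) (balanced_relations A M ract N lact)"

definition balanced_pure ::
  "'a set \<Rightarrow> ('k::field, 'm, 'b) module_scheme \<Rightarrow> ('m \<Rightarrow> 'a \<Rightarrow> 'm) \<Rightarrow>
   ('k, 'n, 'c) module_scheme \<Rightarrow> ('a \<Rightarrow> 'n \<Rightarrow> 'n) \<Rightarrow> 'm \<Rightarrow> 'n \<Rightarrow> ('m \<times> 'n \<Rightarrow>\<^sub>0 'k) set"
  where "balanced_pure A M ract N lact m n =
    balanced_relations A M ract N lact
      +>\<^bsub>free_space (carrier M \<times> carrier N)\<^esub> Poly_Mapping.single (m, n) 1"


section \<open>Tensor algebra and exterior algebra\<close>

definition word_monoid :: "'v set \<Rightarrow> 'v list monoid"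
  where "word_monoid X = \<lparr>carrier = lists X, mult = (@), one = []\<rparr>"

text \<open>\<open>T(V)\<close> is the free associative algebra on the set \<open>V\<close> modulo the linear relations of \<open>V\<close>;
  the class of the word \<open>[v\<^sub>1, \<dots>, v\<^sub>n]\<close> is \<open>v\<^sub>1 \<otimes> \<dots> \<otimes> v\<^sub>n\<close>.\<close>

definition tensor_relations :: "('k::field, 'v, 'm) module_scheme \<Rightarrow> ('v list \<Rightarrow>\<^sub>0 'k) set"
  where "tensor_relations V =
    genideal (monoid_algebra (word_monoid (carrier V)))
      ({Poly_Mapping.single [v \<oplus>\<^bsub>V\<^esub> w] 1 - Poly_Mapping.single [v] 1 - Poly_Mapping.single [w] 1 | v w.
          v \<in> carrier V \<and> w \<in> carrier V} \<union>
       {Poly_Mapping.single [c \<odot>\<^bsub>V\<^esub> v] 1 - Poly_Mapping.single [v] c | c v. v \<in> carrier V})"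

definition tensor_algebra ::
  "('k::field, 'v, 'm) module_scheme \<Rightarrow> ('k, ('v list \<Rightarrow>\<^sub>0 'k) set) module"
  where "tensor_algebra V =
    quotient_module (monoid_algebra (word_monoid (carrier V))) (tensor_relations V)"

definition pure_tensor ::
  "('k::field, 'v, 'm) module_scheme \<Rightarrow> 'v list \<Rightarrow> ('v list \<Rightarrow>\<^sub>0 'k) set"
  where "pure_tensor V vs =
    tensor_relations V +>\<^bsub>monoid_algebra (word_monoid (carrier V))\<^esub> Poly_Mapping.single vs 1"

text \<open>\<open>V\<^sup>\<otimes>\<^sup>n\<close> as the degree \<open>n\<close> component of \<open>T(V)\<close>.\<close>

definition tensor_power ::
  "('k::field, 'v, 'm) module_scheme \<Rightarrow> nat \<Rightarrow> ('k, ('v list \<Rightarrow>\<^sub>0 'k) set) module"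
  where "tensor_power V n = (tensor_algebra V)
    \<lparr>carrier := module.span class_ring (tensor_algebra V)
       (pure_tensor V ` {vs \<in> lists (carrier V). length vs = n})\<rparr>"

definition exterior_algebra ::
  "('k::field, 'v, 'm) module_scheme \<Rightarrow> ('k, ('v list \<Rightarrow>\<^sub>0 'k) set set) module"
  where "exterior_algebra V =
    quotient_module (tensor_algebra V)
      (genideal (tensor_algebra V) {pure_tensor V [v, v] | v. v \<in> carrier V})"


section \<open>Nichols algebras\<close>

text \<open>In this section \<open>c\<close> is a linear endomorphism of \<open>tensor_power V 2\<close>. Tensor factors are
  numbered from \<open>0\<close>, so \<open>braid_at V c n i\<close>, for \<open>i + 1 < n\<close>, is \<open>id\<^sup>\<otimes>\<^sup>i \<otimes> c \<otimes> id\<^sup>\<otimes>\<^sup>(\<^sup>n\<^sup>-\<^sup>i\<^sup>-\<^sup>2\<^sup>)\<close>.\<close>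

definition braid_at ::
  "('k::field, 'v, 'm) module_scheme \<Rightarrow> (('v list \<Rightarrow>\<^sub>0 'k) set \<Rightarrow> ('v list \<Rightarrow>\<^sub>0 'k) set) \<Rightarrow>
   nat \<Rightarrow> nat \<Rightarrow> ('v list \<Rightarrow>\<^sub>0 'k) set \<Rightarrow> ('v list \<Rightarrow>\<^sub>0 'k) set"
  where "braid_at V c n i =
    (THE \<phi>. \<phi> \<in> linear_maps (tensor_power V n) (tensor_power V n) \<and>
      (\<forall>x \<in> carrier (tensor_power V i). \<forall>t \<in> carrier (tensor_power V 2).
       \<forall>y \<in> carrier (tensor_power V (n - i - 2)).
         \<phi> (x \<otimes>\<^bsub>tensor_algebra V\<^esub> t \<otimes>\<^bsub>tensor_algebra V\<^esub> y)
           = x \<otimes>\<^bsub>tensor_algebra V\<^esub> c t \<otimes>\<^bsub>tensor_algebra V\<^esub> y))"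

definition word_perm :: "nat list \<Rightarrow> nat \<Rightarrow> nat"
  where "word_perm js = foldr (\<lambda>i \<sigma>. transpose i (Suc i) \<circ> \<sigma>) js id"

definition reduced_expression :: "nat \<Rightarrow> (nat \<Rightarrow> nat) \<Rightarrow> nat list \<Rightarrow> bool"
  where "reduced_expression n \<sigma> js \<longleftrightarrow>
    js \<in> lists {i. Suc i < n} \<and> word_perm js = \<sigma> \<and>
    (\<forall>js' \<in> lists {i. Suc i < n}. word_perm js' = \<sigma> \<longrightarrow> length js \<le> length js')"

text \<open>If \<open>c\<close> satisfies the braid equation, then the choice of the reduced expression is
  immaterial (Matsumoto).\<close>

definition braid_perm ::
  "('k::field, 'v, 'm) module_scheme \<Rightarrow> (('v list \<Rightarrow>\<^sub>0 'k) set \<Rightarrow> ('v list \<Rightarrow>\<^sub>0 'k) set) \<Rightarrow>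
   nat \<Rightarrow> (nat \<Rightarrow> nat) \<Rightarrow> ('v list \<Rightarrow>\<^sub>0 'k) set \<Rightarrow> ('v list \<Rightarrow>\<^sub>0 'k) set"
  where "braid_perm V c n \<sigma> =
    foldr (\<lambda>i \<phi>. braid_at V c n i \<circ> \<phi>) (SOME js. reduced_expression n \<sigma> js) id"

definition quantum_symmetrizer ::
  "('k::field, 'v, 'm) module_scheme \<Rightarrow> (('v list \<Rightarrow>\<^sub>0 'k) set \<Rightarrow> ('v list \<Rightarrow>\<^sub>0 'k) set) \<Rightarrow>
   nat \<Rightarrow> ('v list \<Rightarrow>\<^sub>0 'k) set \<Rightarrow> ('v list \<Rightarrow>\<^sub>0 'k) set"
  where "quantum_symmetrizer V c n x =
    (\<Oplus>\<^bsub>tensor_power V n\<^esub> \<sigma> \<in> {\<sigma>. \<sigma> permutes {..<n}}. braid_perm V c n \<sigma> x)"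

definition nichols_ideal ::
  "('k::field, 'v, 'm) module_scheme \<Rightarrow> (('v list \<Rightarrow>\<^sub>0 'k) set \<Rightarrow> ('v list \<Rightarrow>\<^sub>0 'k) set) \<Rightarrow>
   ('v list \<Rightarrow>\<^sub>0 'k) set set"
  where "nichols_ideal V c =
    {\<Oplus>\<^bsub>tensor_algebra V\<^esub> n \<in> N. x n | N x. finite N \<and> N \<subseteq> {2..} \<and>
       (\<forall>n \<in> N. x n \<in> carrier (tensor_power V n) \<and>
          quantum_symmetrizer V c n (x n) = \<zero>\<^bsub>tensor_power V n\<^esub>)}"

definition nichols_algebra ::
  "('k::field, 'v, 'm) module_scheme \<Rightarrow> (('v list \<Rightarrow>\<^sub>0 'k) set \<Rightarrow> ('v list \<Rightarrow>\<^sub>0 'k) set) \<Rightarrow>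
   ('k, ('v list \<Rightarrow>\<^sub>0 'k) set set) module"
  where "nichols_algebra V c = quotient_module (tensor_algebra V) (nichols_ideal V c)"


section \<open>Yetter-Drinfeld modules over finite groups\<close>

record ('k, 'v, 'g) yd_module = "('k, 'v) module" +
  component :: "'g \<Rightarrow> 'v set"
  action :: "'g \<Rightarrow> 'v \<Rightarrow> 'v"

locale linear_representation = G: group G + W: vectorspace class_ring W
  for G :: "('g, 'b) monoid_scheme" and W :: "('k::field, 'w, 'm) module_scheme" +
  fixes \<rho> :: "'g \<Rightarrow> 'w \<Rightarrow> 'w"
  assumes linear: "g \<in> carrier G \<Longrightarrow> \<rho> g \<in> module_hom class_ring W W"
    and one: "w \<in> carrier W \<Longrightarrow> \<rho> \<one>\<^bsub>G\<^esub> w = w"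
    and mult: "\<lbrakk>g \<in> carrier G; h \<in> carrier G; w \<in> carrier W\<rbrakk> \<Longrightarrow> \<rho> (g \<otimes>\<^bsub>G\<^esub> h) w = \<rho> g (\<rho> h w)"

locale irreducible_representation = linear_representation G W \<rho>
  for G :: "('g, 'b) monoid_scheme" and W :: "('k::field, 'w, 'm) module_scheme" and \<rho> +
  assumes nonzero: "carrier W \<noteq> {\<zero>\<^bsub>W\<^esub>}"
    and irreducible: "\<lbrakk>subspace class_ring U W; \<And>g u. \<lbrakk>g \<in> carrier G; u \<in> U\<rbrakk> \<Longrightarrow> \<rho> g u \<in> U\<rbrakk>
      \<Longrightarrow> U = {\<zero>\<^bsub>W\<^esub>} \<or> U = carrier W"

locale yetter_drinfeld_module = linear_representation G V "action V"
  for G :: "('g, 'b) monoid_scheme" and V :: "('k::field, 'v, 'g, 'm) yd_module_scheme" +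
  assumes finite_group: "finite (carrier G)"
    and component_subspace: "h \<in> carrier G \<Longrightarrow> subspace class_ring (component V h) V"
    and direct_sum: "v \<in> carrier V \<Longrightarrow>
      \<exists>!x. x \<in> (\<Pi>\<^sub>E h \<in> carrier G. component V h) \<and> v = (\<Oplus>\<^bsub>V\<^esub> h \<in> carrier G. x h)"
    and action_component: "\<lbrakk>g \<in> carrier G; h \<in> carrier G; v \<in> component V h\<rbrakk>
      \<Longrightarrow> action V g v \<in> component V (g \<otimes>\<^bsub>G\<^esub> h \<otimes>\<^bsub>G\<^esub> inv\<^bsub>G\<^esub> g)"

text \<open>Pure tensors with homogeneous first factor span \<open>V \<otimes> V\<close>, which makes the map unique.\<close>

definition yd_braiding ::
  "('g, 'b) monoid_scheme \<Rightarrow> ('k::field, 'v, 'g, 'm) yd_module_scheme \<Rightarrow>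
   ('v list \<Rightarrow>\<^sub>0 'k) set \<Rightarrow> ('v list \<Rightarrow>\<^sub>0 'k) set"
  where "yd_braiding G V =
    (THE c. c \<in> linear_maps (tensor_power V 2) (tensor_power V 2) \<and>
      (\<forall>h \<in> carrier G. \<forall>v \<in> component V h. \<forall>w \<in> carrier V.
        c (pure_tensor V [v, w]) = pure_tensor V [action V h w, v]))"

definition yd_nichols_algebra ::
  "('g, 'b) monoid_scheme \<Rightarrow> ('k::field, 'v, 'g, 'm) yd_module_scheme \<Rightarrow>
   ('k, ('v list \<Rightarrow>\<^sub>0 'k) set set) module"
  where "yd_nichols_algebra G V = nichols_algebra V (yd_braiding G V)"


section \<open>The Yetter-Drinfeld module of a representation of a centralizer\<close>

definition centralizer :: "('g, 'b) monoid_scheme \<Rightarrow> 'g \<Rightarrow> 'g set"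
  where "centralizer G g = {h \<in> carrier G. h \<otimes>\<^bsub>G\<^esub> g = g \<otimes>\<^bsub>G\<^esub> h}"

definition algebra_action ::
  "('k::field, 'w, 'm) module_scheme \<Rightarrow> ('g \<Rightarrow> 'w \<Rightarrow> 'w) \<Rightarrow> ('g \<Rightarrow>\<^sub>0 'k) \<Rightarrow> 'w \<Rightarrow> 'w"
  where "algebra_action W \<rho> a w =
    (\<Oplus>\<^bsub>W\<^esub> z \<in> Poly_Mapping.keys a. Poly_Mapping.lookup a z \<odot>\<^bsub>W\<^esub> \<rho> z w)"

definition induced_space ::
  "('g, 'b) monoid_scheme \<Rightarrow> 'g set \<Rightarrow> ('k::field, 'w, 'm) module_scheme \<Rightarrow> ('g \<Rightarrow> 'w \<Rightarrow> 'w) \<Rightarrow>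
   ('k, (('g \<Rightarrow>\<^sub>0 'k) \<times> 'w \<Rightarrow>\<^sub>0 'k) set) module"
  where "induced_space G Z W \<rho> =
    balanced_tensor (carrier (monoid_algebra (G\<lparr>carrier := Z\<rparr>)))
      (monoid_algebra G) (mult (monoid_algebra G)) W (algebra_action W \<rho>)"

definition induced_pure ::
  "('g, 'b) monoid_scheme \<Rightarrow> 'g set \<Rightarrow> ('k::field, 'w, 'm) module_scheme \<Rightarrow> ('g \<Rightarrow> 'w \<Rightarrow> 'w) \<Rightarrow>
   ('g \<Rightarrow>\<^sub>0 'k) \<Rightarrow> 'w \<Rightarrow> (('g \<Rightarrow>\<^sub>0 'k) \<times> 'w \<Rightarrow>\<^sub>0 'k) set"
  where "induced_pure G Z W \<rho> =
    balanced_pure (carrier (monoid_algebra (G\<lparr>carrier := Z\<rparr>)))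
      (monoid_algebra G) (mult (monoid_algebra G)) W (algebra_action W \<rho>)"

text \<open>\<open>V(g, \<rho>)\<close>, for a representation \<open>\<rho>\<close> of the centralizer of \<open>g\<close> on \<open>W\<close>; only the values of
  \<open>\<rho>\<close> on the centralizer matter.\<close>

definition induced_yd ::
  "('g, 'b) monoid_scheme \<Rightarrow> 'g \<Rightarrow> ('k::field, 'w, 'm) module_scheme \<Rightarrow> ('g \<Rightarrow> 'w \<Rightarrow> 'w) \<Rightarrow>
   ('k, (('g \<Rightarrow>\<^sub>0 'k) \<times> 'w \<Rightarrow>\<^sub>0 'k) set, 'g) yd_module"
  where "induced_yd G g W \<rho> =
    (let Z = centralizer G g; V = induced_space G Z W \<rho>; t = induced_pure G Z W \<rho> in
     module.extend V
      \<lparr>component = (\<lambda>x. module.span class_ring V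
         {t (Poly_Mapping.single h 1) w | h w.
            h \<in> carrier G \<and> w \<in> carrier W \<and> h \<otimes>\<^bsub>G\<^esub> g \<otimes>\<^bsub>G\<^esub> inv\<^bsub>G\<^esub> h = x}),
       action = (\<lambda>x. THE \<phi>. \<phi> \<in> linear_maps V V \<and>
         (\<forall>a \<in> carrier (monoid_algebra G). \<forall>w \<in> carrier W.
            \<phi> (t a w) = t (Poly_Mapping.single x 1 \<otimes>\<^bsub>monoid_algebra G\<^esub> a) w))\<rparr>)"


section \<open>Special linear groups\<close>

definition special_linear :: "nat \<Rightarrow> 'f::field mat monoid"
  where "special_linear n = \<lparr>carrier = {A \<in> carrier_mat n n. det A = 1}, mult = (*), one = 1\<^sub>m n\<rparr>"

end

theory Submission
  imports Defs
begin

text \<open>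
  If \<open>z\<close> is central, then \<open>V(z, \<rho>)\<close> is \<open>\<rho>\<close> concentrated in degree \<open>z\<close>, so its braiding is
  \<open>v \<otimes> w \<mapsto> z \<cdot> w \<otimes> v\<close>. When moreover \<open>z\<^sup>2 = 1\<close>, irreducibility forces \<open>z\<close> to act by a sign
  \<open>\<epsilon> = \<plusminus>1\<close>, and the braiding is \<open>\<epsilon>\<close> times the flip. For \<open>\<epsilon> = 1\<close> the maps \<open>\<SS>\<^sub>n\<close> are the
  symmetrizers; a linear functional \<open>f\<close> with \<open>f v = 1\<close> induces functionals \<open>f\<^sup>\<otimes>\<^sup>n\<close> on \<open>T(V)\<close> which
  vanish on the defining ideal because \<open>f\<^sup>\<otimes>\<^sup>n \<circ> \<SS>\<^sub>n = n! f\<^sup>\<otimes>\<^sup>n\<close>, so the powers of \<open>v\<close> stay linearly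
  independent in the Nichols algebra. For \<open>\<epsilon> = -1\<close> the maps \<open>\<SS>\<^sub>n\<close> are the antisymmetrizers: they
  kill \<open>a \<otimes> v \<otimes> v \<otimes> b\<close> by pairing each permutation with its product with a transposition, and
  modulo the ideal generated by the squares each of them acts as \<open>n!\<close>, so their kernels make up
  exactly that ideal. The identity matrix always falls under \<open>\<epsilon> = 1\<close>.
\<close>

section \<open>Linear algebra\<close>

text \<open>Every object is pinned down indirectly: quotients are sets of cosets,
  \<open>braid_at\<close>, \<open>yd_braiding\<close> and the group action are definite
  descriptions, and \<open>braid_perm\<close> rests on a chosen reduced expression. Much of the work
  is to show that these descriptions are met. A map is built from a universal property (of
  \<open>free_space\<close>, \<open>tensor_algebra\<close> or \<open>induced_space\<close>) and
  identified by its values on a spanning set. The choice of expression is harmless: on pure tensors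
  a word matters only through its permutation, and after an invariant map it does not matter at all.
  The functional with \<open>f v = 1\<close> comes from Zorn's lemma, so no basis is chosen. In the
  exterior case the two ideals are compared inside T(V), without a basis or the dimension of the
  exterior algebra. Characteristic 0 enters through division by 2 and by n!. The two claims are
  linked as follows. The matrix -I may act by either sign, depending on \<rho>. If it acts by +1,
  the argument for I applies verbatim and the Nichols algebra is infinite-dimensional; finite
  dimension thus leaves only -1, the exterior case.\<close>

abbreviation lspan where "lspan V \<equiv> LinearCombinations.module.span class_ring V"

text \<open>The vectors that satisfy \<open>P\<close> form a submodule, and the span is the least
  submodule containing \<open>S\<close>. This is the tool for extending identities from
  generators.\<close>

lemma (in module) span_induct [consumes 2, case_names zero add smult base]:
  assumes "x \<in> span S" and "S \<subseteq> carrier M"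
    and "P \<zero>\<^bsub>M\<^esub>"
    and "\<And>x y. \<lbrakk>x \<in> carrier M; y \<in> carrier M; P x; P y\<rbrakk> \<Longrightarrow> P (x \<oplus>\<^bsub>M\<^esub> y)"
    and "\<And>c x. \<lbrakk>c \<in> carrier R; x \<in> carrier M; P x\<rbrakk> \<Longrightarrow> P (c \<odot>\<^bsub>M\<^esub> x)"
    and "\<And>x. x \<in> S \<Longrightarrow> P x"
  shows "P x"
proof -
  have "submodule R {x \<in> carrier M. P x} M"
    by unfold_locales (use assms in auto)
  then have "span S \<subseteq> {x \<in> carrier M. P x}"
    by (intro span_is_subset) (use assms in auto)
  with assms(1) show ?thesis by auto
qed

lemma module_hom_zero:
  assumes "module R M" "module R N" "f \<in> module_hom R M N"
  shows "f \<zero>\<^bsub>M\<^esub> = \<zero>\<^bsub>N\<^esub>"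
proof -
  interpret mod_hom R M N f
    using assms by (simp add: mod_hom_def mod_hom_axioms_def)
  show ?thesis by simp
qed

text \<open>The uniqueness half of every \<open>THE\<close> below: two candidates that agree on
  spanning vectors agree everywhere.\<close>

lemma module_hom_eq_on_span:
  assumes "module R M" "module R N" "f \<in> module_hom R M N" "g \<in> module_hom R M N"
    and "S \<subseteq> carrier M" "x \<in> module.span R M S" "\<And>s. s \<in> S \<Longrightarrow> f s = g s"
  shows "f x = g x"
proof -
  interpret module R M by fact
  from assms(6,5) show ?thesis
    by (induction rule: span_induct)
      (use assms module_hom_zero[OF assms(1-3)] module_hom_zero[OF assms(1,2,4)]
        in \<open>auto simp: module_hom_add module_hom_smult\<close>)
qed

text \<open>Used with \<open>U\<close> zero to see that a map kills all relations, and with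
  \<open>U\<close> a graded piece or a span to see that a map lands there.\<close>

lemma module_hom_span:
  assumes "module R M" "module R N" "f \<in> module_hom R M N"
    and "S \<subseteq> carrier M" "x \<in> module.span R M S" "submodule R U N" "\<And>s. s \<in> S \<Longrightarrow> f s \<in> U"
  shows "f x \<in> U"
proof -
  interpret module R M by fact
  interpret U: submodule R U N by fact
  from assms(5,4) show ?thesis
    by (induction rule: span_induct)
      (use assms module_hom_zero[OF assms(1-3)] in \<open>auto simp: module_hom_add module_hom_smult\<close>)
qed

lemma module_hom_compose:
  "\<lbrakk>f \<in> module_hom R M N; g \<in> module_hom R N L\<rbrakk> \<Longrightarrow> g \<circ> f \<in> module_hom R M L"
  by (auto simp: module_hom_def Pi_iff)

text \<open>Restates the module axioms with the type class operations of \<open>'k\<close> in place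
  of the record \<open>class_ring\<close>, so that field arithmetic applies to scalars.\<close>

lemma class_smult:
  fixes V :: "('k::field, 'v, 'm) module_scheme"
  assumes "module class_ring V" "x \<in> carrier V"
  shows "(c + d) \<odot>\<^bsub>V\<^esub> x = c \<odot>\<^bsub>V\<^esub> x \<oplus>\<^bsub>V\<^esub> d \<odot>\<^bsub>V\<^esub> x"
    and "(c * d) \<odot>\<^bsub>V\<^esub> x = c \<odot>\<^bsub>V\<^esub> (d \<odot>\<^bsub>V\<^esub> x)"
    and "1 \<odot>\<^bsub>V\<^esub> x = x"
    and "0 \<odot>\<^bsub>V\<^esub> x = \<zero>\<^bsub>V\<^esub>"
    and "(- c) \<odot>\<^bsub>V\<^esub> x = \<ominus>\<^bsub>V\<^esub> (c \<odot>\<^bsub>V\<^esub> x)"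
proof -
  interpret module class_ring V by fact
  show "(c + d) \<odot>\<^bsub>V\<^esub> x = c \<odot>\<^bsub>V\<^esub> x \<oplus>\<^bsub>V\<^esub> d \<odot>\<^bsub>V\<^esub> x"
    "(c * d) \<odot>\<^bsub>V\<^esub> x = c \<odot>\<^bsub>V\<^esub> (d \<odot>\<^bsub>V\<^esub> x)"
    "1 \<odot>\<^bsub>V\<^esub> x = x" "0 \<odot>\<^bsub>V\<^esub> x = \<zero>\<^bsub>V\<^esub>"
    "(- c) \<odot>\<^bsub>V\<^esub> x = \<ominus>\<^bsub>V\<^esub> (c \<odot>\<^bsub>V\<^esub> x)"
    using assms(2) smult_l_distr smult_assoc1 smult_one smult_l_null
      smult_l_minus[of c x] by (auto simp: class_ring_simps)
qed

lemma vectorspace_class_ringI: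
  fixes V :: "('k::field, 'v, 'm) module_scheme"
  assumes "abelian_group V"
    and "\<And>c x. x \<in> carrier V \<Longrightarrow> c \<odot>\<^bsub>V\<^esub> x \<in> carrier V"
    and "\<And>c d x. x \<in> carrier V \<Longrightarrow> (c + d) \<odot>\<^bsub>V\<^esub> x = c \<odot>\<^bsub>V\<^esub> x \<oplus>\<^bsub>V\<^esub> d \<odot>\<^bsub>V\<^esub> x"
    and "\<And>c x y. \<lbrakk>x \<in> carrier V; y \<in> carrier V\<rbrakk>
      \<Longrightarrow> c \<odot>\<^bsub>V\<^esub> (x \<oplus>\<^bsub>V\<^esub> y) = c \<odot>\<^bsub>V\<^esub> x \<oplus>\<^bsub>V\<^esub> c \<odot>\<^bsub>V\<^esub> y"
    and "\<And>c d x. x \<in> carrier V \<Longrightarrow> (c * d) \<odot>\<^bsub>V\<^esub> x = c \<odot>\<^bsub>V\<^esub> (d \<odot>\<^bsub>V\<^esub> x)"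
    and "\<And>x. x \<in> carrier V \<Longrightarrow> 1 \<odot>\<^bsub>V\<^esub> x = x"
  shows "vectorspace class_ring V"
proof -
  have "module class_ring V"
    by (rule moduleI) (use assms fieldE(1)[OF class_field] in auto)
  then show ?thesis
    by (simp add: vectorspace_def class_field)
qed

text \<open>Serves records that differ only in multiplication or in extra fields:
  \<open>monoid_algebra\<close> against \<open>free_space\<close>, and \<open>induced_yd\<close>
  against \<open>induced_space\<close>.\<close>

lemma vectorspace_transfer:
  fixes V :: "('k::field, 'v, 'm) module_scheme" and V' :: "('k, 'v, 'n) module_scheme"
  assumes "vectorspace class_ring V"
    and "carrier V' = carrier V" "add V' = add V" "zero V' = zero V" "smult V' = smult V"
  shows "vectorspace class_ring V'"
proof -
  interpret V: vectorspace class_ring V by fact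
  show ?thesis
    by (rule vectorspace_class_ringI, rule abelian_groupI)
      (use assms V.M.l_neg V.smult_l_distr V.smult_r_distr V.smult_assoc1 V.smult_one
       in \<open>auto simp: V.M.a_ac intro!: bexI[of _ "\<ominus>\<^bsub>V\<^esub> _"]\<close>)
qed

locale quotient_space = vectorspace class_ring V + U: submodule class_ring U V
  for V :: "('k::field, 'v, 'm) module_scheme" and U
begin

sublocale U: abelian_subgroup U V
proof -
  have "subgroup U (add_monoid V)"
  proof (rule M.add.subgroupI)
    show "U \<noteq> {}" using U.zero_closed by blast
  next
    fix a assume "a \<in> U"
    then have "(- 1) \<odot>\<^bsub>V\<^esub> a \<in> U" by simp
    moreover have "(- 1) \<odot>\<^bsub>V\<^esub> a = \<ominus>\<^bsub>V\<^esub> a"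
      using smult_minus_1[of a] U.subset \<open>a \<in> U\<close> by (auto simp: class_ring_simps)
    ultimately show "\<ominus>\<^bsub>V\<^esub> a \<in> U" by simp
  qed (use U.subset in auto)
  then show "abelian_subgroup U V"
    by (intro abelian_subgroupI3 additive_subgroupI M.abelian_group_axioms)
qed

abbreviation proj ("\<pi>") where "proj x \<equiv> U +>\<^bsub>V\<^esub> x"

lemma coset_eq_iff:
  assumes "x \<in> carrier V" "y \<in> carrier V"
  shows "\<pi> x = \<pi> y \<longleftrightarrow> x \<ominus>\<^bsub>V\<^esub> y \<in> U"
proof
  assume "\<pi> x = \<pi> y"
  then have "\<pi> (x \<ominus>\<^bsub>V\<^esub> y) = U"
    using M.a_coset_add_inv2[OF _ assms U.subset] by (simp only: a_minus_def)
  then show "x \<ominus>\<^bsub>V\<^esub> y \<in> U"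
    using M.a_coset_join1 U.a_subgroup assms by blast
next
  assume "x \<ominus>\<^bsub>V\<^esub> y \<in> U"
  then show "\<pi> x = \<pi> y"
    using M.a_coset_add_inv1[OF _ assms U.subset]
      M.a_coset_join2[OF M.minus_closed[OF assms] U.a_subgroup]
    by (simp only: a_minus_def)
qed

lemma coset_eq_self_iff: "x \<in> carrier V \<Longrightarrow> \<pi> x = U \<longleftrightarrow> x \<in> U"
  using M.a_coset_join1 M.a_coset_join2 U.a_subgroup by blast

lemma quotient_simps:
  "carrier (quotient_module V U) = \<pi> ` carrier V"
  "zero (quotient_module V U) = U"
  "one (quotient_module V U) = \<pi> (one V)"
  by (auto simp: quotient_module_def A_RCOSETS_def')

lemma quotient_add:
  "\<lbrakk>x \<in> carrier V; y \<in> carrier V\<rbrakk> \<Longrightarrow> \<pi> x \<oplus>\<^bsub>quotient_module V U\<^esub> \<pi> y = \<pi> (x \<oplus>\<^bsub>V\<^esub> y)"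
  by (simp add: quotient_module_def U.a_rcos_sum)

text \<open>Scalar multiplication of a coset is defined as a union over all its representatives. The
  union is one coset because changing the representative by \<open>u\<close> in \<open>U\<close>
  changes the result by a multiple of \<open>u\<close>.\<close>

lemma quotient_smult:
  assumes "x \<in> carrier V"
  shows "c \<odot>\<^bsub>quotient_module V U\<^esub> \<pi> x = \<pi> (c \<odot>\<^bsub>V\<^esub> x)"
proof -
  have *: "\<pi> (c \<odot>\<^bsub>V\<^esub> y) = \<pi> (c \<odot>\<^bsub>V\<^esub> x)" if y: "y \<in> \<pi> x" for y
  proof -
    obtain u where u: "u \<in> U" "y = u \<oplus>\<^bsub>V\<^esub> x"
      using y by (auto simp: a_r_coset_def')
    then have [simp]: "u \<in> carrier V" using U.subset by auto
    have "c \<odot>\<^bsub>V\<^esub> y \<ominus>\<^bsub>V\<^esub> c \<odot>\<^bsub>V\<^esub> x = c \<odot>\<^bsub>V\<^esub> u"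
      using u assms by (simp add: smult_r_distr a_minus_def M.a_assoc M.r_neg)
    then show ?thesis
      using u assms by (subst coset_eq_iff) auto
  qed
  have "c \<odot>\<^bsub>quotient_module V U\<^esub> \<pi> x = (\<Union>y\<in>\<pi> x. \<pi> (c \<odot>\<^bsub>V\<^esub> y))"
    by (simp add: quotient_module_def)
  also have "\<dots> = \<pi> (c \<odot>\<^bsub>V\<^esub> x)"
    by (rule SUP_eq_const[OF _ *]) (use U.a_rcos_self[OF assms] in blast)
  finally show ?thesis .
qed

lemma quotient_vectorspace: "vectorspace class_ring (quotient_module V U)"
proof (rule vectorspace_class_ringI)
  show "abelian_group (quotient_module V U)"
  proof (rule abelian_groupI)
    fix X assume "X \<in> carrier (quotient_module V U)"
    then obtain x where x: "x \<in> carrier V" "X = \<pi> x"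
      by (auto simp: quotient_simps)
    then have "\<pi> (\<ominus>\<^bsub>V\<^esub> x) \<oplus>\<^bsub>quotient_module V U\<^esub> X = \<zero>\<^bsub>quotient_module V U\<^esub>"
      by (simp add: quotient_add quotient_simps M.l_neg coset_eq_self_iff)
    then show "\<exists>Y\<in>carrier (quotient_module V U). Y \<oplus>\<^bsub>quotient_module V U\<^esub> X = \<zero>\<^bsub>quotient_module V U\<^esub>"
      using x by (auto simp: quotient_simps)
    show "\<zero>\<^bsub>quotient_module V U\<^esub> \<oplus>\<^bsub>quotient_module V U\<^esub> X = X"
      using x quotient_add[of "\<zero>\<^bsub>V\<^esub>" x] M.a_coset_add_zero[OF U.subset]
      by (simp add: quotient_simps)
  next
    show "\<zero>\<^bsub>quotient_module V U\<^esub> \<in> carrier (quotient_module V U)"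
      using M.a_coset_add_zero[OF U.subset] by (force simp: quotient_simps)
  qed (auto simp: quotient_simps quotient_add M.a_ac)
qed (auto simp: quotient_simps quotient_add quotient_smult smult_r_distr
    class_smult[OF module_axioms])

lemma proj_hom: "\<pi> \<in> module_hom class_ring V (quotient_module V U)"
  by (auto simp: module_hom_def quotient_simps quotient_add quotient_smult)

text \<open>The universal property of the quotient. The lift evaluates \<open>f\<close> at a chosen
  representative, and \<open>f\<close> vanishing on \<open>U\<close> makes the choice
  immaterial.\<close>

lemma quotient_lift:
  assumes N: "module class_ring N" and f: "f \<in> module_hom class_ring V N"
    and U0: "\<And>u. u \<in> U \<Longrightarrow> f u = \<zero>\<^bsub>N\<^esub>"
  obtains g where "g \<in> module_hom class_ring (quotient_module V U) N"
    and "\<And>x. x \<in> carrier V \<Longrightarrow> g (\<pi> x) = f x"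
proof -
  interpret f: mod_hom class_ring V N f
    using assms module_axioms by (simp add: mod_hom_def mod_hom_axioms_def)
  define g where "g X = f (SOME x. x \<in> carrier V \<and> X = \<pi> x)" for X
  have g: "g (\<pi> x) = f x" if x: "x \<in> carrier V" for x
  proof -
    define y where "y = (SOME y. y \<in> carrier V \<and> \<pi> x = \<pi> y)"
    have y: "y \<in> carrier V" "\<pi> x = \<pi> y"
      using someI[of "\<lambda>y. y \<in> carrier V \<and> \<pi> x = \<pi> y" x] x by (auto simp: y_def)
    then have "f (x \<ominus>\<^bsub>V\<^esub> y) = \<zero>\<^bsub>N\<^esub>"
      using x U0 coset_eq_iff by blast
    then have "f x = f y"
      using x y abelian_group.minus_other_side[OF module.axioms(2)[OF N]] by simp
    then show ?thesis by (simp add: g_def y_def)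
  qed
  have "g \<in> module_hom class_ring (quotient_module V U) N"
    by (auto simp: module_hom_def quotient_simps quotient_add quotient_smult g)
  then show thesis using g that by blast
qed

lemma quotient_span:
  assumes S: "S \<subseteq> carrier V" and span: "span S = carrier V"
  shows "lspan (quotient_module V U) (\<pi> ` S)
    = carrier (quotient_module V U)"
proof -
  let ?Q = "quotient_module V U"
  have Q: "module class_ring ?Q"
    using quotient_vectorspace by (simp add: vectorspace_def)
  have S': "\<pi> ` S \<subseteq> carrier ?Q"
    using S by (auto simp: quotient_simps)
  have "\<pi> x \<in> lspan ?Q (\<pi> ` S)" if "x \<in> carrier V" for x
  proof (rule module_hom_span[OF module_axioms Q proj_hom S])
    show "x \<in> span S" using that span by simp
    show "submodule class_ring (lspan ?Q (\<pi> ` S)) ?Q"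
      by (rule LinearCombinations.module.span_is_submodule[OF Q S'])
    show "\<pi> s \<in> lspan ?Q (\<pi> ` S)" if "s \<in> S" for s
      using LinearCombinations.module.in_own_span[OF Q S'] that by blast
  qed
  then show ?thesis
    using LinearCombinations.module.span_is_subset2[OF Q S'] by (auto simp: quotient_simps)
qed

end

section \<open>Free spaces\<close>

lemma lookup_scale: "Poly_Mapping.lookup (Poly_Mapping.map ((*) c) p) x = (c::'k::field) * Poly_Mapping.lookup p x"
  by (simp add: Poly_Mapping.map.rep_eq when_def)

lemma scale_single: "Poly_Mapping.map ((*) c) (Poly_Mapping.single x d) = Poly_Mapping.single x ((c::'k::field) * d)"
  by (rule poly_mapping_eqI) (simp add: lookup_scale lookup_single when_def)

lemma keys_scale_subset: "Poly_Mapping.keys (Poly_Mapping.map ((*) (c::'k::field)) p) \<subseteq> Poly_Mapping.keys p"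
  by (auto simp: in_keys_iff lookup_scale)

lemma poly_mapping_sum_singles:
  "finite A \<Longrightarrow> Poly_Mapping.keys p \<subseteq> A \<Longrightarrow>
    (\<Sum>x\<in>A. Poly_Mapping.single x (Poly_Mapping.lookup p x)) = p"
  by (rule poly_mapping_eqI)
    (auto simp: lookup_sum lookup_single when_def sum.delta in_keys_iff)

lemma free_space_simps:
  "carrier (free_space X) = {p. Poly_Mapping.keys p \<subseteq> X}"
  "zero (free_space X) = 0"
  "add (free_space X) = (+)"
  "smult (free_space X) = (\<lambda>c. Poly_Mapping.map ((*) c))"
  by (simp_all add: free_space_def)

lemma single_in_free_space: "x \<in> X \<Longrightarrow> Poly_Mapping.single x c \<in> carrier (free_space X)"
  by (auto simp: free_space_simps)

lemma free_space_vectorspace: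
  "vectorspace class_ring (free_space X :: ('k::field, 'x \<Rightarrow>\<^sub>0 'k) module)"
proof -
  let ?V = "free_space X :: ('k, 'x \<Rightarrow>\<^sub>0 'k) module"
  have add: "p + q \<in> carrier ?V" if "p \<in> carrier ?V" "q \<in> carrier ?V" for p q
    using that keys_add[of p q] by (auto simp: free_space_simps)
  have smult: "Poly_Mapping.map ((*) c) p \<in> carrier ?V" if "p \<in> carrier ?V" for c p
    using that keys_scale_subset[of c p] by (auto simp: free_space_simps)
  have minus: "- p \<in> carrier ?V" if "p \<in> carrier ?V" for p
    using that by (auto simp: free_space_simps in_keys_iff)
  note simps = free_space_simps(2-4)
  have "abelian_group ?V"
  proof (rule abelian_groupI)
    show "\<exists>q\<in>carrier ?V. q \<oplus>\<^bsub>?V\<^esub> p = \<zero>\<^bsub>?V\<^esub>" if "p \<in> carrier ?V" for p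
      using minus[OF that] by (intro bexI[of _ "- p"]) (simp_all add: simps)
    show "\<zero>\<^bsub>?V\<^esub> \<in> carrier ?V" by (simp add: free_space_simps)
  qed (use add in \<open>simp_all add: simps add.assoc add.commute\<close>)
  then show ?thesis
    by (rule vectorspace_class_ringI)
      (use smult in \<open>simp_all add: simps poly_mapping_eq_iff fun_eq_iff lookup_scale lookup_add
        distrib_left distrib_right mult.assoc\<close>)
qed

interpretation free_space: vectorspace class_ring "free_space X"
  by (rule free_space_vectorspace)

lemma free_space_span: "lspan (free_space X) ((\<lambda>x. Poly_Mapping.single x 1) ` X) = carrier (free_space X)"
proof
  let ?S = "(\<lambda>x. Poly_Mapping.single x 1) ` X"
  have S: "?S \<subseteq> carrier (free_space X)" by (auto simp: free_space_simps)
  then show "lspan (free_space X) ?S \<subseteq> carrier (free_space X)"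
    by (rule free_space.span_is_subset2)
  interpret span: submodule class_ring "lspan (free_space X) ?S" "free_space X"
    by (rule free_space.span_is_submodule[OF S])
  have "(\<Sum>x\<in>A. Poly_Mapping.single x (f x)) \<in> lspan (free_space X) ?S" if "finite A" "A \<subseteq> X" for A f
    using that
  proof (induction A)
    case empty
    then show ?case using span.zero_closed by (simp add: free_space_simps)
  next
    case (insert x A)
    have "Poly_Mapping.single x 1 \<in> lspan (free_space X) ?S"
      using free_space.in_own_span[OF S] insert by auto
    then have "Poly_Mapping.single x (f x) \<in> lspan (free_space X) ?S"
      using span.smult_closed[of "f x" "Poly_Mapping.single x 1"] by (simp add: free_space_simps scale_single)
    then show ?case
      using insert span.m_closed by (simp add: free_space_simps)
  qed
  from this[of "Poly_Mapping.keys p" "Poly_Mapping.lookup p" for p]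
  show "carrier (free_space X) \<subseteq> lspan (free_space X) ?S"
    by (auto simp: free_space_simps poly_mapping_sum_singles)
qed

text \<open>The defining relations are written with the subtraction of the type, whereas the theory
  of cosets uses that of the record; this translates between them.\<close>

lemma free_space_minus:
  assumes "p \<in> carrier (free_space X)" "q \<in> carrier (free_space X)"
  shows "p - q \<in> carrier (free_space X)" "p - q = p \<ominus>\<^bsub>free_space X\<^esub> q"
proof -
  have q: "- q \<in> carrier (free_space X)"
    using assms(2) by (auto simp: free_space_simps in_keys_iff)
  have "- q = \<ominus>\<^bsub>free_space X\<^esub> q"
    by (rule free_space.M.minus_equality[symmetric]) (use assms q in \<open>auto simp: free_space_simps\<close>)
  then show eq: "p - q = p \<ominus>\<^bsub>free_space X\<^esub> q"
    by (simp add: a_minus_def free_space_simps)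
  show "p - q \<in> carrier (free_space X)"
    unfolding eq using assms by simp
qed

definition linear_extension ::
  "('k::field, 'v, 'm) module_scheme \<Rightarrow> ('x \<Rightarrow> 'v) \<Rightarrow> ('x \<Rightarrow>\<^sub>0 'k) \<Rightarrow> 'v"
  where "linear_extension N F p =
    (\<Oplus>\<^bsub>N\<^esub> x \<in> Poly_Mapping.keys p. Poly_Mapping.lookup p x \<odot>\<^bsub>N\<^esub> F x)"

context
  fixes N :: "('k::field, 'v, 'm) module_scheme" and F :: "'x \<Rightarrow> 'v" and X :: "'x set"
  assumes N: "module class_ring N" and F: "F \<in> X \<rightarrow> carrier N"
begin

interpretation N: module class_ring N by (rule N)

text \<open>Two finitely supported functions and their sum have different supports. Summing over a
  common superset makes termwise addition possible.\<close>

lemma linear_extension_superset: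
  assumes "finite A" "Poly_Mapping.keys p \<subseteq> A" "A \<subseteq> X"
  shows "linear_extension N F p = (\<Oplus>\<^bsub>N\<^esub> x \<in> A. Poly_Mapping.lookup p x \<odot>\<^bsub>N\<^esub> F x)"
  unfolding linear_extension_def
  by (rule N.M.add.finprod_mono_neutral_cong_left)
    (use assms F in \<open>auto simp: in_keys_iff class_smult[OF N] Pi_iff subset_eq\<close>)

lemma linear_extension_hom: "linear_extension N F \<in> module_hom class_ring (free_space X) N"
proof -
  have closed: "linear_extension N F p \<in> carrier N" if "p \<in> carrier (free_space X)" for p
    unfolding linear_extension_def
    using that F by (intro N.M.finsum_closed) (auto simp: free_space_simps Pi_iff subset_eq)
  have "linear_extension N F (p + q) = linear_extension N F p \<oplus>\<^bsub>N\<^esub> linear_extension N F q"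
    if "p \<in> carrier (free_space X)" "q \<in> carrier (free_space X)" for p q
  proof -
    define A where "A = Poly_Mapping.keys p \<union> Poly_Mapping.keys q"
    have A: "finite A" "A \<subseteq> X" "Poly_Mapping.keys p \<subseteq> A" "Poly_Mapping.keys q \<subseteq> A"
      "Poly_Mapping.keys (p + q) \<subseteq> A"
      using that keys_add[of p q] by (auto simp: A_def free_space_simps)
    have "linear_extension N F (p + q)
      = (\<Oplus>\<^bsub>N\<^esub> x\<in>A. Poly_Mapping.lookup p x \<odot>\<^bsub>N\<^esub> F x \<oplus>\<^bsub>N\<^esub> Poly_Mapping.lookup q x \<odot>\<^bsub>N\<^esub> F x)"
      unfolding linear_extension_superset[OF A(1,5,2)]
      by (rule N.M.finsum_cong')
        (use A F in \<open>auto simp: lookup_add class_smult[OF N] subset_eq Pi_iff\<close>)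
    also have "\<dots> = linear_extension N F p \<oplus>\<^bsub>N\<^esub> linear_extension N F q"
      unfolding linear_extension_superset[OF A(1,3,2)] linear_extension_superset[OF A(1,4,2)]
      by (rule N.M.finsum_addf) (use A F in \<open>auto simp: Pi_iff subset_eq\<close>)
    finally show ?thesis .
  qed
  moreover have "linear_extension N F (Poly_Mapping.map ((*) c) p) = c \<odot>\<^bsub>N\<^esub> linear_extension N F p"
    if "p \<in> carrier (free_space X)" for c p
  proof -
    have A: "Poly_Mapping.keys p \<subseteq> X" using that by (simp add: free_space_simps)
    have "linear_extension N F (Poly_Mapping.map ((*) c) p)
      = (\<Oplus>\<^bsub>N\<^esub> x\<in>Poly_Mapping.keys p. c \<odot>\<^bsub>N\<^esub> (Poly_Mapping.lookup p x \<odot>\<^bsub>N\<^esub> F x))"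
      unfolding linear_extension_superset[OF finite_keys keys_scale_subset A]
      by (rule N.M.finsum_cong')
        (use A F in \<open>auto simp: lookup_scale class_smult[OF N] subset_eq Pi_iff\<close>)
    also have "\<dots> = c \<odot>\<^bsub>N\<^esub> linear_extension N F p"
      unfolding linear_extension_def
      by (rule N.finsum_smult[symmetric]) (use A F in \<open>auto simp: Pi_iff subset_eq\<close>)
    finally show ?thesis .
  qed
  ultimately show ?thesis
    using closed by (auto simp: module_hom_def free_space_simps)
qed

lemma linear_extension_single:
  assumes "x \<in> X"
  shows "linear_extension N F (Poly_Mapping.single x c) = c \<odot>\<^bsub>N\<^esub> F x"
proof -
  have "F x \<in> carrier N" using assms F by auto
  then show ?thesis
    by (subst linear_extension_superset[of "{x}"]) (use assms in auto)
qed

lemma linear_extension_minus: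
  assumes "p \<in> carrier (free_space X)" "q \<in> carrier (free_space X)"
  shows "linear_extension N F (p - q) = linear_extension N F p \<ominus>\<^bsub>N\<^esub> linear_extension N F q"
proof -
  interpret mod_hom class_ring "free_space X" N "linear_extension N F"
    by (simp add: mod_hom_def mod_hom_axioms_def N free_space.module_axioms linear_extension_hom)
  show ?thesis
    using assms by (simp only: free_space_minus f_minus)
qed

end

section \<open>Algebras\<close>

locale assoc_algebra = ring A + VS: vectorspace class_ring A
  for A :: "('k::field, 'a, 'm) module_scheme" (structure) +
  assumes smult_mult_l: "\<lbrakk>x \<in> carrier A; y \<in> carrier A\<rbrakk> \<Longrightarrow> (c \<odot> x) \<otimes> y = c \<odot> (x \<otimes> y)"
    and smult_mult_r: "\<lbrakk>x \<in> carrier A; y \<in> carrier A\<rbrakk> \<Longrightarrow> x \<otimes> (c \<odot> y) = c \<odot> (x \<otimes> y)"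

lemma assoc_algebraI:
  fixes A (structure)
  assumes vs: "vectorspace class_ring A"
    and "\<one> \<in> carrier A"
    and "\<And>x y. \<lbrakk>x \<in> carrier A; y \<in> carrier A\<rbrakk> \<Longrightarrow> x \<otimes> y \<in> carrier A"
    and "\<And>x y z. \<lbrakk>x \<in> carrier A; y \<in> carrier A; z \<in> carrier A\<rbrakk> \<Longrightarrow> x \<otimes> y \<otimes> z = x \<otimes> (y \<otimes> z)"
    and "\<And>x. x \<in> carrier A \<Longrightarrow> \<one> \<otimes> x = x" "\<And>x. x \<in> carrier A \<Longrightarrow> x \<otimes> \<one> = x"
    and "\<And>x y z. \<lbrakk>x \<in> carrier A; y \<in> carrier A; z \<in> carrier A\<rbrakk> \<Longrightarrow> (x \<oplus> y) \<otimes> z = x \<otimes> z \<oplus> y \<otimes> z"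
    and "\<And>x y z. \<lbrakk>x \<in> carrier A; y \<in> carrier A; z \<in> carrier A\<rbrakk> \<Longrightarrow> z \<otimes> (x \<oplus> y) = z \<otimes> x \<oplus> z \<otimes> y"
    and "\<And>c x y. \<lbrakk>x \<in> carrier A; y \<in> carrier A\<rbrakk> \<Longrightarrow> (c \<odot> x) \<otimes> y = c \<odot> (x \<otimes> y)"
    and "\<And>c x y. \<lbrakk>x \<in> carrier A; y \<in> carrier A\<rbrakk> \<Longrightarrow> x \<otimes> (c \<odot> y) = c \<odot> (x \<otimes> y)"
  shows "assoc_algebra A"
proof -
  interpret vectorspace class_ring A by (rule vs)
  have "ring A"
    by (rule ringI[OF M.abelian_group_axioms monoidI]) (use assms in auto)
  then show ?thesis
    using assms by (simp add: assoc_algebra_def assoc_algebra_axioms_def)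
qed

context assoc_algebra
begin

lemma mult_right_hom: "y \<in> carrier A \<Longrightarrow> (\<lambda>x. x \<otimes> y) \<in> module_hom class_ring A A"
  by (auto simp: module_hom_def l_distr smult_mult_l)

lemma mult_left_hom: "y \<in> carrier A \<Longrightarrow> (\<lambda>x. y \<otimes> x) \<in> module_hom class_ring A A"
  by (auto simp: module_hom_def r_distr smult_mult_r)

text \<open>Ring ideals know nothing of scalars, but scaling by \<open>c\<close> is multiplication
  by the algebra element \<open>c\<close> times one.\<close>

lemma ideal_submodule:
  assumes "ideal I A"
  shows "submodule class_ring I A"
proof -
  interpret I: ideal I A by fact
  show ?thesis
  proof
    fix c v assume v: "v \<in> I"
    then have [simp]: "v \<in> carrier A" using I.a_subset by auto
    have "(c \<odot> \<one>) \<otimes> v \<in> I" using v by (intro I.I_l_closed) auto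
    then show "c \<odot> v \<in> I" by (simp add: smult_mult_l)
  qed (use I.a_subset in \<open>auto intro: VS.module_axioms\<close>)
qed

text \<open>Multiplying \<open>a x b\<close> by an element of \<open>S\<close> absorbs it into
  \<open>a\<close> or \<open>b\<close>, so the span is stable under \<open>S\<close>, and by
  linearity under the whole algebra. It is applied to the relations of T(V), with \<open>S\<close>
  the words, and to the squares, with \<open>S\<close> the pure tensors.\<close>

lemma genideal_eq_span:
  assumes S: "S \<subseteq> carrier A" "\<one> \<in> S" "\<And>a b. \<lbrakk>a \<in> S; b \<in> S\<rbrakk> \<Longrightarrow> a \<otimes> b \<in> S"
    and span: "VS.span S = carrier A"
    and X: "X \<subseteq> carrier A"
  shows "genideal A X = VS.span {a \<otimes> x \<otimes> b | a x b. a \<in> S \<and> x \<in> X \<and> b \<in> S}" (is "_ = VS.span ?G")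
proof
  have G: "?G \<subseteq> carrier A" using S(1) X by auto
  interpret span: submodule class_ring "VS.span ?G" A
    by (rule VS.span_is_submodule[OF G])
  interpret Q: quotient_space A "VS.span ?G" ..
  have gen: "?G \<subseteq> VS.span ?G" by (rule VS.in_own_span[OF G])
  have left: "s \<otimes> y \<in> VS.span ?G" if s: "s \<in> S" and y: "y \<in> VS.span ?G" for s y
  proof (rule module_hom_span[OF VS.module_axioms VS.module_axioms mult_left_hom G y span.submodule_axioms])
    show sc: "s \<in> carrier A" using s S(1) by auto
    fix g assume "g \<in> ?G"
    then obtain a x b where g: "g = a \<otimes> x \<otimes> b" "a \<in> S" "x \<in> X" "b \<in> S" by auto
    have gc: "a \<in> carrier A" "x \<in> carrier A" "b \<in> carrier A" using g S(1) X by auto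
    have "s \<otimes> g = (s \<otimes> a) \<otimes> x \<otimes> b"
      unfolding g(1) using gc sc by (simp add: m_assoc)
    moreover have "s \<otimes> a \<in> S" using g s S(3) by simp
    ultimately have "s \<otimes> g \<in> ?G" using g by auto
    then show "s \<otimes> g \<in> VS.span ?G" by (rule subsetD[OF gen])
  qed
  have right: "y \<otimes> s \<in> VS.span ?G" if s: "s \<in> S" and y: "y \<in> VS.span ?G" for s y
  proof (rule module_hom_span[OF VS.module_axioms VS.module_axioms mult_right_hom G y span.submodule_axioms])
    show sc: "s \<in> carrier A" using s S(1) by auto
    fix g assume "g \<in> ?G"
    then obtain a x b where g: "g = a \<otimes> x \<otimes> b" "a \<in> S" "x \<in> X" "b \<in> S" by auto
    have gc: "a \<in> carrier A" "x \<in> carrier A" "b \<in> carrier A" using g S(1) X by auto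
    have "g \<otimes> s = a \<otimes> x \<otimes> (b \<otimes> s)"
      unfolding g(1) using gc sc by (simp add: m_assoc)
    moreover have "b \<otimes> s \<in> S" using g s S(3) by simp
    ultimately have "g \<otimes> s \<in> ?G" using g by auto
    then show "g \<otimes> s \<in> VS.span ?G" by (rule subsetD[OF gen])
  qed
  have "ideal (VS.span ?G) A"
  proof (rule idealI[OF ring_axioms Q.U.a_subgroup])
    fix y z assume y: "y \<in> VS.span ?G" and z: "z \<in> carrier A"
    have yc: "y \<in> carrier A" using y span.subset by auto
    \<comment> \<open>Here \<open>y\<close> is fixed and the outer factor \<open>z\<close> varies
      over the span of \<open>S\<close>; the facts \<open>left\<close> and \<open>right\<close>
      treat the case of an outer factor in \<open>S\<close>.\<close>
    show "z \<otimes> y \<in> VS.span ?G"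
      by (rule module_hom_span[OF VS.module_axioms VS.module_axioms mult_right_hom[OF yc] S(1) _ span.submodule_axioms])
        (use span z left y in auto)
    show "y \<otimes> z \<in> VS.span ?G"
      by (rule module_hom_span[OF VS.module_axioms VS.module_axioms mult_left_hom[OF yc] S(1) _ span.submodule_axioms])
        (use span z right y in auto)
  qed
  moreover have "X \<subseteq> VS.span ?G"
  proof
    fix x assume "x \<in> X"
    then have "x = \<one> \<otimes> x \<otimes> \<one>" using X by auto
    then have "x \<in> ?G"
      using \<open>x \<in> X\<close> S(2) by (intro CollectI exI[of _ \<one>] exI[of _ x]) simp
    then show "x \<in> VS.span ?G" by (rule subsetD[OF gen])
  qed
  ultimately show "genideal A X \<subseteq> VS.span ?G"
    by (rule genideal_minimal)
  interpret I: ideal "genideal A X" A by (rule genideal_ideal[OF X])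
  show "VS.span ?G \<subseteq> genideal A X"
  proof (rule VS.span_is_subset)
    have "a \<otimes> x \<otimes> b \<in> genideal A X" if "a \<in> S" "x \<in> X" "b \<in> S" for a x b
      by (intro I.I_l_closed I.I_r_closed) (use that genideal_self[OF X] S(1) in auto)
    then show "?G \<subseteq> genideal A X" by blast
    show "submodule class_ring (genideal A X) A"
      by (rule ideal_submodule) (rule I.ideal_axioms)
  qed
qed

lemma quotient_mult:
  assumes "ideal I A" "x \<in> carrier A" "y \<in> carrier A"
  shows "(I +> x) \<otimes>\<^bsub>quotient_module A I\<^esub> (I +> y) = I +> (x \<otimes> y)"
  using ideal.rcoset_mult_add[OF assms] by (simp add: quotient_module_def)

lemma quotient_assoc_algebra:
  assumes I: "ideal I A"
  shows "assoc_algebra (quotient_module A I)"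
proof -
  interpret Q: quotient_space A I
    using ideal_submodule[OF I] VS.vectorspace_axioms by (simp add: quotient_space_def)
  show ?thesis
    by (rule assoc_algebraI[OF Q.quotient_vectorspace])
      (auto simp: Q.quotient_simps Q.quotient_add Q.quotient_smult quotient_mult[OF I]
        m_assoc l_distr r_distr smult_mult_l smult_mult_r)
qed

end

section \<open>Monoid algebras\<close>

lemma monoid_algebra_simps:
  "carrier (monoid_algebra M) = {p. Poly_Mapping.keys p \<subseteq> carrier M}"
  "zero (monoid_algebra M) = 0"
  "add (monoid_algebra M) = (+)"
  "smult (monoid_algebra M) = (\<lambda>c. Poly_Mapping.map ((*) c))"
  "one (monoid_algebra M) = Poly_Mapping.single \<one>\<^bsub>M\<^esub> 1"
  by (simp_all add: monoid_algebra_def free_space_simps)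

lemma monoid_algebra_mult:
  assumes "finite A" "Poly_Mapping.keys p \<subseteq> A" "finite B" "Poly_Mapping.keys q \<subseteq> B"
  shows "p \<otimes>\<^bsub>monoid_algebra M\<^esub> q = (\<Sum>x\<in>A. \<Sum>y\<in>B.
    Poly_Mapping.single (x \<otimes>\<^bsub>M\<^esub> y) (Poly_Mapping.lookup p x * Poly_Mapping.lookup q y))"
proof -
  have "p \<otimes>\<^bsub>monoid_algebra M\<^esub> q = (\<Sum>x\<in>Poly_Mapping.keys p. \<Sum>y\<in>B.
    Poly_Mapping.single (x \<otimes>\<^bsub>M\<^esub> y) (Poly_Mapping.lookup p x * Poly_Mapping.lookup q y))"
    unfolding monoid_algebra_def using assms
    by (simp, intro sum.cong refl sum.mono_neutral_left) (auto simp: in_keys_iff)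
  also have "\<dots> = (\<Sum>x\<in>A. \<Sum>y\<in>B.
    Poly_Mapping.single (x \<otimes>\<^bsub>M\<^esub> y) (Poly_Mapping.lookup p x * Poly_Mapping.lookup q y))"
    using assms by (intro sum.mono_neutral_left) (auto simp: in_keys_iff)
  finally show ?thesis .
qed

lemma monoid_algebra_mult_single:
  "Poly_Mapping.single x a \<otimes>\<^bsub>monoid_algebra M\<^esub> Poly_Mapping.single y b
    = Poly_Mapping.single (x \<otimes>\<^bsub>M\<^esub> y) (a * b)"
  by (subst monoid_algebra_mult[of "{x}" _ "{y}"]) auto

lemma monoid_algebra_distrib:
  "(p + q) \<otimes>\<^bsub>monoid_algebra M\<^esub> r = p \<otimes>\<^bsub>monoid_algebra M\<^esub> r + q \<otimes>\<^bsub>monoid_algebra M\<^esub> r" (is ?A)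
  "r \<otimes>\<^bsub>monoid_algebra M\<^esub> (p + q) = r \<otimes>\<^bsub>monoid_algebra M\<^esub> p + r \<otimes>\<^bsub>monoid_algebra M\<^esub> q" (is ?B)
proof -
  define A where "A = Poly_Mapping.keys p \<union> Poly_Mapping.keys q"
  define B where "B = Poly_Mapping.keys r"
  note * = monoid_algebra_mult[of A _ B _ M] monoid_algebra_mult[of B _ A _ M]
  have "finite A" "finite B" "Poly_Mapping.keys p \<subseteq> A" "Poly_Mapping.keys q \<subseteq> A"
    "Poly_Mapping.keys (p + q) \<subseteq> A" "Poly_Mapping.keys r \<subseteq> B"
    using keys_add[of p q] by (auto simp: A_def B_def)
  then show ?A ?B
    by (simp_all add: * lookup_add distrib_left distrib_right single_add sum.distrib)
qed

lemma scale_sum: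
  "Poly_Mapping.map ((*) (c::'k::field)) (\<Sum>x\<in>A. f x) = (\<Sum>x\<in>A. Poly_Mapping.map ((*) c) (f x))"
  by (rule poly_mapping_eqI) (simp add: lookup_scale lookup_sum sum_distrib_left)

lemma monoid_algebra_scale:
  "Poly_Mapping.map ((*) c) p \<otimes>\<^bsub>monoid_algebra M\<^esub> q
    = Poly_Mapping.map ((*) c) (p \<otimes>\<^bsub>monoid_algebra M\<^esub> q)" (is ?A)
  "p \<otimes>\<^bsub>monoid_algebra M\<^esub> Poly_Mapping.map ((*) c) q
    = Poly_Mapping.map ((*) c) (p \<otimes>\<^bsub>monoid_algebra M\<^esub> q)" (is ?B)
proof -
  define A where "A = Poly_Mapping.keys p"
  define B where "B = Poly_Mapping.keys q"
  note * = monoid_algebra_mult[of A _ B _ M]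
  have "finite A" "finite B" "Poly_Mapping.keys p \<subseteq> A" "Poly_Mapping.keys q \<subseteq> B"
    "Poly_Mapping.keys (Poly_Mapping.map ((*) c) p) \<subseteq> A"
    "Poly_Mapping.keys (Poly_Mapping.map ((*) c) q) \<subseteq> B"
    using keys_scale_subset[of c p] keys_scale_subset[of c q] by (auto simp: A_def B_def)
  then show ?A ?B
    by (simp_all add: * lookup_scale scale_sum scale_single mult.assoc mult.left_commute)
qed

lemma monoid_algebra_vectorspace: "vectorspace class_ring (monoid_algebra M)"
  by (rule vectorspace_transfer[OF free_space_vectorspace[of "carrier M"]])
    (simp_all add: monoid_algebra_simps free_space_simps)

text \<open>A span depends on the record in which it is formed. The result for
  \<open>free_space\<close> is carried over because a span formed in one record is a submodule in
  the other.\<close>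

lemma monoid_algebra_span:
  "lspan (monoid_algebra M) ((\<lambda>x. Poly_Mapping.single x 1) ` carrier M) = carrier (monoid_algebra M)"
    (is "lspan (monoid_algebra M) ?S = _")
proof
  interpret monoid_algebra: vectorspace class_ring "monoid_algebra M"
    by (rule monoid_algebra_vectorspace)
  have S: "?S \<subseteq> carrier (monoid_algebra M)" by (auto simp: monoid_algebra_simps)
  then show "lspan (monoid_algebra M) ?S \<subseteq> carrier (monoid_algebra M)"
    by (rule monoid_algebra.span_is_subset2)
  interpret span: submodule class_ring "lspan (monoid_algebra M) ?S" "monoid_algebra M"
    by (rule monoid_algebra.span_is_submodule[OF S])
  have "submodule class_ring (lspan (monoid_algebra M) ?S) (free_space (carrier M))"
    by unfold_locales (use span.subset span.m_closed span.zero_closed span.smult_closed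
      in \<open>auto simp: monoid_algebra_simps free_space_simps\<close>)
  then have "lspan (free_space (carrier M)) ?S \<subseteq> lspan (monoid_algebra M) ?S"
    using monoid_algebra.in_own_span[OF S] by (intro free_space.span_is_subset)
  then show "carrier (monoid_algebra M) \<subseteq> lspan (monoid_algebra M) ?S"
    by (simp add: free_space_span monoid_algebra_simps free_space_simps)
qed


text \<open>Each law is linear in every argument, so it reduces to basis elements, one argument per
  induction, where it is a law of \<open>M\<close>. Distributivity and compatibility with scalars
  hold without carrier conditions and are therefore available before closure.\<close>

lemma monoid_algebra_assoc_algebra:
  assumes "monoid M"
  shows "assoc_algebra (monoid_algebra M)"
proof -
  interpret M: monoid M by fact
  let ?A = "monoid_algebra M"
  let ?S = "(\<lambda>x. Poly_Mapping.single x 1) ` carrier M"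
  interpret A: vectorspace class_ring ?A by (rule monoid_algebra_vectorspace)
  have S: "?S \<subseteq> carrier ?A" by (auto simp: monoid_algebra_simps)
  have in_span: "p \<in> lspan ?A ?S" if "p \<in> carrier ?A" for p
    using that by (simp add: monoid_algebra_span)
  have distrib: "(p \<oplus>\<^bsub>?A\<^esub> q) \<otimes>\<^bsub>?A\<^esub> r = p \<otimes>\<^bsub>?A\<^esub> r \<oplus>\<^bsub>?A\<^esub> q \<otimes>\<^bsub>?A\<^esub> r"
    "r \<otimes>\<^bsub>?A\<^esub> (p \<oplus>\<^bsub>?A\<^esub> q) = r \<otimes>\<^bsub>?A\<^esub> p \<oplus>\<^bsub>?A\<^esub> r \<otimes>\<^bsub>?A\<^esub> q" for p q r
    by (simp_all add: monoid_algebra_simps monoid_algebra_distrib)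
  have scale: "(c \<odot>\<^bsub>?A\<^esub> p) \<otimes>\<^bsub>?A\<^esub> q = c \<odot>\<^bsub>?A\<^esub> (p \<otimes>\<^bsub>?A\<^esub> q)"
    "p \<otimes>\<^bsub>?A\<^esub> (c \<odot>\<^bsub>?A\<^esub> q) = c \<odot>\<^bsub>?A\<^esub> (p \<otimes>\<^bsub>?A\<^esub> q)" for c p q
    by (simp_all add: monoid_algebra_simps monoid_algebra_scale)
  \<comment> \<open>The inductions that establish closure already need the zero case, so it is read
    off from an empty sum instead of ring theory.\<close>
  have zero: "\<zero>\<^bsub>?A\<^esub> \<otimes>\<^bsub>?A\<^esub> q = \<zero>\<^bsub>?A\<^esub>" "q \<otimes>\<^bsub>?A\<^esub> \<zero>\<^bsub>?A\<^esub> = \<zero>\<^bsub>?A\<^esub>" for q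
    using monoid_algebra_mult[of "{}" 0 "Poly_Mapping.keys q" q M]
      monoid_algebra_mult[of "Poly_Mapping.keys q" q "{}" 0 M]
    by (simp_all add: monoid_algebra_simps)
  have mult_S: "s \<otimes>\<^bsub>?A\<^esub> t \<in> ?S" if "s \<in> ?S" "t \<in> ?S" for s t
    using that by (auto simp: monoid_algebra_mult_single)
  have closed1: "s \<otimes>\<^bsub>?A\<^esub> q \<in> carrier ?A" if "s \<in> ?S" "q \<in> carrier ?A" for s q
    using in_span[OF that(2)] S
    by (induction rule: A.span_induct)
      (use mult_S[OF that(1)] S in \<open>auto simp: distrib(2) scale(2) zero(2)\<close>)
  have closed: "p \<otimes>\<^bsub>?A\<^esub> q \<in> carrier ?A" if "p \<in> carrier ?A" "q \<in> carrier ?A" for p q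
    using in_span[OF that(1)] S
    by (induction rule: A.span_induct)
      (use closed1 that in \<open>auto simp: distrib(1) scale(1) zero(1)\<close>)
  have assoc2: "s \<otimes>\<^bsub>?A\<^esub> t \<otimes>\<^bsub>?A\<^esub> r = s \<otimes>\<^bsub>?A\<^esub> (t \<otimes>\<^bsub>?A\<^esub> r)"
    if "s \<in> ?S" "t \<in> ?S" "r \<in> carrier ?A" for s t r
    using in_span[OF that(3)] S
    by (induction rule: A.span_induct)
      (use that in \<open>auto simp: distrib(2) scale(2) zero(2) monoid_algebra_mult_single M.m_assoc\<close>)
  have assoc1: "s \<otimes>\<^bsub>?A\<^esub> q \<otimes>\<^bsub>?A\<^esub> r = s \<otimes>\<^bsub>?A\<^esub> (q \<otimes>\<^bsub>?A\<^esub> r)"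
    if "s \<in> ?S" "q \<in> carrier ?A" "r \<in> carrier ?A" for s q r
    using in_span[OF that(2)] S
    by (induction rule: A.span_induct) (use that assoc2 in \<open>simp_all add: distrib scale zero\<close>)
  have assoc: "p \<otimes>\<^bsub>?A\<^esub> q \<otimes>\<^bsub>?A\<^esub> r = p \<otimes>\<^bsub>?A\<^esub> (q \<otimes>\<^bsub>?A\<^esub> r)"
    if "p \<in> carrier ?A" "q \<in> carrier ?A" "r \<in> carrier ?A" for p q r
    using in_span[OF that(1)] S
    by (induction rule: A.span_induct) (use that assoc1 in \<open>simp_all add: distrib scale zero\<close>)
  have one: "\<one>\<^bsub>?A\<^esub> \<otimes>\<^bsub>?A\<^esub> p = p" "p \<otimes>\<^bsub>?A\<^esub> \<one>\<^bsub>?A\<^esub> = p" if "p \<in> carrier ?A" for p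
    using in_span[OF that] S
    by (induction rule: A.span_induct, simp_all add: distrib scale zero)
      (auto simp: monoid_algebra_simps(5) monoid_algebra_mult_single)
  have "\<one>\<^bsub>?A\<^esub> \<in> carrier ?A" by (simp add: monoid_algebra_simps)
  then show ?thesis
    by (rule assoc_algebraI[OF monoid_algebra_vectorspace])
      (simp_all add: closed assoc one distrib scale)
qed


lemma monoid_algebra_minus:
  assumes "p \<in> carrier (monoid_algebra M)" "q \<in> carrier (monoid_algebra M)"
  shows "p - q \<in> carrier (monoid_algebra M)" "p - q = p \<ominus>\<^bsub>monoid_algebra M\<^esub> q"
proof -
  interpret A: vectorspace class_ring "monoid_algebra M" by (rule monoid_algebra_vectorspace)
  have q: "- q \<in> carrier (monoid_algebra M)"
    using assms(2) by (auto simp: monoid_algebra_simps in_keys_iff)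
  have "- q = \<ominus>\<^bsub>monoid_algebra M\<^esub> q"
    by (rule A.M.minus_equality[symmetric]) (use assms q in \<open>simp_all add: monoid_algebra_simps(2,3)\<close>)
  then show eq: "p - q = p \<ominus>\<^bsub>monoid_algebra M\<^esub> q"
    by (simp add: a_minus_def monoid_algebra_simps)
  show "p - q \<in> carrier (monoid_algebra M)"
    unfolding eq using assms by simp
qed

lemma monoid_algebra_mult_minus:
  "(p - q) \<otimes>\<^bsub>monoid_algebra M\<^esub> r = p \<otimes>\<^bsub>monoid_algebra M\<^esub> r - q \<otimes>\<^bsub>monoid_algebra M\<^esub> r"
  "r \<otimes>\<^bsub>monoid_algebra M\<^esub> (p - q) = r \<otimes>\<^bsub>monoid_algebra M\<^esub> p - r \<otimes>\<^bsub>monoid_algebra M\<^esub> q"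
  using monoid_algebra_distrib(1)[where M = M and p = "p - q" and q = q and r = r]
    monoid_algebra_distrib(2)[where M = M and p = "p - q" and q = q and r = r]
  by (simp_all add: eq_diff_eq)

section \<open>The tensor algebra\<close>

lemma word_monoid_simps:
  "carrier (word_monoid X) = lists X" "mult (word_monoid X) = (@)" "one (word_monoid X) = []"
  by (simp_all add: word_monoid_def)

lemma word_monoid: "monoid (word_monoid X)"
  by (rule monoidI) (auto simp: word_monoid_simps)

text \<open>The domain consists of words of all lengths: this is a family of multilinear maps, one
  for each degree, which is what a linear map on the whole of T(V) amounts to.\<close>

definition multilinear ::
  "('k::field, 'v, 'm) module_scheme \<Rightarrow> ('k, 'w, 'n) module_scheme \<Rightarrow> ('v list \<Rightarrow> 'w) \<Rightarrow> bool"
  where "multilinear V N F \<longleftrightarrow> F \<in> lists (carrier V) \<rightarrow> carrier N \<and>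
    (\<forall>us\<in>lists (carrier V). \<forall>ws\<in>lists (carrier V). \<forall>v\<in>carrier V.
      (\<forall>w\<in>carrier V. F (us @ (v \<oplus>\<^bsub>V\<^esub> w) # ws) = F (us @ v # ws) \<oplus>\<^bsub>N\<^esub> F (us @ w # ws)) \<and>
      (\<forall>c. F (us @ (c \<odot>\<^bsub>V\<^esub> v) # ws) = c \<odot>\<^bsub>N\<^esub> F (us @ v # ws)))"

locale tensor_space = V: vectorspace class_ring V
  for V :: "('k::field, 'v, 'm) module_scheme"
begin

abbreviation "C \<equiv> carrier V"
abbreviation "W \<equiv> monoid_algebra (word_monoid C) :: ('k, 'v list \<Rightarrow>\<^sub>0 'k) module"
abbreviation "T \<equiv> tensor_algebra V"
abbreviation "pure \<equiv> pure_tensor V"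

interpretation W: assoc_algebra W
  by (rule monoid_algebra_assoc_algebra) (rule word_monoid)

definition linear_relations :: "('v list \<Rightarrow>\<^sub>0 'k) set" where
  "linear_relations =
     {Poly_Mapping.single [v \<oplus>\<^bsub>V\<^esub> w] 1 - Poly_Mapping.single [v] 1 - Poly_Mapping.single [w] 1 | v w.
        v \<in> C \<and> w \<in> C} \<union>
     {Poly_Mapping.single [c \<odot>\<^bsub>V\<^esub> v] 1 - Poly_Mapping.single [v] c | c v. v \<in> C}"

lemma tensor_relations_eq: "tensor_relations V = genideal W linear_relations"
  by (simp add: tensor_relations_def linear_relations_def)

lemma single_in_W [simp]: "vs \<in> lists C \<Longrightarrow> Poly_Mapping.single vs c \<in> carrier W"
  by (auto simp: monoid_algebra_simps word_monoid_simps)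

lemma linear_relations_subset: "linear_relations \<subseteq> carrier W"
  by (auto simp: linear_relations_def intro!: monoid_algebra_minus(1))

lemma relations_ideal: "ideal (tensor_relations V) W"
  unfolding tensor_relations_eq by (rule W.genideal_ideal) (rule linear_relations_subset)

interpretation Q: quotient_space W "tensor_relations V"
  using W.ideal_submodule[OF relations_ideal] W.VS.vectorspace_axioms
  by (simp add: quotient_space_def)

lemma T_eq: "T = quotient_module W (tensor_relations V)"
  by (simp add: tensor_algebra_def)

lemma T_algebra: "assoc_algebra T"
  unfolding T_eq by (rule W.quotient_assoc_algebra) (rule relations_ideal)

sublocale T: assoc_algebra T by (rule T_algebra)

lemma pure_closed [simp]: "vs \<in> lists C \<Longrightarrow> pure vs \<in> carrier T"
  by (auto simp: T_eq Q.quotient_simps pure_tensor_def)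

lemma pure_Nil: "pure [] = \<one>\<^bsub>T\<^esub>"
  by (simp add: T_eq Q.quotient_simps pure_tensor_def monoid_algebra_simps word_monoid_simps)

lemma pure_mult: "\<lbrakk>vs \<in> lists C; ws \<in> lists C\<rbrakk> \<Longrightarrow> pure vs \<otimes>\<^bsub>T\<^esub> pure ws = pure (vs @ ws)"
  unfolding T_eq pure_tensor_def
  by (subst W.quotient_mult[OF relations_ideal])
    (auto simp: monoid_algebra_mult_single word_monoid_simps)

lemma W_span:
  "(\<lambda>x. Poly_Mapping.single x 1) ` lists C \<subseteq> carrier W"
  "W.VS.span ((\<lambda>x. Poly_Mapping.single x 1) ` lists C) = carrier W"
  using single_in_W monoid_algebra_span[of "word_monoid C"]
  by (blast, simp only: word_monoid_simps)

lemma pure_span: "T.VS.span (pure ` lists C) = carrier T"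
proof -
  have "pure = (\<lambda>vs. tensor_relations V +>\<^bsub>W\<^esub> Poly_Mapping.single vs 1)"
    by (rule ext) (simp add: pure_tensor_def)
  then show ?thesis
    using Q.quotient_span[OF W_span] by (simp only: T_eq image_image)
qed

lemma single_relation:
  assumes "p - q \<in> linear_relations" "p \<in> carrier W" "q \<in> carrier W"
  shows "tensor_relations V +>\<^bsub>W\<^esub> p = tensor_relations V +>\<^bsub>W\<^esub> q"
proof -
  have "p - q \<in> tensor_relations V"
    using W.genideal_self[OF linear_relations_subset] assms(1) by (auto simp only: tensor_relations_eq)
  then show ?thesis
    unfolding monoid_algebra_minus(2)[OF assms(2,3)] using assms by (simp only: Q.coset_eq_iff)
qed

lemma pure_add1:
  assumes "v \<in> C" "w \<in> C"
  shows "pure [v \<oplus>\<^bsub>V\<^esub> w] = pure [v] \<oplus>\<^bsub>T\<^esub> pure [w]"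
proof -
  let ?s = "\<lambda>v. Poly_Mapping.single [v] (1::'k)"
  have closed: "?s v \<in> carrier W" "?s w \<in> carrier W" "?s (v \<oplus>\<^bsub>V\<^esub> w) \<in> carrier W"
    using assms by auto
  have "?s (v \<oplus>\<^bsub>V\<^esub> w) - ?s v - ?s w \<in> linear_relations"
    using assms by (auto simp only: linear_relations_def)
  moreover have "?s (v \<oplus>\<^bsub>V\<^esub> w) - ?s v - ?s w = ?s (v \<oplus>\<^bsub>V\<^esub> w) - (?s v \<oplus>\<^bsub>W\<^esub> ?s w)"
    by (simp add: monoid_algebra_simps(3) diff_diff_eq)
  ultimately have "pure [v \<oplus>\<^bsub>V\<^esub> w] = tensor_relations V +>\<^bsub>W\<^esub> (?s v \<oplus>\<^bsub>W\<^esub> ?s w)"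
    unfolding pure_tensor_def using closed by (intro single_relation) simp_all
  also have "\<dots> = pure [v] \<oplus>\<^bsub>T\<^esub> pure [w]"
    unfolding T_eq pure_tensor_def using closed by (simp only: Q.quotient_add)
  finally show ?thesis .
qed

lemma pure_smult1:
  assumes "v \<in> C"
  shows "pure [c \<odot>\<^bsub>V\<^esub> v] = c \<odot>\<^bsub>T\<^esub> pure [v]"
proof -
  have "pure [c \<odot>\<^bsub>V\<^esub> v] = tensor_relations V +>\<^bsub>W\<^esub> Poly_Mapping.single [v] c"
    unfolding pure_tensor_def
    by (rule single_relation) (use assms in \<open>auto simp: linear_relations_def\<close>)
  also have "Poly_Mapping.single [v] c = c \<odot>\<^bsub>W\<^esub> Poly_Mapping.single [v] 1"
    by (simp add: monoid_algebra_simps scale_single)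
  finally show ?thesis
    using assms by (simp add: T_eq pure_tensor_def Q.quotient_smult)
qed

lemma pure_multilinear: "multilinear V T pure"
  unfolding multilinear_def
proof (intro conjI ballI allI)
  fix us ws v assume *: "us \<in> lists C" "ws \<in> lists C" "v \<in> C"
  have split: "pure (us @ x # ws) = pure us \<otimes>\<^bsub>T\<^esub> pure [x] \<otimes>\<^bsub>T\<^esub> pure ws" if "x \<in> C" for x
    using * that by (simp add: pure_mult)
  show "pure (us @ (c \<odot>\<^bsub>V\<^esub> v) # ws) = c \<odot>\<^bsub>T\<^esub> pure (us @ v # ws)" for c
    using * by (simp add: split pure_smult1 T.smult_mult_l T.smult_mult_r)
  fix w assume "w \<in> C"
  then show "pure (us @ (v \<oplus>\<^bsub>V\<^esub> w) # ws) = pure (us @ v # ws) \<oplus>\<^bsub>T\<^esub> pure (us @ w # ws)"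
    using * by (simp add: split pure_add1 T.l_distr T.r_distr)
qed auto

text \<open>The source of all linear maps out of T(V) other than products. The linear extension of
  \<open>F\<close> to the free algebra kills the defining ideal, because multilinearity in the slot
  between \<open>us\<close> and \<open>ws\<close> says precisely that a linear relation placed there
  is sent to zero. Only linear maps are produced, so \<open>F\<close> need not be
  multiplicative.\<close>

lemma tensor_universal:
  assumes N: "module class_ring N" and F: "multilinear V N F"
  obtains \<phi> where "\<phi> \<in> module_hom class_ring T N" "\<And>vs. vs \<in> lists C \<Longrightarrow> \<phi> (pure vs) = F vs"
proof -
  interpret N: module class_ring N by (rule N)
  let ?f = "linear_extension N F"
  let ?S = "(\<lambda>x. Poly_Mapping.single x 1) ` lists C :: ('v list \<Rightarrow>\<^sub>0 'k) set"
  have Fc: "F \<in> lists C \<rightarrow> carrier N" using F by (simp add: multilinear_def)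
  have hom: "?f \<in> module_hom class_ring W N"
    using linear_extension_hom[OF N Fc]
    by (simp add: module_hom_def free_space_simps monoid_algebra_simps word_monoid_simps)
  have fs: "?f (Poly_Mapping.single vs c) = c \<odot>\<^bsub>N\<^esub> F vs" if "vs \<in> lists C" for vs c
    by (rule linear_extension_single[OF N Fc that])
  have fm: "?f (p - q) = ?f p \<ominus>\<^bsub>N\<^esub> ?f q" if "p \<in> carrier W" "q \<in> carrier W" for p q
    using linear_extension_minus[OF N Fc] that
    by (simp add: free_space_simps monoid_algebra_simps word_monoid_simps)
  have zero: "submodule class_ring {\<zero>\<^bsub>N\<^esub>} N"
    by unfold_locales auto
  \<comment> \<open>The two-sided ideal is rewritten as a linear span, since the map
    \<open>?f\<close> is linear but not multiplicative.\<close>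
  have gen: "tensor_relations V
      = lspan W {a \<otimes>\<^bsub>W\<^esub> x \<otimes>\<^bsub>W\<^esub> b | a x b. a \<in> ?S \<and> x \<in> linear_relations \<and> b \<in> ?S}" (is "_ = lspan W ?G")
    unfolding tensor_relations_eq
  proof (rule W.genideal_eq_span[OF W_span(1) _ _ W_span(2) linear_relations_subset])
    show "\<one>\<^bsub>W\<^esub> \<in> ?S" by (auto simp: monoid_algebra_simps word_monoid_simps)
    show "a \<otimes>\<^bsub>W\<^esub> b \<in> ?S" if "a \<in> ?S" "b \<in> ?S" for a b
      using that by (auto simp: monoid_algebra_mult_single word_monoid_simps intro!: imageI)
  qed
  have G: "?G \<subseteq> carrier W"
    using W_span(1) linear_relations_subset by (blast intro: W.m_closed)
  have fG: "?f g \<in> {\<zero>\<^bsub>N\<^esub>}" if gG: "g \<in> ?G" for g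
  proof -
    obtain us ws x where x: "x \<in> linear_relations" and us: "us \<in> lists C" "ws \<in> lists C"
      and g: "g = Poly_Mapping.single us 1 \<otimes>\<^bsub>W\<^esub> x \<otimes>\<^bsub>W\<^esub> Poly_Mapping.single ws 1"
      using gG by blast
    have Fn: "F (us @ v # ws) \<in> carrier N" if "v \<in> C" for v
      using Fc us that by (auto simp: Pi_iff)
    from x consider
      v w where "v \<in> C" "w \<in> C" "x = Poly_Mapping.single [v \<oplus>\<^bsub>V\<^esub> w] 1 - Poly_Mapping.single [v] 1 - Poly_Mapping.single [w] 1"
      | v c where "v \<in> C" "x = Poly_Mapping.single [c \<odot>\<^bsub>V\<^esub> v] 1 - Poly_Mapping.single [v] c"
      by (auto simp: linear_relations_def)
    then show ?thesis
    proof cases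
      case (1 v w)
      then have "g = Poly_Mapping.single (us @ (v \<oplus>\<^bsub>V\<^esub> w) # ws) 1 - Poly_Mapping.single (us @ v # ws) 1
          - Poly_Mapping.single (us @ w # ws) 1"
        by (simp add: g monoid_algebra_mult_minus monoid_algebra_mult_single word_monoid_simps)
      then have "?f g = F (us @ (v \<oplus>\<^bsub>V\<^esub> w) # ws) \<ominus>\<^bsub>N\<^esub> F (us @ v # ws) \<ominus>\<^bsub>N\<^esub> F (us @ w # ws)"
        using 1 us Fn by (simp add: fm fs monoid_algebra_minus(1) class_smult[OF N])
      also have "F (us @ (v \<oplus>\<^bsub>V\<^esub> w) # ws) = F (us @ v # ws) \<oplus>\<^bsub>N\<^esub> F (us @ w # ws)"
        using F us 1 by (simp add: multilinear_def)
      also have "F (us @ v # ws) \<oplus>\<^bsub>N\<^esub> F (us @ w # ws) \<ominus>\<^bsub>N\<^esub> F (us @ v # ws) \<ominus>\<^bsub>N\<^esub> F (us @ w # ws)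
          = (F (us @ v # ws) \<oplus>\<^bsub>N\<^esub> F (us @ w # ws)) \<ominus>\<^bsub>N\<^esub> (F (us @ v # ws) \<oplus>\<^bsub>N\<^esub> F (us @ w # ws))"
        using 1 Fn by (simp add: a_minus_def N.M.minus_add N.M.a_assoc)
      finally show ?thesis
        using 1 Fn by (simp add: a_minus_def N.M.r_neg)
    next
      case (2 v c)
      then have "g = Poly_Mapping.single (us @ (c \<odot>\<^bsub>V\<^esub> v) # ws) 1 - Poly_Mapping.single (us @ v # ws) c"
        by (simp add: g monoid_algebra_mult_minus monoid_algebra_mult_single word_monoid_simps)
      then have "?f g = F (us @ (c \<odot>\<^bsub>V\<^esub> v) # ws) \<ominus>\<^bsub>N\<^esub> c \<odot>\<^bsub>N\<^esub> F (us @ v # ws)"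
        using 2 us Fn by (simp add: fm fs class_smult[OF N])
      also have "F (us @ (c \<odot>\<^bsub>V\<^esub> v) # ws) = c \<odot>\<^bsub>N\<^esub> F (us @ v # ws)"
        using F us 2 by (simp add: multilinear_def)
      finally show ?thesis
        using 2 Fn by (simp add: a_minus_def N.M.r_neg)
    qed
  qed
  have "?f u = \<zero>\<^bsub>N\<^esub>" if "u \<in> tensor_relations V" for u
    using module_hom_span[OF W.VS.module_axioms N hom G _ zero fG] that by (simp add: gen)
  then obtain \<phi> where \<phi>: "\<phi> \<in> module_hom class_ring T N"
      "\<And>x. x \<in> carrier W \<Longrightarrow> \<phi> (tensor_relations V +>\<^bsub>W\<^esub> x) = ?f x"
    using Q.quotient_lift[OF N hom] unfolding T_eq by metis
  have "\<phi> (pure vs) = F vs" if "vs \<in> lists C" for vs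
    using \<phi>(2)[of "Poly_Mapping.single vs 1"] that Fc fs[OF that, of 1]
    by (auto simp: pure_tensor_def Pi_iff class_smult[OF N])
  with \<phi>(1) show thesis by (rule that)
qed

end

section \<open>Permutations as words in adjacent transpositions\<close>

declare in_lists_conv_set [simp] ball_Un [simp]

lemma word_perm_simps [simp]:
  "word_perm [] = id" "word_perm (i # js) = Transposition.transpose i (Suc i) \<circ> word_perm js"
  by (simp_all add: word_perm_def)

lemma word_perm_append: "word_perm (js @ js') = word_perm js \<circ> word_perm js'"
  by (induction js) (auto simp: comp_assoc)

lemma adjacent_transpose_permutes: "Suc i < n \<Longrightarrow> Transposition.transpose i (Suc i) permutes {..<n}"
  by (rule permutes_swap_id) auto

lemma word_perm_permutes: "js \<in> lists {i. Suc i < n} \<Longrightarrow> word_perm js permutes {..<n}"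
proof (induction js)
  case (Cons i js)
  then show ?case
    unfolding word_perm_simps by (intro permutes_compose adjacent_transpose_permutes) auto
qed (simp add: permutes_id)

lemma sign_word_perm: "sign (word_perm js) = (- 1) ^ length js"
proof (induction js)
  case (Cons i js)
  \<comment> \<open>The list comes without a bound. One is made from its largest letter, since the
    letter \<open>i\<close> moves \<open>i\<close> and \<open>Suc i\<close>; this gives a
    permutation of a finite set.\<close>
  have "js \<in> lists {i. Suc i < Max (set js) + 2}"
    by (auto simp: less_Suc_eq_le)
  then have "permutation (word_perm js)"
    using word_perm_permutes by (metis finite_lessThan permutation_permutes)
  with Cons show ?case
    unfolding word_perm_simps by (subst sign_compose) (simp_all add: permutation_swap_id sign_swap_id)
qed auto

text \<open>Conjugation raises the upper point: (a b+1) = (b b+1)(a b)(b b+1) for a < b, and the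
  base case is a single letter.\<close>

lemma transpose_word:
  assumes "a < b" "b < n"
  shows "\<exists>js \<in> lists {i. Suc i < n}. word_perm js = Transposition.transpose a b"
  using assms
proof (induction b)
  case (Suc b)
  show ?case
  proof (cases "a = b")
    case True
    then show ?thesis using Suc.prems by (intro bexI[of _ "[a]"]) auto
  next
    case False
    with Suc obtain js where js: "js \<in> lists {i. Suc i < n}" "word_perm js = Transposition.transpose a b"
      by auto
    have "word_perm (b # js @ [b]) = Transposition.transpose a (Suc b)"
      using False Suc.prems
      by (auto simp: word_perm_append js fun_eq_iff Transposition.transpose_def)
    then show ?thesis using js Suc.prems by (intro bexI[of _ "b # js @ [b]"]) auto
  qed
qed simp

lemma permutation_word:
  assumes "\<sigma> permutes {..<n}"
  shows "\<exists>js \<in> lists {i. Suc i < n}. word_perm js = \<sigma>"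
  using assms finite_lessThan
proof (induction rule: permutes_induct)
  case id
  show ?case by (intro bexI[of _ "[]"]) auto
next
  case (swap a b p)
  obtain js where js: "js \<in> lists {i. Suc i < n}" "word_perm js = p" using swap by auto
  obtain js' where js': "js' \<in> lists {i. Suc i < n}" "word_perm js' = Transposition.transpose a b"
  proof (cases "a < b")
    case True
    then show thesis using transpose_word[of a b n] swap that by auto
  next
    case False
    then show thesis
      using transpose_word[of b a n] swap that by (auto simp: transpose_commute)
  qed
  show ?case using js js' by (intro bexI[of _ "js' @ js"]) (auto simp: word_perm_append)
qed

text \<open>Among the words for \<sigma> take one of least length. This makes the choice in
  \<open>braid_perm\<close> meaningful.\<close>

lemma reduced_expression_exists:
  assumes "\<sigma> permutes {..<n}"
  shows "\<exists>js. reduced_expression n \<sigma> js"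
proof -
  obtain js where "js \<in> lists {i. Suc i < n} \<and> word_perm js = \<sigma>"
    using permutation_word[OF assms] by blast
  from ex_has_least_nat[of "\<lambda>js. js \<in> lists {i. Suc i < n} \<and> word_perm js = \<sigma>", OF this, of length]
  show ?thesis unfolding reduced_expression_def by blast
qed

text \<open>Position \<open>i\<close> of the permuted list shows entry \<open>f i\<close> of the
  original, so the entry at \<open>k\<close> turns up at the preimage of \<open>k\<close>.\<close>

lemma permute_list_update:
  assumes "f permutes {..<length xs}" "k < length xs"
  shows "permute_list f (xs[k := x]) = (permute_list f xs)[inv_into UNIV f k := x]"
proof (rule nth_equalityI)
  fix i assume i: "i < length (permute_list f (xs[k := x]))"
  have "f i < length xs" using i permutes_in_image[OF assms(1)] by simp
  moreover have "f i = k \<longleftrightarrow> i = inv_into UNIV f k"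
    using permutes_inv_eq[OF assms(1)] by metis
  ultimately show "permute_list f (xs[k := x]) ! i = (permute_list f xs)[inv_into UNIV f k := x] ! i"
    using i assms by (auto simp: permute_list_nth nth_list_update)
qed simp

text \<open>The words \<open>us'\<close> and \<open>ws'\<close> do not depend on \<open>x\<close>: a
  permutation moves a slot to a fixed place and arranges the other letters independently of its
  content. The letter \<open>c\<close> is a placeholder that fills the slot while these words are
  cut out. This makes permuting tensor factors multilinear.\<close>

lemma permute_list_middle:
  assumes "f permutes {..<Suc (length us + length ws)}" "us \<in> lists C" "ws \<in> lists C" "c \<in> C"
  obtains us' ws' where "us' \<in> lists C" "ws' \<in> lists C"
    "length us' + length ws' = length us + length ws"
    "\<And>x. permute_list f (us @ x # ws) = us' @ x # ws'"
proof -
  let ?ys = "permute_list f (us @ c # ws)"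
  let ?k = "inv_into UNIV f (length us)"
  have f: "f permutes {..<length (us @ c # ws)}" using assms(1) by simp
  have k: "?k < length ?ys"
    using permutes_in_image[OF permutes_inv[OF assms(1)], of "length us"] by simp
  have split: "permute_list f (us @ x # ws) = take ?k ?ys @ x # drop (Suc ?k) ?ys" for x
  proof -
    have "us @ x # ws = (us @ c # ws)[length us := x]" by simp
    also have "permute_list f \<dots> = ?ys[?k := x]"
      by (rule permute_list_update[OF f]) simp
    also have "\<dots> = take ?k ?ys @ x # drop (Suc ?k) ?ys"
      by (rule upd_conv_take_nth_drop[OF k])
    finally show ?thesis .
  qed
  have "set ?ys \<subseteq> C" using assms(2-4) set_permute_list[OF f] by auto
  then have "take ?k ?ys \<in> lists C" "drop (Suc ?k) ?ys \<in> lists C"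
    by (auto dest: in_set_takeD in_set_dropD)
  then show thesis
    by (rule that[OF _ _ _ split]) (use k in simp)
qed

lemma permute_list_adjacent:
  "permute_list (Transposition.transpose (length us) (Suc (length us))) (us @ v # w # ws) = us @ w # v # ws"
proof (rule nth_equalityI)
  fix i
  let ?t = "Transposition.transpose (length us) (Suc (length us))"
  assume "i < length (permute_list ?t (us @ v # w # ws))"
  then have "permute_list ?t (us @ v # w # ws) ! i = (us @ v # w # ws) ! ?t i"
    by (intro permute_list_nth adjacent_transpose_permutes) auto
  also have "\<dots> = (us @ w # v # ws) ! i"
    by (cases "i < length us"; cases "i = length us"; cases "i = Suc (length us)")
      (auto simp: Transposition.transpose_def nth_append nth_Cons' Suc_diff_le)
  finally show "permute_list ?t (us @ v # w # ws) ! i = (us @ w # v # ws) ! i" .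
qed simp

section \<open>Graded pieces of T(V) and permutations of tensor factors\<close>

context tensor_space
begin

definition words :: "nat \<Rightarrow> 'v list set" where "words n = {vs \<in> lists C. length vs = n}"

abbreviation "Tn n \<equiv> tensor_power V n"

lemma Tn_eq: "Tn n = T\<lparr>carrier := T.VS.span (pure ` words n)\<rparr>"
  by (simp add: tensor_power_def words_def)

lemma Tn_simps:
  "add (Tn n) = add T" "zero (Tn n) = zero T" "smult (Tn n) = smult T"
  by (simp_all add: Tn_eq)

lemma pure_words: "pure ` words n \<subseteq> carrier T"
  by (auto simp: words_def)

lemma Tn_carrier: "carrier (Tn n) = T.VS.span (pure ` words n)"
  by (simp add: Tn_eq)

lemma Tn_submodule: "submodule class_ring (carrier (Tn n)) T"
  unfolding Tn_carrier by (rule T.VS.span_is_submodule) (rule pure_words)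

lemma Tn_subset: "x \<in> carrier (Tn n) \<Longrightarrow> x \<in> carrier T"
  using submodule.subset[OF Tn_submodule] by blast

lemma pure_in_Tn: "vs \<in> words n \<Longrightarrow> pure vs \<in> carrier (Tn n)"
  unfolding Tn_carrier using T.VS.in_own_span[OF pure_words] by blast

lemma Tn_module: "module class_ring (Tn n)"
  using T.VS.submodule_is_module[OF Tn_submodule[of n]] by (simp add: Tn_eq)

lemma Tn_span: "lspan (Tn n) (pure ` words n) = carrier (Tn n)"
  using T.VS.span_li_not_depend[OF _ Tn_submodule, of "pure ` words n" n] pure_in_Tn
  by (auto simp: Tn_eq)

text \<open>\<open>tensor_power\<close> is \<open>tensor_algebra\<close> with a smaller carrier, and
  finite sums refer to the carrier; they agree as long as all terms stay in degree
  \<open>n\<close>.\<close>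

lemma Tn_finsum:
  assumes "f \<in> A \<rightarrow> carrier (Tn n)"
  shows "finsum (Tn n) f A = finsum T f A"
proof -
  interpret n: module class_ring "Tn n" by (rule Tn_module)
  show ?thesis
    using assms
  proof (induction A rule: infinite_finite_induct)
    case (insert a A)
    then have "f \<in> A \<rightarrow> carrier T" "f a \<in> carrier T" using Tn_subset by auto
    with insert show ?case by (simp add: Tn_simps)
  qed (simp_all add: Tn_simps)
qed

lemma Tn_hom_eqI:
  assumes "module class_ring N" "f \<in> module_hom class_ring (Tn n) N" "g \<in> module_hom class_ring (Tn n) N"
    and "\<And>vs. vs \<in> words n \<Longrightarrow> f (pure vs) = g (pure vs)" and "x \<in> carrier (Tn n)"
  shows "f x = g x"
  by (rule module_hom_eq_on_span[OF Tn_module assms(1-3), of "pure ` words n"])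
    (use assms pure_in_Tn in \<open>auto simp: Tn_span\<close>)

lemma T_hom_Tn:
  "f \<in> module_hom class_ring T N \<Longrightarrow> f \<in> module_hom class_ring (Tn n) N"
  by (auto simp: module_hom_def Tn_simps Tn_subset)

lemma Tn_mult:
  assumes "x \<in> carrier (Tn m)" "y \<in> carrier (Tn n)"
  shows "x \<otimes>\<^bsub>T\<^esub> y \<in> carrier (Tn (m + n))"
proof (rule module_hom_span[where f = "\<lambda>x. x \<otimes>\<^bsub>T\<^esub> y", OF Tn_module T.VS.module_axioms _ _ _ Tn_submodule])
  show "(\<lambda>x. x \<otimes>\<^bsub>T\<^esub> y) \<in> module_hom class_ring (Tn m) T"
    using T_hom_Tn T.mult_right_hom Tn_subset assms by blast
  show "pure ` words m \<subseteq> carrier (Tn m)" using pure_in_Tn by auto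
  show "x \<in> lspan (Tn m) (pure ` words m)"
    using assms by (simp add: Tn_span)
  fix s assume "s \<in> pure ` words m"
  then obtain vs where vs: "vs \<in> words m" "s = pure vs" by auto
  show "s \<otimes>\<^bsub>T\<^esub> y \<in> carrier (Tn (m + n))"
  proof (rule module_hom_span[where f = "\<lambda>y. s \<otimes>\<^bsub>T\<^esub> y", OF Tn_module T.VS.module_axioms _ _ _ Tn_submodule])
    show "(\<lambda>y. s \<otimes>\<^bsub>T\<^esub> y) \<in> module_hom class_ring (Tn n) T"
      using T_hom_Tn T.mult_left_hom Tn_subset vs pure_in_Tn by blast
    show "pure ` words n \<subseteq> carrier (Tn n)" using pure_in_Tn by auto
    show "y \<in> lspan (Tn n) (pure ` words n)"
      using assms by (simp add: Tn_span)
    fix t assume "t \<in> pure ` words n"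
    then obtain ws where ws: "ws \<in> words n" "t = pure ws" by auto
    then show "s \<otimes>\<^bsub>T\<^esub> t \<in> carrier (Tn (m + n))"
      using vs by (auto simp: words_def pure_mult intro!: pure_in_Tn)
  qed
qed

lemma pure_add:
  "\<lbrakk>us \<in> lists C; ws \<in> lists C; v \<in> C; w \<in> C\<rbrakk>
    \<Longrightarrow> pure (us @ (v \<oplus>\<^bsub>V\<^esub> w) # ws) = pure (us @ v # ws) \<oplus>\<^bsub>T\<^esub> pure (us @ w # ws)"
  using pure_multilinear unfolding multilinear_def by blast

lemma pure_smult:
  "\<lbrakk>us \<in> lists C; ws \<in> lists C; v \<in> C\<rbrakk>
    \<Longrightarrow> pure (us @ (c \<odot>\<^bsub>V\<^esub> v) # ws) = c \<odot>\<^bsub>T\<^esub> pure (us @ v # ws)"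
  using pure_multilinear unfolding multilinear_def by blast

text \<open>Permuting letters is multilinear by \<open>permute_list_middle\<close>. Words of length
  other than \<open>n\<close> are sent to zero, since \<open>tensor_universal\<close> asks for
  values in all degrees.\<close>

lemma permutation_operator:
  assumes "f permutes {..<n}"
  obtains P where "P \<in> module_hom class_ring T T"
    "\<And>vs. vs \<in> words n \<Longrightarrow> P (pure vs) = pure (permute_list f vs)"
proof -
  let ?F = "\<lambda>vs. if length vs = n then pure (permute_list f vs) else \<zero>\<^bsub>T\<^esub>"
  have "multilinear V T ?F"
    unfolding multilinear_def
  proof (intro conjI ballI allI)
    show "?F \<in> lists C \<rightarrow> carrier T"
    proof
      fix vs assume "vs \<in> lists C"
      then show "?F vs \<in> carrier T"
        using assms set_permute_list[of f vs] by (auto intro!: pure_closed)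
    qed
    fix us ws v assume *: "us \<in> lists C" "ws \<in> lists C" "v \<in> C"
    show "?F (us @ (c \<odot>\<^bsub>V\<^esub> v) # ws) = c \<odot>\<^bsub>T\<^esub> ?F (us @ v # ws)" for c
    proof (cases "Suc (length us + length ws) = n")
      case True
      obtain us' ws' where "us' \<in> lists C" "ws' \<in> lists C"
        "\<And>x. permute_list f (us @ x # ws) = us' @ x # ws'"
        by (rule permute_list_middle[of f us ws C v]) (use assms True * in auto)
      then show ?thesis
        using * True by (simp add: pure_add pure_smult)
    qed simp
    fix w assume w: "w \<in> C"
    show "?F (us @ (v \<oplus>\<^bsub>V\<^esub> w) # ws) = ?F (us @ v # ws) \<oplus>\<^bsub>T\<^esub> ?F (us @ w # ws)"
    proof (cases "Suc (length us + length ws) = n")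
      case True
      obtain us' ws' where "us' \<in> lists C" "ws' \<in> lists C"
        "\<And>x. permute_list f (us @ x # ws) = us' @ x # ws'"
        by (rule permute_list_middle[of f us ws C v]) (use assms True * in auto)
      then show ?thesis
        using * w True by (simp add: pure_add pure_smult)
    qed simp
  qed
  then obtain P where "P \<in> module_hom class_ring T T" "\<And>vs. vs \<in> lists C \<Longrightarrow> P (pure vs) = ?F vs"
    using tensor_universal[OF T.VS.module_axioms] by blast
  then show thesis by (intro that) (auto simp: words_def)
qed

end

section \<open>Nichols algebras of scalar multiples of the flip\<close>

lemma finsum_const:
  fixes N :: "('k::field, 'v, 'm) module_scheme"
  assumes "module class_ring N" "finite A" "y \<in> carrier N"
  shows "(\<Oplus>\<^bsub>N\<^esub> a\<in>A. y) = of_nat (card A) \<odot>\<^bsub>N\<^esub> y"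
proof -
  interpret module class_ring N by fact
  show ?thesis
    using assms(2)
    by induction (use assms(3) in \<open>simp_all add: class_smult[OF assms(1)] M.a_comm\<close>)
qed

lemma smult_hom:
  fixes N :: "('k::field, 'v, 'm) module_scheme"
  assumes "module class_ring N"
  shows "(\<lambda>x. c \<odot>\<^bsub>N\<^esub> x) \<in> module_hom class_ring N N"
proof -
  interpret module class_ring N by fact
  have "c \<odot>\<^bsub>N\<^esub> (d \<odot>\<^bsub>N\<^esub> x) = d \<odot>\<^bsub>N\<^esub> (c \<odot>\<^bsub>N\<^esub> x)" if "x \<in> carrier N" for d x
    using class_smult(2)[OF assms that, of c d] class_smult(2)[OF assms that, of d c]
    by (simp add: mult.commute)
  then show ?thesis by (auto simp: module_hom_def smult_r_distr)
qed

lemma module_hom_finsum: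
  assumes "module R M" "module R N" "f \<in> module_hom R M N" "g \<in> A \<rightarrow> carrier M"
  shows "f (\<Oplus>\<^bsub>M\<^esub> a\<in>A. g a) = (\<Oplus>\<^bsub>N\<^esub> a\<in>A. f (g a))"
proof -
  interpret mod_hom R M N f
    using assms by (simp add: mod_hom_def mod_hom_axioms_def)
  show ?thesis
    using assms(4)
  proof (induction A rule: infinite_finite_induct)
    case (insert a A)
    then have "(\<lambda>a. f (g a)) \<in> A \<rightarrow> carrier N" "f (g a) \<in> carrier N" "g \<in> A \<rightarrow> carrier M" "g a \<in> carrier M"
      by auto
    with insert show ?case by simp
  qed simp_all
qed

text \<open>The existence witness for both \<open>braid_at\<close> and \<open>yd_braiding\<close>,
  with an adjacent transposition for \<open>f\<close> and the sign for \<open>a\<close>.\<close>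

lemma (in tensor_space) scaled_permutation_operator:
  assumes f: "f permutes {..<n}"
  obtains P where "P \<in> module_hom class_ring T T"
    "\<And>x. x \<in> carrier (Tn n) \<Longrightarrow> P x \<in> carrier (Tn n)"
    "\<And>vs. vs \<in> words n \<Longrightarrow> P (pure vs) = a \<odot>\<^bsub>T\<^esub> pure (permute_list f vs)"
proof -
  obtain P where P: "P \<in> module_hom class_ring T T"
    "\<And>vs. vs \<in> words n \<Longrightarrow> P (pure vs) = pure (permute_list f vs)"
    using permutation_operator[OF f] by blast
  let ?f = "\<lambda>x. a \<odot>\<^bsub>T\<^esub> P x"
  have hom: "?f \<in> module_hom class_ring T T"
    using module_hom_compose[OF P(1) smult_hom[OF T.VS.module_axioms]] by (simp add: comp_def)
  have "?f x \<in> carrier (Tn n)" if "x \<in> carrier (Tn n)" for x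
  proof (rule module_hom_span[OF Tn_module T.VS.module_axioms T_hom_Tn[OF hom] _ _ Tn_submodule])
    show "pure ` words n \<subseteq> carrier (Tn n)" using pure_in_Tn by auto
    show "x \<in> lspan (Tn n) (pure ` words n)"
      using that by (simp add: Tn_span)
    fix s assume "s \<in> pure ` words n"
    then obtain vs where vs: "vs \<in> words n" "s = pure vs" by auto
    have "permute_list f vs \<in> words n"
      using vs(1) f set_permute_list[of f vs] by (auto simp: words_def)
    then show "?f s \<in> carrier (Tn n)"
      using vs P(2) submodule.smult_closed[OF Tn_submodule[of n]] by (simp add: pure_in_Tn)
  qed
  with hom P(2) show thesis by (intro that[of ?f]) auto
qed

text \<open>Elements of \<open>linear_maps\<close> are extensional, which makes definite
  descriptions of maps unique as functions; restriction provides this.\<close>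

lemma (in tensor_space) restrict_linear_map:
  assumes "P \<in> module_hom class_ring T T" "\<And>x. x \<in> carrier (Tn n) \<Longrightarrow> P x \<in> carrier (Tn n)"
  shows "restrict P (carrier (Tn n)) \<in> linear_maps (Tn n) (Tn n)"
proof -
  interpret n: module class_ring "Tn n" by (rule Tn_module)
  have "P \<in> module_hom class_ring (Tn n) (Tn n)"
    using T_hom_Tn[OF assms(1), of n] assms(2) by (auto simp: module_hom_def Tn_simps)
  then show ?thesis
    using n.M.a_closed n.smult_closed by (auto simp: linear_maps_def module_hom_def Pi_iff)
qed

text \<open>Here \<epsilon> is any scalar. The construction of the operators and of the symmetrizer
  is uniform in it; the values 1 and -1 are separated only afterwards.\<close>

locale flip_braiding = tensor_space V
  for V :: "('k::field_char_0, 'v, 'm) module_scheme" +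
  fixes c :: "('v list \<Rightarrow>\<^sub>0 'k) set \<Rightarrow> ('v list \<Rightarrow>\<^sub>0 'k) set" and \<epsilon> :: 'k
  assumes c_hom: "c \<in> linear_maps (tensor_power V 2) (tensor_power V 2)"
    and c_pure: "\<lbrakk>v \<in> carrier V; w \<in> carrier V\<rbrakk>
      \<Longrightarrow> c (pure_tensor V [v, w]) = \<epsilon> \<odot>\<^bsub>tensor_algebra V\<^esub> pure_tensor V [w, v]"
begin

lemma c_module_hom: "c \<in> module_hom class_ring (Tn 2) (Tn 2)"
  using c_hom by (simp add: linear_maps_def)

lemma c_module_hom_T: "c \<in> module_hom class_ring (Tn 2) T"
  using c_module_hom by (auto simp: module_hom_def Tn_simps intro: Tn_subset)

lemma words_split:
  assumes "vs \<in> words n" "Suc i < n"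
  obtains us v w ws where "vs = us @ v # w # ws" "us \<in> words i" "v \<in> C" "w \<in> C" "ws \<in> words (n - i - 2)"
proof -
  have "vs = take i vs @ vs ! i # vs ! Suc i # drop (i + 2) vs"
    using assms by (simp add: words_def Cons_nth_drop_Suc)
  then show thesis
    using assms by (intro that[of "take i vs" "vs ! i" "vs ! Suc i" "drop (i + 2) vs"])
      (auto simp: words_def dest: in_set_takeD in_set_dropD)
qed

text \<open>The property inside the definite description of \<open>braid_at\<close>, named so that
  existence and uniqueness can be treated separately.\<close>

definition braid_spec :: "nat \<Rightarrow> nat \<Rightarrow> (('v list \<Rightarrow>\<^sub>0 'k) set \<Rightarrow> ('v list \<Rightarrow>\<^sub>0 'k) set) \<Rightarrow> bool"
  where "braid_spec n i \<phi> \<longleftrightarrow> \<phi> \<in> linear_maps (Tn n) (Tn n) \<and>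
    (\<forall>x\<in>carrier (Tn i). \<forall>t\<in>carrier (Tn 2). \<forall>y\<in>carrier (Tn (n - i - 2)).
      \<phi> (x \<otimes>\<^bsub>T\<^esub> t \<otimes>\<^bsub>T\<^esub> y) = x \<otimes>\<^bsub>T\<^esub> c t \<otimes>\<^bsub>T\<^esub> y)"

lemma braid_at_eq: "braid_at V c n i = (THE \<phi>. braid_spec n i \<phi>)"
  by (simp add: braid_at_def braid_spec_def)

lemma braid_spec_pure:
  assumes "braid_spec n i \<phi>" "us \<in> words i" "v \<in> C" "w \<in> C" "ws \<in> words (n - i - 2)"
  shows "\<phi> (pure (us @ v # w # ws)) = \<epsilon> \<odot>\<^bsub>T\<^esub> pure (us @ w # v # ws)"
proof -
  have us: "us \<in> lists C" "ws \<in> lists C" using assms by (auto simp: words_def)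
  have "[v, w] \<in> words 2" using assms by (simp add: words_def)
  then have "\<phi> (pure us \<otimes>\<^bsub>T\<^esub> pure [v, w] \<otimes>\<^bsub>T\<^esub> pure ws)
      = pure us \<otimes>\<^bsub>T\<^esub> c (pure [v, w]) \<otimes>\<^bsub>T\<^esub> pure ws"
    using assms(1,2,5) by (simp add: braid_spec_def pure_in_Tn)
  then show ?thesis
    using assms(3,4) us
    by (simp add: pure_mult c_pure T.smult_mult_l T.smult_mult_r)
qed

text \<open>The witness swaps the letters at \<open>i\<close> and \<open>Suc i\<close> and
  multiplies by \<epsilon>. The required identity is linear in each of \<open>x\<close>,
  \<open>t\<close> and \<open>y\<close>: it is checked on pure tensors (fact \<open>1\<close>) and
  then extended to arbitrary \<open>t\<close>, arbitrary \<open>y\<close> and finally arbitrary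
  \<open>x\<close>.\<close>

lemma braid_spec_exists:
  assumes "Suc i < n"
  shows "\<exists>\<phi>. braid_spec n i \<phi>"
proof -
  let ?t = "Transposition.transpose i (Suc i)"
  have t: "?t permutes {..<n}" by (rule adjacent_transpose_permutes) (rule assms)
  obtain f where f: "f \<in> module_hom class_ring T T"
    and f_Tn: "\<And>x. x \<in> carrier (Tn n) \<Longrightarrow> f x \<in> carrier (Tn n)"
    and f_pure: "\<And>vs. vs \<in> words n \<Longrightarrow> f (pure vs) = \<epsilon> \<odot>\<^bsub>T\<^esub> pure (permute_list ?t vs)"
    using scaled_permutation_operator[OF t] by blast
  have f_mult: "f (x \<otimes>\<^bsub>T\<^esub> t \<otimes>\<^bsub>T\<^esub> y) = x \<otimes>\<^bsub>T\<^esub> c t \<otimes>\<^bsub>T\<^esub> y"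
    if x: "x \<in> carrier (Tn i)" and t: "t \<in> carrier (Tn 2)" and y: "y \<in> carrier (Tn (n - i - 2))" for x t y
  proof -
    have left: "(\<lambda>x. x \<otimes>\<^bsub>T\<^esub> b) \<in> module_hom class_ring (Tn m) T" if "b \<in> carrier T" for b m
      by (rule T_hom_Tn[OF T.mult_right_hom[OF that]])
    have right: "(\<lambda>x. b \<otimes>\<^bsub>T\<^esub> x) \<in> module_hom class_ring T T" if "b \<in> carrier T" for b
      by (rule T.mult_left_hom[OF that])
    have ct: "c t \<in> carrier T" if "t \<in> carrier (Tn 2)" for t
      using module_hom_closed[OF c_module_hom_T] that by auto
    have 1: "f (pure us \<otimes>\<^bsub>T\<^esub> pure vs \<otimes>\<^bsub>T\<^esub> pure ws) = pure us \<otimes>\<^bsub>T\<^esub> c (pure vs) \<otimes>\<^bsub>T\<^esub> pure ws"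
      if "us \<in> words i" "vs \<in> words 2" "ws \<in> words (n - i - 2)" for us vs ws
    proof -
      obtain v w where vw: "vs = [v, w]" "v \<in> C" "w \<in> C"
        using \<open>vs \<in> words 2\<close> by (auto simp: words_def numeral_2_eq_2 length_Suc_conv)
      have us: "us \<in> lists C" "ws \<in> lists C" "length us = i" using that by (auto simp: words_def)
      have "us @ v # w # ws \<in> words n" using that vw assms by (auto simp: words_def)
      then show ?thesis
        using us vw permute_list_adjacent[of us v w ws]
        by (simp add: pure_mult c_pure T.smult_mult_l T.smult_mult_r f_pure)
    qed
    have 2: "f (pure us \<otimes>\<^bsub>T\<^esub> t \<otimes>\<^bsub>T\<^esub> pure ws) = pure us \<otimes>\<^bsub>T\<^esub> c t \<otimes>\<^bsub>T\<^esub> pure ws"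
      if "us \<in> words i" "ws \<in> words (n - i - 2)" "t \<in> carrier (Tn 2)" for us ws t
    proof -
      have b: "pure us \<in> carrier T" "pure ws \<in> carrier T"
        using that pure_in_Tn Tn_subset by blast+
      have h: "(\<lambda>t. pure us \<otimes>\<^bsub>T\<^esub> t \<otimes>\<^bsub>T\<^esub> pure ws) \<in> module_hom class_ring T T"
        using module_hom_compose[OF right T.mult_right_hom] b by (simp add: comp_def)
      show ?thesis
        by (rule Tn_hom_eqI[where n = 2 and x = t and f = "\<lambda>t. f (pure us \<otimes>\<^bsub>T\<^esub> t \<otimes>\<^bsub>T\<^esub> pure ws)"
              and g = "\<lambda>t. pure us \<otimes>\<^bsub>T\<^esub> c t \<otimes>\<^bsub>T\<^esub> pure ws" and N = T, OF T.VS.module_axioms])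
          (use 1 that T_hom_Tn[OF module_hom_compose[OF h f]] module_hom_compose[OF c_module_hom_T h]
            in \<open>simp_all add: comp_def\<close>)
    qed
    have 3: "f (pure us \<otimes>\<^bsub>T\<^esub> t \<otimes>\<^bsub>T\<^esub> y) = pure us \<otimes>\<^bsub>T\<^esub> c t \<otimes>\<^bsub>T\<^esub> y" if us: "us \<in> words i" for us
    proof -
      have b: "pure us \<in> carrier T" using us pure_in_Tn Tn_subset by blast
      have h: "(\<lambda>y. pure us \<otimes>\<^bsub>T\<^esub> t \<otimes>\<^bsub>T\<^esub> y) \<in> module_hom class_ring T T"
        using b Tn_subset[OF t] by (intro right) simp
      show ?thesis
        by (rule Tn_hom_eqI[where n = "n - i - 2" and x = y and f = "\<lambda>y. f (pure us \<otimes>\<^bsub>T\<^esub> t \<otimes>\<^bsub>T\<^esub> y)"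
              and g = "\<lambda>y. pure us \<otimes>\<^bsub>T\<^esub> c t \<otimes>\<^bsub>T\<^esub> y" and N = T, OF T.VS.module_axioms])
          (use 2 us t y T_hom_Tn[OF module_hom_compose[OF h f]] T_hom_Tn[OF right] b ct[OF t]
            in \<open>simp_all add: comp_def\<close>)
    qed
    have y': "y \<in> carrier T" by (rule Tn_subset[OF y])
    have h: "(\<lambda>x. x \<otimes>\<^bsub>T\<^esub> s \<otimes>\<^bsub>T\<^esub> y) \<in> module_hom class_ring T T" if "s \<in> carrier T" for s
      using module_hom_compose[OF T.mult_right_hom[OF that] T.mult_right_hom[OF y']] by (simp add: comp_def)
    show ?thesis
      by (rule Tn_hom_eqI[where n = i and x = x and f = "\<lambda>x. f (x \<otimes>\<^bsub>T\<^esub> t \<otimes>\<^bsub>T\<^esub> y)"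
            and g = "\<lambda>x. x \<otimes>\<^bsub>T\<^esub> c t \<otimes>\<^bsub>T\<^esub> y" and N = T, OF T.VS.module_axioms])
        (use 3 x T_hom_Tn[OF module_hom_compose[OF h[OF Tn_subset[OF t]] f]] T_hom_Tn[OF h[OF ct[OF t]]]
          in \<open>simp_all add: comp_def\<close>)
  qed
  have "x \<otimes>\<^bsub>T\<^esub> t \<otimes>\<^bsub>T\<^esub> y \<in> carrier (Tn n)"
    if "x \<in> carrier (Tn i)" "t \<in> carrier (Tn 2)" "y \<in> carrier (Tn (n - i - 2))" for x t y
  proof -
    \<comment> \<open>Truncated subtraction is harmless here because \<open>Suc i < n\<close>. The
      product has to lie in degree \<open>n\<close>, as the restricted map agrees with
      \<open>f\<close> only there.\<close>
    have "i + 2 + (n - i - 2) = n" using assms by simp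
    then show ?thesis using Tn_mult[OF Tn_mult[OF that(1,2)] that(3)] by (simp only:)
  qed
  then have "braid_spec n i (restrict f (carrier (Tn n)))"
    using f_mult restrict_linear_map[OF f f_Tn] by (simp add: braid_spec_def)
  then show ?thesis by blast
qed

text \<open>Every word of length \<open>n\<close> splits around the positions \<open>i\<close> and
  \<open>Suc i\<close>, so the values on pure tensors are forced; extensionality settles the map off
  the carrier.\<close>

lemma braid_spec_unique:
  assumes i: "Suc i < n" and \<phi>: "braid_spec n i \<phi>" and \<psi>: "braid_spec n i \<psi>"
  shows "\<phi> = \<psi>"
proof (rule extensionalityI)
  show "\<phi> \<in> extensional (carrier (Tn n))" "\<psi> \<in> extensional (carrier (Tn n))"
    using \<phi> \<psi> by (auto simp: braid_spec_def linear_maps_def)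
  fix x assume x: "x \<in> carrier (Tn n)"
  show "\<phi> x = \<psi> x"
  proof (rule Tn_hom_eqI[OF Tn_module _ _ _ x])
    show "\<phi> \<in> module_hom class_ring (Tn n) (Tn n)" "\<psi> \<in> module_hom class_ring (Tn n) (Tn n)"
      using \<phi> \<psi> by (auto simp: braid_spec_def linear_maps_def)
    fix vs assume "vs \<in> words n"
    then obtain us v w ws where "vs = us @ v # w # ws" "us \<in> words i" "v \<in> C" "w \<in> C" "ws \<in> words (n - i - 2)"
      using words_split[OF _ i] by blast
    then show "\<phi> (pure vs) = \<psi> (pure vs)"
      using braid_spec_pure[OF \<phi>] braid_spec_pure[OF \<psi>] by simp
  qed
qed

lemma braid_at_spec:
  assumes "Suc i < n"
  shows "braid_spec n i (braid_at V c n i)"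
  unfolding braid_at_eq
proof (rule theI'[of "braid_spec n i"])
  show "\<exists>!\<phi>. braid_spec n i \<phi>"
    using braid_spec_exists[OF assms] braid_spec_unique[OF assms] by (rule ex_ex1I)
qed

lemma braid_at_hom: "Suc i < n \<Longrightarrow> braid_at V c n i \<in> module_hom class_ring (Tn n) (Tn n)"
  using braid_at_spec by (auto simp: braid_spec_def linear_maps_def)

definition braid_word :: "nat \<Rightarrow> nat list \<Rightarrow> ('v list \<Rightarrow>\<^sub>0 'k) set \<Rightarrow> ('v list \<Rightarrow>\<^sub>0 'k) set"
  where "braid_word n js = foldr (\<lambda>i \<phi>. braid_at V c n i \<circ> \<phi>) js id"

lemma braid_word_simps [simp]:
  "braid_word n [] x = x" "braid_word n (i # js) x = braid_at V c n i (braid_word n js x)"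
  by (simp_all add: braid_word_def)

lemma braid_word_hom:
  "js \<in> lists {i. Suc i < n} \<Longrightarrow> braid_word n js \<in> module_hom class_ring (Tn n) (Tn n)"
proof (induction js)
  case (Cons i js)
  have "braid_word n (i # js) = braid_at V c n i \<circ> braid_word n js"
    by (rule ext) simp
  then show ?case
    using Cons by (simp only:) (rule module_hom_compose[OF _ braid_at_hom], auto)
qed (simp add: module_hom_def)

text \<open>Replaces the chosen reduced expression by a concrete word. The later computations hold
  for every word that represents \<sigma>, so they cover whichever one \<open>SOME\<close>
  picks.\<close>

lemma braid_perm_word:
  assumes "\<sigma> permutes {..<n}"
  obtains js where "js \<in> lists {i. Suc i < n}" "word_perm js = \<sigma>" "braid_perm V c n \<sigma> = braid_word n js"
proof
  define js where "js = (SOME js. reduced_expression n \<sigma> js)"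
  have "reduced_expression n \<sigma> js"
    unfolding js_def by (rule someI_ex) (rule reduced_expression_exists[OF assms])
  then show "js \<in> lists {i. Suc i < n}" "word_perm js = \<sigma>"
    unfolding reduced_expression_def by blast+
  show "braid_perm V c n \<sigma> = braid_word n js"
    by (simp add: braid_perm_def braid_word_def js_def)
qed

lemma braid_perm_hom:
  assumes "\<sigma> permutes {..<n}"
  shows "braid_perm V c n \<sigma> \<in> module_hom class_ring (Tn n) (Tn n)"
proof -
  obtain js where js: "js \<in> lists {i. Suc i < n}" "braid_perm V c n \<sigma> = braid_word n js"
    by (rule braid_perm_word[OF assms])
  show ?thesis unfolding js(2) by (rule braid_word_hom[OF js(1)])
qed

abbreviation "perms n \<equiv> {\<sigma>. \<sigma> permutes {..<n::nat}}"

lemma symmetrizer_eq: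
  assumes "x \<in> carrier (Tn n)"
  shows "quantum_symmetrizer V c n x = (\<Oplus>\<^bsub>T\<^esub> \<sigma>\<in>perms n. braid_perm V c n \<sigma> x)"
  unfolding quantum_symmetrizer_def
  by (rule Tn_finsum) (use module_hom_closed[OF braid_perm_hom] assms in auto)

lemma symmetrizer_hom: "quantum_symmetrizer V c n \<in> module_hom class_ring (Tn n) (Tn n)"
proof -
  interpret n: module class_ring "Tn n" by (rule Tn_module)
  have closed: "braid_perm V c n \<sigma> x \<in> carrier (Tn n)" if "\<sigma> \<in> perms n" "x \<in> carrier (Tn n)" for \<sigma> x
    using module_hom_closed[OF braid_perm_hom] that by auto
  have "quantum_symmetrizer V c n (x \<oplus>\<^bsub>Tn n\<^esub> y)
      = quantum_symmetrizer V c n x \<oplus>\<^bsub>Tn n\<^esub> quantum_symmetrizer V c n y"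
    if "x \<in> carrier (Tn n)" "y \<in> carrier (Tn n)" for x y
  proof -
    have "quantum_symmetrizer V c n (x \<oplus>\<^bsub>Tn n\<^esub> y)
        = (\<Oplus>\<^bsub>Tn n\<^esub> \<sigma>\<in>perms n. braid_perm V c n \<sigma> x \<oplus>\<^bsub>Tn n\<^esub> braid_perm V c n \<sigma> y)"
      unfolding quantum_symmetrizer_def
      by (rule n.M.finsum_cong') (use that closed module_hom_add[OF braid_perm_hom] in auto)
    also have "\<dots> = quantum_symmetrizer V c n x \<oplus>\<^bsub>Tn n\<^esub> quantum_symmetrizer V c n y"
      unfolding quantum_symmetrizer_def by (rule n.M.finsum_addf) (use that closed in auto)
    finally show ?thesis .
  qed
  moreover have "quantum_symmetrizer V c n (a \<odot>\<^bsub>Tn n\<^esub> x) = a \<odot>\<^bsub>Tn n\<^esub> quantum_symmetrizer V c n x"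
    if "x \<in> carrier (Tn n)" for a x
  proof -
    have "quantum_symmetrizer V c n (a \<odot>\<^bsub>Tn n\<^esub> x) = (\<Oplus>\<^bsub>Tn n\<^esub> \<sigma>\<in>perms n. a \<odot>\<^bsub>Tn n\<^esub> braid_perm V c n \<sigma> x)"
      unfolding quantum_symmetrizer_def
      by (rule n.M.finsum_cong') (use that closed module_hom_smult[OF braid_perm_hom] in auto)
    also have "\<dots> = a \<odot>\<^bsub>Tn n\<^esub> quantum_symmetrizer V c n x"
      unfolding quantum_symmetrizer_def
      by (rule n.finsum_smult[symmetric]) (use that closed finite_permutations in auto)
    finally show ?thesis .
  qed
  moreover have "quantum_symmetrizer V c n x \<in> carrier (Tn n)" if "x \<in> carrier (Tn n)" for x
    unfolding quantum_symmetrizer_def by (rule n.M.finsum_closed) (use that closed in auto)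
  ultimately show ?thesis by (auto simp: module_hom_def)
qed

text \<open>Applied with \<open>h\<close> a functional \<open>f\<^sup>\<otimes>\<^sup>m\<close> for \<open>\<epsilon> = 1\<close>, and with \<open>h\<close> the projection to the exterior
  algebra for \<open>\<epsilon> = -1\<close>.\<close>

lemma symmetrizer_invariant:
  assumes N: "module class_ring N" and h: "h \<in> module_hom class_ring T N"
    and inv: "\<And>i x. \<lbrakk>Suc i < n; x \<in> carrier (Tn n)\<rbrakk> \<Longrightarrow> h (braid_at V c n i x) = h x"
    and x: "x \<in> carrier (Tn n)"
  shows "h (quantum_symmetrizer V c n x) = of_nat (fact n) \<odot>\<^bsub>N\<^esub> h x"
proof -
  interpret h: mod_hom class_ring T N h
    using N h by (simp add: mod_hom_def mod_hom_axioms_def T.VS.module_axioms)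
  have word: "h (braid_word n js y) = h y" if "js \<in> lists {i. Suc i < n}" "y \<in> carrier (Tn n)" for js y
    using that(1)
  proof (induction js)
    case (Cons i js)
    then have "braid_word n js y \<in> carrier (Tn n)"
      using module_hom_closed[OF braid_word_hom] that(2) by auto
    with Cons inv show ?case by simp
  qed simp
  have closed: "braid_perm V c n \<sigma> x \<in> carrier T" if "\<sigma> \<in> perms n" for \<sigma>
    using Tn_subset[OF funcset_mem[OF module_hom_closed[OF braid_perm_hom] x]] that by simp
  have "h (quantum_symmetrizer V c n x) = (\<Oplus>\<^bsub>N\<^esub> \<sigma>\<in>perms n. h (braid_perm V c n \<sigma> x))"
    unfolding symmetrizer_eq[OF x]
    by (rule module_hom_finsum[OF T.VS.module_axioms N h]) (use closed in auto)
  also have "\<dots> = (\<Oplus>\<^bsub>N\<^esub> \<sigma>\<in>perms n. h x)"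
  proof (rule h.N.M.finsum_cong')
    fix \<sigma> assume "\<sigma> \<in> perms n"
    then have "\<sigma> permutes {..<n}" by simp
    then obtain js where "js \<in> lists {i. Suc i < n}" "braid_perm V c n \<sigma> = braid_word n js"
      by (rule braid_perm_word)
    with word x show "h (braid_perm V c n \<sigma> x) = h x" by simp
  qed (use x Tn_subset in auto)
  also have "\<dots> = of_nat (fact n) \<odot>\<^bsub>N\<^esub> h x"
    using x Tn_subset by (subst finsum_const[OF N]) (auto simp: card_permutations finite_permutations)
  finally show ?thesis .
qed

end

section \<open>Linear functionals\<close>

definition scalar_space :: "('k::field, 'k) module" where
  "scalar_space = \<lparr>carrier = UNIV, mult = (*), one = 1, zero = 0, add = (+), smult = (*)\<rparr>"

lemma scalar_space_simps [simp]:
  "carrier scalar_space = UNIV" "zero scalar_space = 0" "add scalar_space = (+)" "smult scalar_space = (*)"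
  by (simp_all add: scalar_space_def)

lemma scalar_space_module: "module class_ring (scalar_space :: ('k::field, 'k) module)"
proof -
  have "vectorspace class_ring (scalar_space :: ('k, 'k) module)"
  proof (rule vectorspace_class_ringI, rule abelian_groupI)
    fix x :: 'k
    show "\<exists>y\<in>carrier scalar_space. y \<oplus>\<^bsub>scalar_space\<^esub> x = \<zero>\<^bsub>scalar_space\<^esub>"
      by (intro bexI[of _ "- x"]) auto
  qed (auto simp: algebra_simps)
  then show ?thesis by (simp add: vectorspace_def)
qed

text \<open>Zorn's lemma gives a subspace \<open>M\<close> maximal among those that miss
  \<open>v\<close>. Maximality forces \<open>V\<close> to be the direct sum of \<open>M\<close> and
  the line through \<open>v\<close>, and \<open>f\<close> reads off the coefficient of
  \<open>v\<close>.\<close>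

lemma linear_functional_exists:
  fixes V :: "('k::field, 'v, 'm) module_scheme"
  assumes V: "vectorspace class_ring V" and v: "v \<in> carrier V" "v \<noteq> \<zero>\<^bsub>V\<^esub>"
  obtains f where "f \<in> module_hom class_ring V scalar_space" "f v = 1"
proof -
  interpret vectorspace class_ring V by (rule V)
  note sm = class_smult[OF module_axioms]
  define \<A> where "\<A> = {U. submodule class_ring U V \<and> v \<notin> U}"
  have "\<exists>M\<in>\<A>. \<forall>X\<in>\<A>. M \<subseteq> X \<longrightarrow> X = M"
  proof (rule subset_Zorn_nonempty)
    have "submodule class_ring {\<zero>\<^bsub>V\<^esub>} V" by unfold_locales auto
    then show "\<A> \<noteq> {}" using v by (auto simp: \<A>_def)
    fix \<C> assume \<C>: "\<C> \<noteq> {}" "subset.chain \<A> \<C>"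
    then have sub: "submodule class_ring U V" if "U \<in> \<C>" for U
      using that by (auto simp: subset.chain_def \<A>_def)
    have "submodule class_ring (\<Union>\<C>) V"
    proof
      show "\<Union>\<C> \<subseteq> carrier V" using sub submodule.subset by blast
      show "\<zero>\<^bsub>V\<^esub> \<in> \<Union>\<C>" using \<C>(1) sub submodule.zero_closed by blast
      show "a \<odot>\<^bsub>V\<^esub> x \<in> \<Union>\<C>" if "x \<in> \<Union>\<C>" for a x
        using that sub submodule.smult_closed[of class_ring _ V a x] by auto
      fix x y assume "x \<in> \<Union>\<C>" "y \<in> \<Union>\<C>"
      then obtain X Y where XY: "X \<in> \<C>" "x \<in> X" "Y \<in> \<C>" "y \<in> Y" by auto
      then have "X \<subseteq> Y \<or> Y \<subseteq> X" using \<C>(2) by (auto simp: subset.chain_def)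
      then show "x \<oplus>\<^bsub>V\<^esub> y \<in> \<Union>\<C>"
        using XY submodule.m_closed[OF sub] by blast
    qed
    then show "\<Union>\<C> \<in> \<A>" using \<C>(2) by (auto simp: \<A>_def subset.chain_def)
  qed
  then obtain M where M: "submodule class_ring M V" "v \<notin> M"
    and max: "\<And>X. \<lbrakk>submodule class_ring X V; v \<notin> X; M \<subseteq> X\<rbrakk> \<Longrightarrow> X = M"
    by (auto simp: \<A>_def)
  interpret M: submodule class_ring M V by (rule M(1))
  have Mc: "u \<in> carrier V" if "u \<in> M" for u using that M.subset by auto
  have ex: "\<exists>a u. u \<in> M \<and> w = u \<oplus>\<^bsub>V\<^esub> a \<odot>\<^bsub>V\<^esub> v" if w: "w \<in> carrier V" for w
  proof -
    \<comment> \<open>The span of \<open>M\<close> and \<open>w\<close>. Either it equals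
      \<open>M\<close>, so \<open>w\<close> lies in \<open>M\<close>, or it contains
      \<open>v\<close>; then v = u + a w with \<open>a\<close> nonzero, because \<open>v\<close> is
      not in \<open>M\<close>, and the equation can be solved for \<open>w\<close>.\<close>
    define X where "X = {u \<oplus>\<^bsub>V\<^esub> a \<odot>\<^bsub>V\<^esub> w | u a. u \<in> M}"
    have "submodule class_ring X V"
    proof
      show "X \<subseteq> carrier V" using Mc w by (auto simp: X_def)
      have "\<zero>\<^bsub>V\<^esub> = \<zero>\<^bsub>V\<^esub> \<oplus>\<^bsub>V\<^esub> 0 \<odot>\<^bsub>V\<^esub> w" using w by (simp add: sm)
      then show "\<zero>\<^bsub>V\<^esub> \<in> X" unfolding X_def using M.zero_closed by blast
      show "b \<odot>\<^bsub>V\<^esub> x \<in> X" if x: "x \<in> X" for b x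
      proof -
        obtain u a where u: "u \<in> M" "x = u \<oplus>\<^bsub>V\<^esub> a \<odot>\<^bsub>V\<^esub> w" using x by (auto simp: X_def)
        then have "b \<odot>\<^bsub>V\<^esub> x = b \<odot>\<^bsub>V\<^esub> u \<oplus>\<^bsub>V\<^esub> (b * a) \<odot>\<^bsub>V\<^esub> w"
          using Mc w by (simp add: smult_r_distr sm)
        then show ?thesis unfolding X_def using u M.smult_closed by auto
      qed
      fix x y assume "x \<in> X" "y \<in> X"
      then obtain u a u' a' where u: "u \<in> M" "x = u \<oplus>\<^bsub>V\<^esub> a \<odot>\<^bsub>V\<^esub> w" "u' \<in> M" "y = u' \<oplus>\<^bsub>V\<^esub> a' \<odot>\<^bsub>V\<^esub> w"
        by (auto simp: X_def)
      then have "x \<oplus>\<^bsub>V\<^esub> y = (u \<oplus>\<^bsub>V\<^esub> u') \<oplus>\<^bsub>V\<^esub> (a + a') \<odot>\<^bsub>V\<^esub> w"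
        using Mc w by (simp add: sm M.a_ac)
      then show "x \<oplus>\<^bsub>V\<^esub> y \<in> X" unfolding X_def using u M.m_closed by blast
    qed
    moreover have "M \<subseteq> X"
    proof
      fix u assume "u \<in> M"
      then have "u = u \<oplus>\<^bsub>V\<^esub> 0 \<odot>\<^bsub>V\<^esub> w" using Mc w by (simp add: sm)
      with \<open>u \<in> M\<close> show "u \<in> X" unfolding X_def by blast
    qed
    ultimately consider "X = M" | "v \<in> X" using max by blast
    then show ?thesis
    proof cases
      case 1
      have "w = \<zero>\<^bsub>V\<^esub> \<oplus>\<^bsub>V\<^esub> 1 \<odot>\<^bsub>V\<^esub> w" using w by (simp add: sm)
      then have "w \<in> X" unfolding X_def using M.zero_closed by blast
      with 1 have "w \<in> M" by simp
      moreover have "w = w \<oplus>\<^bsub>V\<^esub> 0 \<odot>\<^bsub>V\<^esub> v" using w v by (simp add: sm)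
      ultimately show ?thesis by blast
    next
      case 2
      then obtain u a where u: "u \<in> M" "v = u \<oplus>\<^bsub>V\<^esub> a \<odot>\<^bsub>V\<^esub> w" by (auto simp: X_def)
      have "a \<noteq> 0" using u M(2) Mc w by (auto simp: sm)
      have "inverse a \<odot>\<^bsub>V\<^esub> v = inverse a \<odot>\<^bsub>V\<^esub> u \<oplus>\<^bsub>V\<^esub> (inverse a * a) \<odot>\<^bsub>V\<^esub> w"
        using u Mc w by (simp add: smult_r_distr sm)
      also have "\<dots> = inverse a \<odot>\<^bsub>V\<^esub> u \<oplus>\<^bsub>V\<^esub> w"
        using \<open>a \<noteq> 0\<close> w by (simp add: sm)
      finally have "w = (- inverse a) \<odot>\<^bsub>V\<^esub> u \<oplus>\<^bsub>V\<^esub> inverse a \<odot>\<^bsub>V\<^esub> v"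
        using u Mc w by (simp add: sm M.r_neg1)
      moreover have "(- inverse a) \<odot>\<^bsub>V\<^esub> u \<in> M" using u by simp
      ultimately show ?thesis by (intro exI conjI)
    qed
  qed
  have uniq: "a = b" if "u \<in> M" "u' \<in> M" "u \<oplus>\<^bsub>V\<^esub> a \<odot>\<^bsub>V\<^esub> v = u' \<oplus>\<^bsub>V\<^esub> b \<odot>\<^bsub>V\<^esub> v" for a b u u'
  proof (rule ccontr)
    assume "a \<noteq> b"
    \<comment> \<open>Two different coefficients would put a nonzero multiple of \<open>v\<close>,
      and hence \<open>v\<close> itself, into \<open>M\<close>.\<close>
    have "(a - b) \<odot>\<^bsub>V\<^esub> v = (- 1) \<odot>\<^bsub>V\<^esub> u \<oplus>\<^bsub>V\<^esub> u'"
    proof -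
      have "u \<oplus>\<^bsub>V\<^esub> (a - b) \<odot>\<^bsub>V\<^esub> v \<oplus>\<^bsub>V\<^esub> b \<odot>\<^bsub>V\<^esub> v = u \<oplus>\<^bsub>V\<^esub> ((a - b) + b) \<odot>\<^bsub>V\<^esub> v"
        using Mc that v by (simp only: sm(1)[OF v(1)] M.a_assoc smult_closed M.a_closed UNIV_I partial_object.select_convs)
      also have "\<dots> = u' \<oplus>\<^bsub>V\<^esub> b \<odot>\<^bsub>V\<^esub> v" using that by simp
      finally have "u \<oplus>\<^bsub>V\<^esub> (a - b) \<odot>\<^bsub>V\<^esub> v = u'"
        using Mc that v by (subst (asm) M.add.right_cancel) auto
      then show ?thesis using Mc[OF that(1)] v by (auto simp: sm M.r_neg1)
    qed
    then have "(a - b) \<odot>\<^bsub>V\<^esub> v \<in> M" using that by simp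
    then have "inverse (a - b) \<odot>\<^bsub>V\<^esub> ((a - b) \<odot>\<^bsub>V\<^esub> v) \<in> M" by simp
    then show False using \<open>a \<noteq> b\<close> v M(2) by (simp add: sm flip: sm(2))
  qed
  define f where "f w = (THE a. \<exists>u\<in>M. w = u \<oplus>\<^bsub>V\<^esub> a \<odot>\<^bsub>V\<^esub> v)" for w
  have f: "f (u \<oplus>\<^bsub>V\<^esub> a \<odot>\<^bsub>V\<^esub> v) = a" if "u \<in> M" for u a
    unfolding f_def by (rule the_equality) (use that uniq in auto)
  have "f \<in> module_hom class_ring V scalar_space"
    unfolding module_hom_def
  proof (intro CollectI conjI allI impI)
    fix x y assume "x \<in> carrier V \<and> y \<in> carrier V"
    then obtain u a u' a' where u: "u \<in> M" "x = u \<oplus>\<^bsub>V\<^esub> a \<odot>\<^bsub>V\<^esub> v" "u' \<in> M" "y = u' \<oplus>\<^bsub>V\<^esub> a' \<odot>\<^bsub>V\<^esub> v"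
      using ex[of x] ex[of y] by blast
    then have "x \<oplus>\<^bsub>V\<^esub> y = (u \<oplus>\<^bsub>V\<^esub> u') \<oplus>\<^bsub>V\<^esub> (a + a') \<odot>\<^bsub>V\<^esub> v"
      using Mc v by (simp add: sm M.a_ac)
    then show "f (x \<oplus>\<^bsub>V\<^esub> y) = f x \<oplus>\<^bsub>scalar_space\<^esub> f y"
      using u f M.m_closed by simp
  next
    fix b :: 'k and x assume "b \<in> carrier class_ring \<and> x \<in> carrier V"
    then obtain u a where u: "u \<in> M" "x = u \<oplus>\<^bsub>V\<^esub> a \<odot>\<^bsub>V\<^esub> v"
      using ex[of x] by blast
    then have "b \<odot>\<^bsub>V\<^esub> x = b \<odot>\<^bsub>V\<^esub> u \<oplus>\<^bsub>V\<^esub> (b * a) \<odot>\<^bsub>V\<^esub> v"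
      using Mc v by (simp add: smult_r_distr sm)
    then show "f (b \<odot>\<^bsub>V\<^esub> x) = b \<odot>\<^bsub>scalar_space\<^esub> f x"
      using u f M.smult_closed by simp
  qed simp
  moreover have "f v = 1"
    using f[OF M.zero_closed, of 1] v by (simp add: sm)
  ultimately show thesis by (rule that)
qed

context flip_braiding
begin

section \<open>The Nichols ideal as a sum of kernels\<close>

definition sym_kernel :: "nat \<Rightarrow> ('v list \<Rightarrow>\<^sub>0 'k) set set"
  where "sym_kernel n = {x \<in> carrier (Tn n). quantum_symmetrizer V c n x = \<zero>\<^bsub>T\<^esub>}"

lemma sym_kernel_submodule: "submodule class_ring (sym_kernel n) T"
proof -
  interpret S: mod_hom class_ring "Tn n" T "quantum_symmetrizer V c n"
    using symmetrizer_hom[of n] Tn_subset[of _ n]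
    by (auto simp: mod_hom_def mod_hom_axioms_def Tn_module T.VS.module_axioms module_hom_def Tn_simps)
  interpret n: submodule class_ring "carrier (Tn n)" T by (rule Tn_submodule)
  show ?thesis
  proof
    show "sym_kernel n \<subseteq> carrier T" using n.subset by (auto simp: sym_kernel_def)
    show "\<zero>\<^bsub>T\<^esub> \<in> sym_kernel n" using S.f0_is_0 by (simp add: sym_kernel_def Tn_simps)
    show "a \<odot>\<^bsub>T\<^esub> x \<in> sym_kernel n" if "x \<in> sym_kernel n" for a x
      using that S.f_smult[of a x] by (simp add: sym_kernel_def Tn_simps)
    show "x \<oplus>\<^bsub>T\<^esub> y \<in> sym_kernel n" if "x \<in> sym_kernel n" "y \<in> sym_kernel n" for x y
      using that S.f_add[of x y] by (simp add: sym_kernel_def Tn_simps)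
  qed
qed

lemma nichols_ideal_eq:
  "nichols_ideal V c = {\<Oplus>\<^bsub>T\<^esub> n\<in>N. x n | N x. finite N \<and> N \<subseteq> {2..} \<and> (\<forall>n\<in>N. x n \<in> sym_kernel n)}"
  by (simp add: nichols_ideal_def sym_kernel_def Tn_simps)

lemma nichols_idealI:
  "\<lbrakk>finite N; N \<subseteq> {2..}; \<And>n. n \<in> N \<Longrightarrow> x n \<in> sym_kernel n\<rbrakk>
    \<Longrightarrow> (\<Oplus>\<^bsub>T\<^esub> n\<in>N. x n) \<in> nichols_ideal V c"
  unfolding nichols_ideal_eq by blast

lemma nichols_idealE:
  assumes "y \<in> nichols_ideal V c"
  obtains N x where "finite N" "N \<subseteq> {2..}" "\<And>n. n \<in> N \<Longrightarrow> x n \<in> sym_kernel n"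
    "y = (\<Oplus>\<^bsub>T\<^esub> n\<in>N. x n)"
proof -
  from assms obtain N x where "finite N \<and> N \<subseteq> {2..} \<and> (\<forall>n\<in>N. x n \<in> sym_kernel n) \<and> y = (\<Oplus>\<^bsub>T\<^esub> n\<in>N. x n)"
    unfolding nichols_ideal_eq by blast
  then show thesis by (intro that[of N x]) auto
qed

lemma sym_kernel_subset_nichols:
  assumes "x \<in> sym_kernel n" "2 \<le> n"
  shows "x \<in> nichols_ideal V c"
proof -
  have "x \<in> carrier T" using assms submodule.subset[OF sym_kernel_submodule] by blast
  then have "x = (\<Oplus>\<^bsub>T\<^esub> n\<in>{n}. x)" by simp
  also have "\<dots> \<in> nichols_ideal V c" by (rule nichols_idealI) (use assms in auto)
  finally show ?thesis .
qed

text \<open>Every element is a finite sum of kernel elements, so a subspace containing all kernels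
  of degree at least 2 contains it. This reduces inclusions to a single degree, both for kernels of
  functionals and for the ideal of squares.\<close>

lemma nichols_ideal_least:
  assumes "submodule class_ring U T" "\<And>n. 2 \<le> n \<Longrightarrow> sym_kernel n \<subseteq> U"
  shows "nichols_ideal V c \<subseteq> U"
proof
  interpret U: submodule class_ring U T by fact
  fix y assume "y \<in> nichols_ideal V c"
  then obtain N x where N: "finite N" "N \<subseteq> {2..}" "\<And>n. n \<in> N \<Longrightarrow> x n \<in> sym_kernel n"
    and y: "y = (\<Oplus>\<^bsub>T\<^esub> n\<in>N. x n)"
    by (rule nichols_idealE) blast
  have "x n \<in> U" if "n \<in> N" for n using N(2,3) assms(2) that by fastforce
  with N(1) show "y \<in> U" unfolding y
  proof induction
    case (insert a A)
    then have "x \<in> A \<rightarrow> carrier T" "x a \<in> carrier T" using U.subset by auto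
    with insert show ?case by simp
  qed simp
qed

lemma nichols_ideal_submodule: "submodule class_ring (nichols_ideal V c) T"
proof
  let ?I = "nichols_ideal V c"
  have K: "sym_kernel n \<subseteq> carrier T" for n
    by (rule submodule.subset[OF sym_kernel_submodule])
  show "?I \<subseteq> carrier T"
  proof (rule nichols_ideal_least)
    show "submodule class_ring (carrier T) T" by unfold_locales auto
  qed (rule K)
  have "\<zero>\<^bsub>T\<^esub> = (\<Oplus>\<^bsub>T\<^esub> n\<in>({}::nat set). \<zero>\<^bsub>T\<^esub>)" by simp
  also have "\<dots> \<in> ?I" by (rule nichols_idealI) auto
  finally show "\<zero>\<^bsub>T\<^esub> \<in> ?I" .
  show "a \<odot>\<^bsub>T\<^esub> y \<in> ?I" if y: "y \<in> ?I" for a y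
  proof -
    obtain N x where N: "finite N" "N \<subseteq> {2..}" "\<And>n. n \<in> N \<Longrightarrow> x n \<in> sym_kernel n"
      and y: "y = (\<Oplus>\<^bsub>T\<^esub> n\<in>N. x n)"
      using y by (rule nichols_idealE) blast
    have "a \<odot>\<^bsub>T\<^esub> y = (\<Oplus>\<^bsub>T\<^esub> n\<in>N. a \<odot>\<^bsub>T\<^esub> x n)"
      unfolding y by (rule T.VS.finsum_smult) (use N(1) subsetD[OF K N(3)] in auto)
    also have "\<dots> \<in> ?I"
      by (rule nichols_idealI) (use N submodule.smult_closed[OF sym_kernel_submodule] in auto)
    finally show ?thesis .
  qed
  fix y z assume "y \<in> ?I" "z \<in> ?I"
  obtain N x where N: "finite N" "N \<subseteq> {2..}" "\<And>n. n \<in> N \<Longrightarrow> x n \<in> sym_kernel n"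
    and y: "y = (\<Oplus>\<^bsub>T\<^esub> n\<in>N. x n)"
    using \<open>y \<in> ?I\<close> by (rule nichols_idealE) blast
  obtain N' x' where N': "finite N'" "N' \<subseteq> {2..}" "\<And>n. n \<in> N' \<Longrightarrow> x' n \<in> sym_kernel n"
    and z: "z = (\<Oplus>\<^bsub>T\<^esub> n\<in>N'. x' n)"
    using \<open>z \<in> ?I\<close> by (rule nichols_idealE) blast
  \<comment> \<open>The two sums may run over different sets of degrees. Both families are padded
    with zeros, so that they can be added over the union.\<close>
  define u where "u n = (if n \<in> N then x n else \<zero>\<^bsub>T\<^esub>)" for n
  define u' where "u' n = (if n \<in> N' then x' n else \<zero>\<^bsub>T\<^esub>)" for n
  have ker: "u n \<in> sym_kernel n" "u' n \<in> sym_kernel n" for n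
    using N(3) N'(3) submodule.zero_closed[OF sym_kernel_submodule] by (auto simp: u_def u'_def)
  then have closed: "u \<in> A \<rightarrow> carrier T" "u' \<in> A \<rightarrow> carrier T" for A
    using K by blast+
  have "y = (\<Oplus>\<^bsub>T\<^esub> n\<in>N \<union> N'. u n)"
    unfolding y by (rule T.add.finprod_mono_neutral_cong_left)
      (use N(1) N'(1) subsetD[OF K N(3)] subsetD[OF K N'(3)] in \<open>auto simp: u_def\<close>)
  moreover have "z = (\<Oplus>\<^bsub>T\<^esub> n\<in>N \<union> N'. u' n)"
    unfolding z by (rule T.add.finprod_mono_neutral_cong_left)
      (use N(1) N'(1) subsetD[OF K N(3)] subsetD[OF K N'(3)] in \<open>auto simp: u'_def\<close>)
  ultimately have "y \<oplus>\<^bsub>T\<^esub> z = (\<Oplus>\<^bsub>T\<^esub> n\<in>N \<union> N'. u n \<oplus>\<^bsub>T\<^esub> u' n)"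
    using T.finsum_addf[OF closed] by simp
  also have "\<dots> \<in> ?I"
    by (rule nichols_idealI) (use N(1,2) N'(1,2) ker submodule.m_closed[OF sym_kernel_submodule] in auto)
  finally show "y \<oplus>\<^bsub>T\<^esub> z \<in> ?I" .
qed

end

context flip_braiding
begin

section \<open>The symmetric case\<close>

text \<open>The product of the values of \<open>f\<close> is multilinear in the letters. The result
  is the \<open>m\<close>-th tensor power of \<open>f\<close>, extended by zero to the other
  degrees.\<close>

lemma power_functional:
  assumes f: "f \<in> module_hom class_ring V scalar_space"
  obtains \<phi> where "\<phi> \<in> module_hom class_ring T scalar_space"
    "\<And>vs. vs \<in> lists C \<Longrightarrow> \<phi> (pure vs) = (if length vs = m then prod_list (map f vs) else 0)"
proof (rule tensor_universal[OF scalar_space_module])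
  show "multilinear V scalar_space (\<lambda>vs. if length vs = m then prod_list (map f vs) else 0)"
    using module_hom_add[OF f] module_hom_smult[OF f]
    by (auto simp: multilinear_def algebra_simps)
qed (use that in blast)

text \<open>Products in a field commute, so for \<epsilon> = 1 swapping neighbours does not change
  \<phi> and \<open>symmetrizer_invariant\<close> applies. In degree \<open>m\<close> this gives m!
  \<phi>(x) = 0 on the kernel, hence \<phi>(x) = 0; in any other degree \<phi> is zero from the
  start.\<close>

lemma power_functional_nichols:
  assumes \<epsilon>: "\<epsilon> = 1"
    and \<phi>: "\<phi> \<in> module_hom class_ring T scalar_space"
    and \<phi>_pure: "\<And>vs. vs \<in> lists C \<Longrightarrow> \<phi> (pure vs) = (if length vs = m then prod_list (map f vs) else 0)"
    and x: "x \<in> nichols_ideal V c"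
  shows "\<phi> x = 0"
proof -
  interpret \<phi>: mod_hom class_ring T scalar_space \<phi>
    using \<phi> by (simp add: mod_hom_def mod_hom_axioms_def T.VS.module_axioms scalar_space_module)
  have inv: "\<phi> (braid_at V c n i x) = \<phi> x" if i: "Suc i < n" and x: "x \<in> carrier (Tn n)" for n i x
  proof (rule Tn_hom_eqI[where f = "\<lambda>x. \<phi> (braid_at V c n i x)", OF scalar_space_module _ T_hom_Tn[OF \<phi>] _ x])
    show "(\<lambda>x. \<phi> (braid_at V c n i x)) \<in> module_hom class_ring (Tn n) scalar_space"
      using module_hom_compose[OF braid_at_hom[OF i] T_hom_Tn[OF \<phi>]] by (simp add: comp_def)
    fix vs assume "vs \<in> words n"
    then obtain us v w ws where vs: "vs = us @ v # w # ws" "us \<in> words i" "v \<in> C" "w \<in> C" "ws \<in> words (n - i - 2)"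
      using words_split[OF _ i] by blast
    then have "braid_at V c n i (pure vs) = pure (us @ w # v # ws)"
      using braid_spec_pure[OF braid_at_spec[OF i]] \<epsilon>
      by (simp add: words_def class_smult[OF T.VS.module_axioms])
    then show "\<phi> (braid_at V c n i (pure vs)) = \<phi> (pure vs)"
      using vs by (simp add: \<phi>_pure words_def)
  qed
  have "sym_kernel n \<subseteq> \<phi>.ker" for n
  proof
    fix x assume x: "x \<in> sym_kernel n"
    then have xn: "x \<in> carrier (Tn n)" by (simp add: sym_kernel_def)
    have "\<phi> x = 0"
    proof (cases "n = m")
      case True
      have "fact n * \<phi> x = \<phi> (quantum_symmetrizer V c n x)"
        using symmetrizer_invariant[OF scalar_space_module \<phi> inv xn] by simp
      also have "\<dots> = 0" using x \<phi>.f0_is_0 by (simp add: sym_kernel_def)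
      finally show ?thesis by simp
    next
      case False
      show ?thesis
        by (rule Tn_hom_eqI[where g = "\<lambda>_. 0", OF scalar_space_module T_hom_Tn[OF \<phi>] _ _ xn])
          (use False \<phi>_pure in \<open>auto simp: module_hom_def words_def\<close>)
    qed
    then show "x \<in> \<phi>.ker" using Tn_subset[OF xn] by (simp add: \<phi>.ker_def)
  qed
  then show ?thesis
    using nichols_ideal_least[OF \<phi>.ker_is_submodule] x by (auto simp: \<phi>.ker_def)
qed

text \<open>The classes \<open>e n\<close> of the powers of \<open>v\<close> and the descended
  functionals \<open>g m\<close> form dual families: \<open>g m (e n)\<close> is 1 for m = n and 0
  otherwise. Hence the \<open>e n\<close> are distinct and independent, which a finite-dimensional
  space does not allow.\<close>

lemma symmetric_not_fin_dim:
  assumes \<epsilon>: "\<epsilon> = 1" and nonzero: "C \<noteq> {\<zero>\<^bsub>V\<^esub>}"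
  shows "\<not> vectorspace.fin_dim class_ring (nichols_algebra V c)"
proof
  let ?B = "nichols_algebra V c"
  interpret Q: quotient_space T "nichols_ideal V c"
    using nichols_ideal_submodule T.VS.vectorspace_axioms by (simp add: quotient_space_def)
  have B_eq: "?B = quotient_module T (nichols_ideal V c)" by (simp add: nichols_algebra_def)
  interpret B: vectorspace class_ring ?B
    unfolding B_eq by (rule Q.quotient_vectorspace)
  assume fd: "B.fin_dim"
  obtain v where v: "v \<in> C" "v \<noteq> \<zero>\<^bsub>V\<^esub>" using nonzero V.M.zero_closed by blast
  obtain f where f: "f \<in> module_hom class_ring V scalar_space" "f v = 1"
    using linear_functional_exists[OF V.vectorspace_axioms v] by blast
  define e where "e n = Q.proj (pure (replicate n v))" for n
  have vn: "replicate n v \<in> lists C" for n using v by simp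
  have eB: "e n \<in> carrier ?B" for n
    using vn by (simp add: e_def B_eq Q.quotient_simps)
  have "\<exists>g. g \<in> module_hom class_ring ?B scalar_space \<and> (\<forall>n. g (e n) = (if n = m then 1 else 0))" for m
  proof -
    obtain \<phi> where \<phi>: "\<phi> \<in> module_hom class_ring T scalar_space"
      "\<And>vs. vs \<in> lists C \<Longrightarrow> \<phi> (pure vs) = (if length vs = m then prod_list (map f vs) else 0)"
      using power_functional[OF f(1)] by blast
    have "\<phi> x = \<zero>\<^bsub>scalar_space\<^esub>" if "x \<in> nichols_ideal V c" for x
      using power_functional_nichols[OF \<epsilon> \<phi> that] by simp
    then obtain g where "g \<in> module_hom class_ring ?B scalar_space"
      "\<And>x. x \<in> carrier T \<Longrightarrow> g (Q.proj x) = \<phi> x"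
      using Q.quotient_lift[OF scalar_space_module \<phi>(1)] unfolding B_eq by blast
    then show ?thesis
      using vn \<phi>(2) f(2) by (intro exI[of _ g]) (simp add: e_def)
  qed
  then obtain g where g: "\<And>m. g m \<in> module_hom class_ring ?B scalar_space"
    "\<And>m n. g m (e n) = (if n = m then 1 else 0)"
    by metis
  have inj: "inj e"
    by (rule injI) (metis g(2) zero_neq_one)
  have "\<not> B.lin_dep (range e)"
  proof
    assume "B.lin_dep (range e)"
    then obtain A a u where A: "finite A" "A \<subseteq> range e" "B.lincomb a A = \<zero>\<^bsub>?B\<^esub>" "u \<in> A" "a u \<noteq> 0"
      unfolding B.lin_dep_def by auto
    obtain m where m: "u = e m" using A by auto
    interpret g: mod_hom class_ring ?B scalar_space "g m"
      using g by (simp add: mod_hom_def mod_hom_axioms_def B.module_axioms scalar_space_module)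
    have Ac: "A \<subseteq> carrier ?B" using A eB by auto
    have sum: "finsum (scalar_space :: ('k, 'k) module) h A = sum h A" for h
      using A(1) by induction auto
    \<comment> \<open>Since \<open>u\<close> is \<open>e m\<close>, the functional
      \<open>g m\<close> picks out the coefficient of \<open>u\<close> in the vanishing
      combination.\<close>
    have "0 = g m (B.lincomb a A)" using A(3) g.f0_is_0 by simp
    also have "\<dots> = (\<Sum>x\<in>A. g m (a x \<odot>\<^bsub>?B\<^esub> x))"
      unfolding B.lincomb_def
      by (subst module_hom_finsum[OF B.module_axioms scalar_space_module g(1)]) (use Ac in \<open>auto simp: sum\<close>)
    also have "\<dots> = (\<Sum>x\<in>A. if x = u then a u else 0)"
    proof (rule sum.cong[OF refl])
      fix x assume x: "x \<in> A"
      then obtain n where n: "x = e n" using A by auto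
      have "g m (a x \<odot>\<^bsub>?B\<^esub> x) = a x * g m x" using g.f_smult[of "a x" x] x Ac by auto
      then show "g m (a x \<odot>\<^bsub>?B\<^esub> x) = (if x = u then a u else 0)"
        using n m g(2) inj by (auto simp: inj_eq)
    qed
    also have "\<dots> = a u" using A by simp
    finally show False using A by simp
  qed
  then have "finite (range e)"
    by (rule B.fin_dim_li_fin[OF fd]) (use eB in auto)
  then show False using inj finite_imageD by blast
qed

section \<open>The exterior case\<close>

abbreviation "alt_ideal \<equiv> genideal T {pure [v, v] | v. v \<in> C}"

lemma squares_subset: "{pure [v, v] | v. v \<in> C} \<subseteq> carrier T"
  by auto

lemma alt_ideal: "ideal alt_ideal T"
  by (rule T.genideal_ideal[OF squares_subset])

text \<open>An instance of \<open>genideal_eq_span\<close> with the pure tensors as multiplicative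
  spanning set. It reduces membership in the Nichols ideal to words with two equal
  neighbours.\<close>

lemma alt_ideal_span:
  "alt_ideal = T.VS.span {pure us \<otimes>\<^bsub>T\<^esub> pure [v, v] \<otimes>\<^bsub>T\<^esub> pure ws | us v ws.
    us \<in> lists C \<and> v \<in> C \<and> ws \<in> lists C}"
proof -
  have "alt_ideal = T.VS.span {a \<otimes>\<^bsub>T\<^esub> x \<otimes>\<^bsub>T\<^esub> b | a x b.
      a \<in> pure ` lists C \<and> x \<in> {pure [v, v] | v. v \<in> C} \<and> b \<in> pure ` lists C}"
  proof (rule T.genideal_eq_span[OF _ _ _ pure_span squares_subset])
    show "pure ` lists C \<subseteq> carrier T" using pure_closed by blast
    show "\<one>\<^bsub>T\<^esub> \<in> pure ` lists C" unfolding pure_Nil[symmetric] by blast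
    fix a b assume "a \<in> pure ` lists C" "b \<in> pure ` lists C"
    then obtain us ws where "us \<in> lists C" "ws \<in> lists C" "a = pure us" "b = pure ws" by blast
    then have "a \<otimes>\<^bsub>T\<^esub> b = pure (us @ ws)" "us @ ws \<in> lists C" by (simp_all add: pure_mult)
    then show "a \<otimes>\<^bsub>T\<^esub> b \<in> pure ` lists C" by blast
  qed
  also have "{a \<otimes>\<^bsub>T\<^esub> x \<otimes>\<^bsub>T\<^esub> b | a x b.
      a \<in> pure ` lists C \<and> x \<in> {pure [v, v] | v. v \<in> C} \<and> b \<in> pure ` lists C}
    = {pure us \<otimes>\<^bsub>T\<^esub> pure [v, v] \<otimes>\<^bsub>T\<^esub> pure ws | us v ws. us \<in> lists C \<and> v \<in> C \<and> ws \<in> lists C}"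
    by blast
  finally show ?thesis .
qed

text \<open>Each letter contributes one factor -1, and together they give the sign. The inverse
  appears because \<open>permute_list\<close> is contravariant: permuting by \<open>p\<close> and
  then by \<open>t\<close> is permuting by the composite of \<open>p\<close> after \<open>t\<close>,
  whereas \<open>word_perm\<close> puts the new letter on the left.\<close>

lemma braid_word_pure:
  assumes \<epsilon>: "\<epsilon> = - 1" and "js \<in> lists {i. Suc i < n}" and vs: "vs \<in> words n"
  shows "braid_word n js (pure vs)
    = of_int (sign (word_perm js)) \<odot>\<^bsub>T\<^esub> pure (permute_list (inv_into UNIV (word_perm js)) vs)"
  using assms(2)
proof (induction js)
  case Nil
  then show ?case
    using vs by (simp add: class_smult[OF T.VS.module_axioms] words_def)
next
  case (Cons i js)
  let ?t = "Transposition.transpose i (Suc i)"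
  let ?p = "inv_into UNIV (word_perm js)"
  have i: "Suc i < n" and js: "js \<in> lists {i. Suc i < n}" using Cons.hyps by simp_all
  have t: "?t permutes {..<n}" by (rule adjacent_transpose_permutes[OF i])
  have p: "?p permutes {..<n}" by (rule permutes_inv[OF word_perm_permutes[OF js]])
  have len: "length vs = n" using vs by (simp add: words_def)
  have pvs: "permute_list ?p vs \<in> words n"
    using vs p set_permute_list[of ?p vs] by (auto simp: words_def)
  obtain us v w ws where split: "permute_list ?p vs = us @ v # w # ws" "us \<in> words i" "v \<in> C" "w \<in> C" "ws \<in> words (n - i - 2)"
    by (rule words_split[OF pvs i])
  have swap: "permute_list ?t (permute_list ?p vs) = us @ w # v # ws"
    using split permute_list_adjacent[of us v w ws] by (simp add: words_def)
  have "braid_word n (i # js) (pure vs)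
      = of_int (sign (word_perm js)) \<odot>\<^bsub>T\<^esub> (\<epsilon> \<odot>\<^bsub>T\<^esub> pure (us @ w # v # ws))"
    using Cons.IH module_hom_smult[OF braid_at_hom[OF i], of "of_int (sign (word_perm js))" "pure (permute_list ?p vs)"]
      braid_spec_pure[OF braid_at_spec[OF i] split(2-5)] pure_in_Tn[OF pvs]
    by (simp add: split(1) Tn_simps)
  also have "\<dots> = of_int (sign (word_perm (i # js))) \<odot>\<^bsub>T\<^esub> pure (us @ w # v # ws)"
  proof -
    have "sign (word_perm (i # js)) = - sign (word_perm js)"
      unfolding sign_word_perm by simp
    then show ?thesis
      using split \<epsilon> by (simp add: words_def flip: class_smult(2)[OF T.VS.module_axioms])
  qed
  also have "us @ w # v # ws = permute_list (?p \<circ> ?t) vs"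
    using swap permute_list_compose[of ?t vs ?p] t len by simp
  also have "?p \<circ> ?t = inv_into UNIV (word_perm (i # js))"
    using o_inv_distrib[of ?t "word_perm js"] permutes_bij[OF word_perm_permutes[OF js]]
    by (simp only: word_perm_simps bij_swap inv_swap_id) simp
  finally show ?case .
qed

text \<open>Composing \<sigma> on the right with the transposition \<open>?t\<close> of the two
  equal letters flips the sign. As inverses act on words, \<open>?t\<close> is applied to the word
  first and leaves it unchanged. The summands for \<sigma> and for its product with
  \<open>?t\<close> are therefore opposite.\<close>

lemma antisymmetrizer_kills_square:
  assumes \<epsilon>: "\<epsilon> = - 1" and us: "us \<in> lists C" "v \<in> C" "ws \<in> lists C"
    and n: "n = length us + length ws + 2"
  shows "pure (us @ v # v # ws) \<in> sym_kernel n"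
proof -
  let ?vs = "us @ v # v # ws"
  let ?t = "Transposition.transpose (length us) (Suc (length us))"
  define g where "g \<sigma> = braid_perm V c n \<sigma> (pure ?vs)" for \<sigma>
  have vs: "?vs \<in> words n" using us n by (auto simp: words_def)
  have t: "?t permutes {..<n}" by (rule adjacent_transpose_permutes) (simp add: n)
  have g: "g \<sigma> = of_int (sign \<sigma>) \<odot>\<^bsub>T\<^esub> pure (permute_list (inv_into UNIV \<sigma>) ?vs)" if "\<sigma> \<in> perms n" for \<sigma>
  proof -
    have "\<sigma> permutes {..<n}" using that by simp
    then obtain js where "js \<in> lists {i. Suc i < n}" "word_perm js = \<sigma>" "braid_perm V c n \<sigma> = braid_word n js"
      by (rule braid_perm_word)
    then show ?thesis using braid_word_pure[OF \<epsilon> _ vs] by (auto simp: g_def)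
  qed
  have closed: "pure (permute_list (inv_into UNIV \<sigma>) ?vs) \<in> carrier T" if "\<sigma> \<in> perms n" for \<sigma>
  proof -
    have "inv_into UNIV \<sigma> permutes {..<length ?vs}" using that n permutes_inv[of \<sigma>] by simp
    then show ?thesis using us set_permute_list[of "inv_into UNIV \<sigma>" ?vs] by (intro pure_closed) auto
  qed
  have g_closed: "g \<in> perms n \<rightarrow> carrier T" using g closed by auto
  have gt: "g (\<sigma> \<circ> ?t) = (- 1) \<odot>\<^bsub>T\<^esub> g \<sigma>" if \<sigma>: "\<sigma> \<in> perms n" for \<sigma>
  proof -
    have \<sigma>t: "\<sigma> \<circ> ?t \<in> perms n" using permutes_compose[OF t] \<sigma> by simp
    have inv: "inv_into UNIV (\<sigma> \<circ> ?t) = ?t \<circ> inv_into UNIV \<sigma>"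
      using o_inv_distrib[of \<sigma> ?t] permutes_bij[of \<sigma>] \<sigma> by (simp only: bij_swap inv_swap_id mem_Collect_eq) simp
    have "permute_list (inv_into UNIV (\<sigma> \<circ> ?t)) ?vs = permute_list (inv_into UNIV \<sigma>) (permute_list ?t ?vs)"
      unfolding inv by (rule permute_list_compose) (use \<sigma> n permutes_inv[of \<sigma>] in simp)
    also have "\<dots> = permute_list (inv_into UNIV \<sigma>) ?vs"
      by (simp only: permute_list_adjacent)
    finally have "g (\<sigma> \<circ> ?t) = of_int (sign (\<sigma> \<circ> ?t)) \<odot>\<^bsub>T\<^esub> pure (permute_list (inv_into UNIV \<sigma>) ?vs)"
      using g[OF \<sigma>t] by simp
    also have "sign (\<sigma> \<circ> ?t) = - sign \<sigma>"
    proof -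
      have "permutation \<sigma>" using \<sigma> permutation_permutes by blast
      then show ?thesis by (subst sign_compose) (simp_all add: permutation_swap_id sign_swap_id)
    qed
    also have "of_int (- sign \<sigma>) \<odot>\<^bsub>T\<^esub> pure (permute_list (inv_into UNIV \<sigma>) ?vs) = (- 1) \<odot>\<^bsub>T\<^esub> g \<sigma>"
      unfolding g[OF \<sigma>] using closed[OF \<sigma>] by (simp add: class_smult[OF T.VS.module_axioms])
    finally show ?thesis .
  qed
  define S where "S = (\<Oplus>\<^bsub>T\<^esub> \<sigma>\<in>perms n. g \<sigma>)"
  have Sc: "S \<in> carrier T" unfolding S_def using g_closed by (rule T.finsum_closed)
  have bij: "bij_betw (\<lambda>\<sigma>. \<sigma> \<circ> ?t) (perms n) (perms n)"
  proof (rule bij_betw_byWitness[where f' = "\<lambda>\<sigma>. \<sigma> \<circ> ?t"])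
    show "\<forall>\<sigma>\<in>perms n. (\<sigma> \<circ> ?t) \<circ> ?t = \<sigma>" "\<forall>\<sigma>\<in>perms n. (\<sigma> \<circ> ?t) \<circ> ?t = \<sigma>"
      by (simp_all add: fun_eq_iff)
    show "(\<lambda>\<sigma>. \<sigma> \<circ> ?t) ` perms n \<subseteq> perms n" "(\<lambda>\<sigma>. \<sigma> \<circ> ?t) ` perms n \<subseteq> perms n"
      using permutes_compose[OF t] by blast+
  qed
  have "S = (\<Oplus>\<^bsub>T\<^esub> \<sigma>\<in>perms n. g (\<sigma> \<circ> ?t))"
    unfolding S_def
    using T.add.finprod_reindex[of g "\<lambda>\<sigma>. \<sigma> \<circ> ?t" "perms n"] bij g_closed
    by (simp add: bij_betw_def)
  also have "\<dots> = (\<Oplus>\<^bsub>T\<^esub> \<sigma>\<in>perms n. (- 1) \<odot>\<^bsub>T\<^esub> g \<sigma>)"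
    by (rule T.finsum_cong') (use gt g_closed in auto)
  also have "\<dots> = (- 1) \<odot>\<^bsub>T\<^esub> S"
    unfolding S_def by (rule T.VS.finsum_smult[symmetric]) (use g_closed finite_permutations in auto)
  \<comment> \<open>Reindexing the sum along this involution of the permutations gives S = -S;
    dividing by 2 then yields S = 0.\<close>
  finally have "S \<oplus>\<^bsub>T\<^esub> S = \<zero>\<^bsub>T\<^esub>"
    using Sc by (metis T.r_neg class_smult(3,5)[OF T.VS.module_axioms])
  then have "(1 + 1) \<odot>\<^bsub>T\<^esub> S = \<zero>\<^bsub>T\<^esub>"
    using Sc by (simp only: class_smult[OF T.VS.module_axioms])
  then have "inverse (1 + 1) \<odot>\<^bsub>T\<^esub> ((1 + 1) \<odot>\<^bsub>T\<^esub> S) = \<zero>\<^bsub>T\<^esub>"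
    by simp
  then have "S = \<zero>\<^bsub>T\<^esub>"
    using Sc by (simp add: class_smult[OF T.VS.module_axioms] flip: class_smult(2)[OF T.VS.module_axioms])
  then show ?thesis
    using symmetrizer_eq[OF pure_in_Tn[OF vs]] by (simp add: sym_kernel_def pure_in_Tn[OF vs] S_def g_def)
qed

text \<open>One inclusion is the vanishing on repeated neighbours. For the other, the projection to
  the quotient by the squares is invariant under all \<open>braid_at\<close>, so a kernel element
  has n! times its class equal to zero. It thus lies in the ideal, with no need to split the ideal
  by degree.\<close>

lemma nichols_ideal_exterior:
  assumes \<epsilon>: "\<epsilon> = - 1"
  shows "nichols_ideal V c = alt_ideal"
proof
  show "alt_ideal \<subseteq> nichols_ideal V c"
    unfolding alt_ideal_span
  proof (rule T.VS.span_is_subset[OF _ nichols_ideal_submodule])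
    have "pure us \<otimes>\<^bsub>T\<^esub> pure [v, v] \<otimes>\<^bsub>T\<^esub> pure ws \<in> nichols_ideal V c"
      if "us \<in> lists C" "v \<in> C" "ws \<in> lists C" for us v ws
      using sym_kernel_subset_nichols[OF antisymmetrizer_kills_square[OF \<epsilon> that refl]] that
      by (simp add: pure_mult)
    then show "{pure us \<otimes>\<^bsub>T\<^esub> pure [v, v] \<otimes>\<^bsub>T\<^esub> pure ws | us v ws. us \<in> lists C \<and> v \<in> C \<and> ws \<in> lists C}
        \<subseteq> nichols_ideal V c"
      by blast
  qed
  interpret I: ideal alt_ideal T by (rule alt_ideal)
  have sub: "submodule class_ring alt_ideal T" by (rule T.ideal_submodule[OF alt_ideal])
  interpret Q: quotient_space T alt_ideal
    using sub T.VS.vectorspace_axioms by (simp add: quotient_space_def)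
  let ?Q = "quotient_module T alt_ideal"
  interpret QV: vectorspace class_ring ?Q by (rule Q.quotient_vectorspace)
  have square: "pure (us @ v # v # ws) \<in> alt_ideal" if "us \<in> lists C" "v \<in> C" "ws \<in> lists C" for us v ws
  proof -
    have "pure [v, v] \<in> alt_ideal" using T.genideal_self[OF squares_subset] that by blast
    then have "pure us \<otimes>\<^bsub>T\<^esub> pure [v, v] \<otimes>\<^bsub>T\<^esub> pure ws \<in> alt_ideal"
      using that by (intro I.I_l_closed I.I_r_closed) auto
    then show ?thesis using that by (simp add: pure_mult)
  qed
  \<comment> \<open>Polarization: expanding the square of v + w and removing the squares of
    \<open>v\<close> and of \<open>w\<close> leaves the sum of the two mixed terms, so these are
    opposite in the quotient.\<close>
  have swap: "Q.proj ((- 1) \<odot>\<^bsub>T\<^esub> pure (us @ w # v # ws)) = Q.proj (pure (us @ v # w # ws))"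
    if "us \<in> lists C" "v \<in> C" "w \<in> C" "ws \<in> lists C" for us v w ws
  proof -
    let ?p = "\<lambda>v w. pure (us @ v # w # ws)"
    have c: "?p x y \<in> carrier T" if "x \<in> C" "y \<in> C" for x y
      using that \<open>us \<in> lists C\<close> \<open>ws \<in> lists C\<close> by simp
    have a1: "?p (x \<oplus>\<^bsub>V\<^esub> y) z = ?p x z \<oplus>\<^bsub>T\<^esub> ?p y z" if "x \<in> C" "y \<in> C" "z \<in> C" for x y z
      using that \<open>us \<in> lists C\<close> \<open>ws \<in> lists C\<close> pure_add[of us "z # ws" x y] by simp
    have a2: "?p z (x \<oplus>\<^bsub>V\<^esub> y) = ?p z x \<oplus>\<^bsub>T\<^esub> ?p z y" if "x \<in> C" "y \<in> C" "z \<in> C" for x y z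
      using that \<open>us \<in> lists C\<close> \<open>ws \<in> lists C\<close> pure_add[of "us @ [z]" ws x y] by simp
    have "?p (v \<oplus>\<^bsub>V\<^esub> w) (v \<oplus>\<^bsub>V\<^esub> w) \<in> alt_ideal" "?p v v \<in> alt_ideal" "?p w w \<in> alt_ideal"
      using that by (auto intro: square)
    then have "?p (v \<oplus>\<^bsub>V\<^esub> w) (v \<oplus>\<^bsub>V\<^esub> w) \<ominus>\<^bsub>T\<^esub> (?p v v \<oplus>\<^bsub>T\<^esub> ?p w w) \<in> alt_ideal"
      by (simp add: a_minus_def)
    also have "?p (v \<oplus>\<^bsub>V\<^esub> w) (v \<oplus>\<^bsub>V\<^esub> w) \<ominus>\<^bsub>T\<^esub> (?p v v \<oplus>\<^bsub>T\<^esub> ?p w w) = ?p v w \<oplus>\<^bsub>T\<^esub> ?p w v"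
    proof -
      have "?p (v \<oplus>\<^bsub>V\<^esub> w) (v \<oplus>\<^bsub>V\<^esub> w) = (?p v w \<oplus>\<^bsub>T\<^esub> ?p w v) \<oplus>\<^bsub>T\<^esub> (?p v v \<oplus>\<^bsub>T\<^esub> ?p w w)"
        using that c by (simp add: a1 a2 T.a_ac)
      then show ?thesis using that c by (simp add: a_minus_def T.a_assoc T.r_neg)
    qed
    finally have "\<ominus>\<^bsub>T\<^esub> (?p v w \<oplus>\<^bsub>T\<^esub> ?p w v) \<in> alt_ideal" by simp
    also have "\<ominus>\<^bsub>T\<^esub> (?p v w \<oplus>\<^bsub>T\<^esub> ?p w v) = (- 1) \<odot>\<^bsub>T\<^esub> ?p w v \<ominus>\<^bsub>T\<^esub> ?p v w"
      using that c by (simp add: a_minus_def T.minus_add class_smult[OF T.VS.module_axioms] T.a_comm)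
    finally show ?thesis using that c by (simp add: Q.coset_eq_iff)
  qed
  have inv: "Q.proj (braid_at V c n i x) = Q.proj x" if i: "Suc i < n" and x: "x \<in> carrier (Tn n)" for n i x
  proof (rule Tn_hom_eqI[where f = "\<lambda>x. Q.proj (braid_at V c n i x)", OF QV.module_axioms _ T_hom_Tn[OF Q.proj_hom] _ x])
    show "(\<lambda>x. Q.proj (braid_at V c n i x)) \<in> module_hom class_ring (Tn n) ?Q"
      using module_hom_compose[OF braid_at_hom[OF i] T_hom_Tn[OF Q.proj_hom]] by (simp add: comp_def)
    fix vs assume "vs \<in> words n"
    then obtain us v w ws where vs: "vs = us @ v # w # ws" "us \<in> words i" "v \<in> C" "w \<in> C" "ws \<in> words (n - i - 2)"
      using words_split[OF _ i] by blast
    then show "Q.proj (braid_at V c n i (pure vs)) = Q.proj (pure vs)"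
      using braid_spec_pure[OF braid_at_spec[OF i] vs(2-5)] \<epsilon> swap[of us v w ws]
      by (simp add: words_def)
  qed
  show "nichols_ideal V c \<subseteq> alt_ideal"
  proof (rule nichols_ideal_least[OF sub])
    fix n :: nat
    show "sym_kernel n \<subseteq> alt_ideal"
    proof
      fix x assume x: "x \<in> sym_kernel n"
      then have xn: "x \<in> carrier (Tn n)" by (simp add: sym_kernel_def)
      then have xc: "x \<in> carrier T" by (rule Tn_subset)
      \<comment> \<open>The class of n! x is the class of the symmetrized \<open>x\<close>, which
        vanishes; n! is invertible in characteristic 0.\<close>
      have "Q.proj (of_nat (fact n) \<odot>\<^bsub>T\<^esub> x) = of_nat (fact n) \<odot>\<^bsub>?Q\<^esub> Q.proj x"
        using xc by (simp only: Q.quotient_smult)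
      also have "\<dots> = Q.proj (quantum_symmetrizer V c n x)"
        using symmetrizer_invariant[OF QV.module_axioms Q.proj_hom inv xn] by simp
      also have "\<dots> = alt_ideal"
        using x by (simp add: sym_kernel_def Q.coset_eq_self_iff Q.U.zero_closed)
      finally have "of_nat (fact n) \<odot>\<^bsub>T\<^esub> x \<in> alt_ideal"
        using xc by (subst (asm) Q.coset_eq_self_iff) simp_all
      then have "inverse (of_nat (fact n)) \<odot>\<^bsub>T\<^esub> (of_nat (fact n) \<odot>\<^bsub>T\<^esub> x) \<in> alt_ideal"
        by (rule submodule.smult_closed[OF sub, rotated]) simp_all
      also have "inverse (of_nat (fact n)) \<odot>\<^bsub>T\<^esub> (of_nat (fact n) \<odot>\<^bsub>T\<^esub> x) = x"
        using xc by (simp add: class_smult(3)[OF T.VS.module_axioms] flip: class_smult(2)[OF T.VS.module_axioms])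
      finally show "x \<in> alt_ideal" .
    qed
  qed
qed

end

section \<open>The Yetter-Drinfeld module of a central element\<close>

text \<open>For central \<open>z\<close> the centralizer is all of \<open>G\<close>, so V(z, \<rho>)
  is the tensor product of kG with \<open>W\<close> over kG itself. The space \<open>E\<close> is
  written with \<open>carrier G\<close> from the outset, and \<open>centralizer_eq\<close> connects
  it to the definition.\<close>

locale central_induction = linear_representation G W \<rho>
  for G :: "('g, 'b) monoid_scheme" and W :: "('k::field_char_0, 'w, 'm) module_scheme" and \<rho> +
  fixes z
  assumes z_closed: "z \<in> carrier G"
    and central: "g \<in> carrier G \<Longrightarrow> z \<otimes>\<^bsub>G\<^esub> g = g \<otimes>\<^bsub>G\<^esub> z"
begin

abbreviation "A \<equiv> monoid_algebra G :: ('k, 'g \<Rightarrow>\<^sub>0 'k) module"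

sublocale A: assoc_algebra A
  by (rule monoid_algebra_assoc_algebra) (rule G.monoid_axioms)

abbreviation "act \<equiv> algebra_action W \<rho>"
abbreviation "\<delta> (g :: 'g) \<equiv> Poly_Mapping.single g (1::'k)"
abbreviation "FX \<equiv> free_space (carrier A \<times> carrier W) :: ('k, (('g \<Rightarrow>\<^sub>0 'k) \<times> 'w) \<Rightarrow>\<^sub>0 'k) module"
abbreviation "R \<equiv> balanced_relations (carrier A) A (mult A) W act"
abbreviation "E \<equiv> induced_space G (carrier G) W \<rho>"
abbreviation "t \<equiv> induced_pure G (carrier G) W \<rho>"
abbreviation "V \<equiv> induced_yd G z W \<rho>"

lemma rho_closed: "\<lbrakk>g \<in> carrier G; w \<in> carrier W\<rbrakk> \<Longrightarrow> \<rho> g w \<in> carrier W"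
  by (rule funcset_mem[OF module_hom_closed[OF linear]])

lemma \<delta>_closed [simp]: "g \<in> carrier G \<Longrightarrow> \<delta> g \<in> carrier A"
  by (simp add: monoid_algebra_simps)

lemma \<delta>_subset: "\<delta> ` carrier G \<subseteq> carrier A"
  using \<delta>_closed by blast

lemma \<delta>_span: "A.VS.span (\<delta> ` carrier G) = carrier A"
  by (rule monoid_algebra_span)

lemma act_eq: "act a w = linear_extension W (\<lambda>g. \<rho> g w) a"
  by (simp add: algebra_action_def linear_extension_def)

lemma act_hom_left:
  assumes "w \<in> carrier W"
  shows "(\<lambda>a. act a w) \<in> module_hom class_ring A W"
proof -
  have "(\<lambda>g. \<rho> g w) \<in> carrier G \<rightarrow> carrier W" using rho_closed assms by auto
  from linear_extension_hom[OF W.module_axioms this] show ?thesis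
    by (simp add: act_eq module_hom_def free_space_simps monoid_algebra_simps)
qed

lemma act_closed: "\<lbrakk>a \<in> carrier A; w \<in> carrier W\<rbrakk> \<Longrightarrow> act a w \<in> carrier W"
  by (rule funcset_mem[OF module_hom_closed[OF act_hom_left]])

lemma act_\<delta>: "\<lbrakk>g \<in> carrier G; w \<in> carrier W\<rbrakk> \<Longrightarrow> act (\<delta> g) w = \<rho> g w"
  unfolding act_eq
  by (subst linear_extension_single[OF W.module_axioms, where X = "carrier G"])
    (auto simp: rho_closed class_smult[OF W.module_axioms])

text \<open>Group elements span kG, so the laws for the action of kG on \<open>W\<close> reduce to
  those of \<rho>.\<close>

lemma act_eqI:
  assumes "f \<in> module_hom class_ring A W" "g \<in> module_hom class_ring A W"
    and "\<And>x. x \<in> carrier G \<Longrightarrow> f (\<delta> x) = g (\<delta> x)" and "a \<in> carrier A"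
  shows "f a = g a"
  by (rule module_hom_eq_on_span[OF A.VS.module_axioms W.module_axioms assms(1,2) \<delta>_subset])
    (use assms in \<open>auto simp only: \<delta>_span\<close>)

lemma act_add:
  assumes "a \<in> carrier A" "w \<in> carrier W" "w' \<in> carrier W"
  shows "act a (w \<oplus>\<^bsub>W\<^esub> w') = act a w \<oplus>\<^bsub>W\<^esub> act a w'"
proof (rule act_eqI[where f = "\<lambda>a. act a (w \<oplus>\<^bsub>W\<^esub> w')", OF act_hom_left _ _ assms(1)])
  show "(\<lambda>a. act a w \<oplus>\<^bsub>W\<^esub> act a w') \<in> module_hom class_ring A W"
    using act_hom_left[OF assms(2)] act_hom_left[OF assms(3)]
    by (auto simp: module_hom_def W.smult_r_distr W.M.a_ac Pi_iff)
qed (use assms module_hom_add[OF linear] in \<open>auto simp: act_\<delta>\<close>)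

lemma act_smult:
  assumes "a \<in> carrier A" "w \<in> carrier W"
  shows "act a (c \<odot>\<^bsub>W\<^esub> w) = c \<odot>\<^bsub>W\<^esub> act a w"
proof (rule act_eqI[where f = "\<lambda>a. act a (c \<odot>\<^bsub>W\<^esub> w)", OF act_hom_left _ _ assms(1)])
  show "(\<lambda>a. c \<odot>\<^bsub>W\<^esub> act a w) \<in> module_hom class_ring A W"
    using module_hom_compose[OF act_hom_left[OF assms(2)] smult_hom[OF W.module_axioms]]
    by (simp add: comp_def)
qed (use assms module_hom_smult[OF linear] in \<open>auto simp: act_\<delta>\<close>)

lemma act_hom_right: "a \<in> carrier A \<Longrightarrow> act a \<in> module_hom class_ring W W"
  by (auto simp: module_hom_def act_closed act_add act_smult)

lemma act_mult:
  assumes "a \<in> carrier A" "b \<in> carrier A" "w \<in> carrier W"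
  shows "act (a \<otimes>\<^bsub>A\<^esub> b) w = act a (act b w)"
proof (rule act_eqI[where f = "\<lambda>a. act (a \<otimes>\<^bsub>A\<^esub> b) w", OF _ _ _ assms(1)])
  show "(\<lambda>a. act (a \<otimes>\<^bsub>A\<^esub> b) w) \<in> module_hom class_ring A W"
    using module_hom_compose[OF A.mult_right_hom[OF assms(2)] act_hom_left[OF assms(3)]]
    by (simp add: comp_def)
  show "(\<lambda>a. act a (act b w)) \<in> module_hom class_ring A W"
    by (rule act_hom_left) (rule act_closed[OF assms(2,3)])
  fix x assume x: "x \<in> carrier G"
  show "act (\<delta> x \<otimes>\<^bsub>A\<^esub> b) w = act (\<delta> x) (act b w)"
  proof (rule act_eqI[where f = "\<lambda>b. act (\<delta> x \<otimes>\<^bsub>A\<^esub> b) w", OF _ _ _ assms(2)])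
    show "(\<lambda>b. act (\<delta> x \<otimes>\<^bsub>A\<^esub> b) w) \<in> module_hom class_ring A W"
      using module_hom_compose[OF A.mult_left_hom[OF \<delta>_closed[OF x]] act_hom_left[OF assms(3)]]
      by (simp add: comp_def)
    show "(\<lambda>b. act (\<delta> x) (act b w)) \<in> module_hom class_ring A W"
      using module_hom_compose[OF act_hom_left[OF assms(3)] act_hom_right[OF \<delta>_closed[OF x]]]
      by (simp add: comp_def)
    fix y assume "y \<in> carrier G"
    then show "act (\<delta> x \<otimes>\<^bsub>A\<^esub> \<delta> y) w = act (\<delta> x) (act (\<delta> y) w)"
      using x assms by (simp add: monoid_algebra_mult_single act_\<delta> rho_closed mult)
  qed
qed

lemma act_one: "w \<in> carrier W \<Longrightarrow> act \<one>\<^bsub>A\<^esub> w = w"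
  by (simp add: monoid_algebra_simps act_\<delta> one)

text \<open>The generators inside \<open>balanced_relations\<close> for kG acting on both sides,
  named so that they can be treated one family at a time.\<close>

definition relation_generators :: "(('g \<Rightarrow>\<^sub>0 'k) \<times> 'w \<Rightarrow>\<^sub>0 'k) set" where
  "relation_generators = (let e = (\<lambda>m n. Poly_Mapping.single (m, n) (1::'k)) in
      {e (m \<oplus>\<^bsub>A\<^esub> m') n - e m n - e m' n | m m' n.
          m \<in> carrier A \<and> m' \<in> carrier A \<and> n \<in> carrier W} \<union>
       {e m (n \<oplus>\<^bsub>W\<^esub> n') - e m n - e m n' | m n n'.
          m \<in> carrier A \<and> n \<in> carrier W \<and> n' \<in> carrier W} \<union>
       {e (c \<odot>\<^bsub>A\<^esub> m) n - Poly_Mapping.single (m, n) c | c m n.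
          m \<in> carrier A \<and> n \<in> carrier W} \<union>
       {e m (c \<odot>\<^bsub>W\<^esub> n) - Poly_Mapping.single (m, n) c | c m n.
          m \<in> carrier A \<and> n \<in> carrier W} \<union>
       {e (m \<otimes>\<^bsub>A\<^esub> a) n - e m (act a n) | m a n.
          m \<in> carrier A \<and> a \<in> carrier A \<and> n \<in> carrier W})"

lemma R_eq: "R = lspan FX relation_generators"
  by (simp add: balanced_relations_def relation_generators_def Let_def)

lemma single_FX [simp]:
  "\<lbrakk>a \<in> carrier A; w \<in> carrier W\<rbrakk> \<Longrightarrow> Poly_Mapping.single (a, w) c \<in> carrier FX"
  by (rule single_in_free_space) simp

lemma generators_subset: "relation_generators \<subseteq> carrier FX"
  unfolding relation_generators_def Let_def
  by (auto intro!: free_space_minus(1) simp: act_closed)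

interpretation Q: quotient_space FX R
  using free_space.span_is_submodule[OF generators_subset] free_space_vectorspace
  by (simp add: quotient_space_def R_eq)

lemma E_eq: "E = quotient_module FX R"
  by (simp add: induced_space_def balanced_tensor_def)

lemma t_eq: "t a w = Q.proj (Poly_Mapping.single (a, w) 1)"
  by (simp add: induced_pure_def balanced_pure_def)

lemma E_vectorspace: "vectorspace class_ring E"
  unfolding E_eq by (rule Q.quotient_vectorspace)

sublocale E: vectorspace class_ring E by (rule E_vectorspace)

lemma t_closed [simp]: "\<lbrakk>a \<in> carrier A; w \<in> carrier W\<rbrakk> \<Longrightarrow> t a w \<in> carrier E"
  by (simp add: t_eq E_eq Q.quotient_simps)

lemma relation_coset:
  assumes "p - q \<in> relation_generators" "p \<in> carrier FX" "q \<in> carrier FX"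
  shows "Q.proj p = Q.proj q"
proof -
  have "p - q \<in> R" using free_space.in_own_span[OF generators_subset] assms(1) by (auto simp only: R_eq)
  then show ?thesis
    unfolding free_space_minus(2)[OF assms(2,3)] using assms by (simp only: Q.coset_eq_iff)
qed

lemma t_balanced:
  assumes "a \<in> carrier A" "b \<in> carrier A" "w \<in> carrier W"
  shows "t (a \<otimes>\<^bsub>A\<^esub> b) w = t a (act b w)"
proof -
  have "Poly_Mapping.single (a \<otimes>\<^bsub>A\<^esub> b, w) 1 - Poly_Mapping.single (a, act b w) 1 \<in> relation_generators"
    unfolding relation_generators_def Let_def using assms by blast
  then show ?thesis
    unfolding t_eq using assms by (intro relation_coset) (simp_all add: act_closed)
qed

lemma t_add:
  assumes "a \<in> carrier A" "w \<in> carrier W" "w' \<in> carrier W"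
  shows "t a (w \<oplus>\<^bsub>W\<^esub> w') = t a w \<oplus>\<^bsub>E\<^esub> t a w'"
proof -
  let ?s = "\<lambda>w. Poly_Mapping.single (a, w) (1::'k)"
  have closed: "?s w \<in> carrier FX" "?s w' \<in> carrier FX" "?s (w \<oplus>\<^bsub>W\<^esub> w') \<in> carrier FX"
    using assms by simp_all
  have "?s (w \<oplus>\<^bsub>W\<^esub> w') - ?s w - ?s w' \<in> relation_generators"
    unfolding relation_generators_def Let_def using assms by blast
  moreover have "?s (w \<oplus>\<^bsub>W\<^esub> w') - ?s w - ?s w' = ?s (w \<oplus>\<^bsub>W\<^esub> w') - (?s w \<oplus>\<^bsub>FX\<^esub> ?s w')"
    by (simp add: free_space_simps diff_diff_eq)
  ultimately have "t a (w \<oplus>\<^bsub>W\<^esub> w') = Q.proj (?s w \<oplus>\<^bsub>FX\<^esub> ?s w')"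
    unfolding t_eq using closed by (intro relation_coset) simp_all
  also have "\<dots> = t a w \<oplus>\<^bsub>E\<^esub> t a w'"
    unfolding t_eq E_eq using closed by (simp only: Q.quotient_add)
  finally show ?thesis .
qed

lemma t_smult:
  assumes "a \<in> carrier A" "w \<in> carrier W"
  shows "t a (c \<odot>\<^bsub>W\<^esub> w) = c \<odot>\<^bsub>E\<^esub> t a w"
proof -
  have "Poly_Mapping.single (a, c \<odot>\<^bsub>W\<^esub> w) 1 - Poly_Mapping.single (a, w) c \<in> relation_generators"
    unfolding relation_generators_def Let_def using assms by blast
  then have "t a (c \<odot>\<^bsub>W\<^esub> w) = Q.proj (Poly_Mapping.single (a, w) c)"
    unfolding t_eq using assms by (intro relation_coset) simp_all
  also have "Poly_Mapping.single (a, w) c = c \<odot>\<^bsub>FX\<^esub> Poly_Mapping.single (a, w) 1"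
    by (simp add: free_space_simps scale_single)
  also have "Q.proj \<dots> = c \<odot>\<^bsub>E\<^esub> t a w"
    unfolding t_eq E_eq using assms by (simp only: Q.quotient_smult single_FX)
  finally show ?thesis .
qed

lemma t_span: "E.span {t a w | a w. a \<in> carrier A \<and> w \<in> carrier W} = carrier E"
proof -
  have "{t a w | a w. a \<in> carrier A \<and> w \<in> carrier W}
      = Q.proj ` (\<lambda>x. Poly_Mapping.single x 1) ` (carrier A \<times> carrier W)"
    by (auto simp: t_eq)
  moreover have "lspan (quotient_module FX R) (Q.proj ` (\<lambda>x. Poly_Mapping.single x 1) ` (carrier A \<times> carrier W))
      = carrier (quotient_module FX R)"
    by (rule Q.quotient_span) (auto simp only: free_space_span single_FX image_subset_iff mem_Sigma_iff)
  ultimately show ?thesis by (simp only: E_eq)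
qed

abbreviation "\<iota> w \<equiv> t \<one>\<^bsub>A\<^esub> w"

lemma \<iota>_hom: "\<iota> \<in> module_hom class_ring W E"
  by (auto simp: module_hom_def t_add t_smult)

text \<open>Balancedness moves \<open>a\<close> across the tensor sign: a \<otimes> w = 1 a
  \<otimes> w = 1 \<otimes> a w.\<close>

lemma t_eq_\<iota>: "\<lbrakk>a \<in> carrier A; w \<in> carrier W\<rbrakk> \<Longrightarrow> t a w = \<iota> (act a w)"
  using t_balanced[of "\<one>\<^bsub>A\<^esub>" a w] by simp

text \<open>The action kG \<times> W \<rightarrow> W is bilinear and balanced, so it factors through
  the tensor product. The map \<mu> turns out to be the inverse of \<open>\<iota>\<close>.\<close>

lemma evaluation_exists:
  obtains \<mu> where "\<mu> \<in> module_hom class_ring E W"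
    "\<And>a w. \<lbrakk>a \<in> carrier A; w \<in> carrier W\<rbrakk> \<Longrightarrow> \<mu> (t a w) = act a w"
proof -
  let ?F = "\<lambda>(a, w). act a w"
  let ?f = "linear_extension W ?F"
  have F: "?F \<in> carrier A \<times> carrier W \<rightarrow> carrier W" using act_closed by auto
  note hom = linear_extension_hom[OF W.module_axioms F]
  have fs: "?f (Poly_Mapping.single (a, w) c) = c \<odot>\<^bsub>W\<^esub> act a w" if "a \<in> carrier A" "w \<in> carrier W" for a w c
    using linear_extension_single[OF W.module_axioms F, of "(a, w)"] that by simp
  note fm = linear_extension_minus[OF W.module_axioms F]
  note sm = class_smult[OF W.module_axioms]
  have cancel: "x \<oplus>\<^bsub>W\<^esub> y \<ominus>\<^bsub>W\<^esub> x \<ominus>\<^bsub>W\<^esub> y = \<zero>\<^bsub>W\<^esub>" if "x \<in> carrier W" "y \<in> carrier W" for x y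
  proof -
    have "x \<oplus>\<^bsub>W\<^esub> y \<ominus>\<^bsub>W\<^esub> x \<ominus>\<^bsub>W\<^esub> y = (x \<oplus>\<^bsub>W\<^esub> y) \<ominus>\<^bsub>W\<^esub> (x \<oplus>\<^bsub>W\<^esub> y)"
      using that by (simp add: a_minus_def W.M.minus_add W.M.a_assoc)
    then show ?thesis using that by (simp add: a_minus_def W.M.r_neg)
  qed
  have minus_self: "x \<ominus>\<^bsub>W\<^esub> x = \<zero>\<^bsub>W\<^esub>" if "x \<in> carrier W" for x
    using that by (simp add: a_minus_def W.M.r_neg)
  have gen: "?f r = \<zero>\<^bsub>W\<^esub>" if r: "r \<in> relation_generators" for r
    using r unfolding relation_generators_def Let_def
    \<comment> \<open>One case per family of relations: additivity and homogeneity in either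
      argument cancel by linearity of \<open>act\<close>, and balancedness is
      \<open>act_mult\<close>.\<close>
    by (elim UnE CollectE exE conjE)
      (simp_all add: fm fs free_space_minus(1) act_closed act_add act_smult act_mult sm cancel
        module_hom_add[OF act_hom_left] module_hom_smult[OF act_hom_left] minus_self)
  have "?f r \<in> {\<zero>\<^bsub>W\<^esub>}" if "r \<in> R" for r
  proof (rule module_hom_span[OF free_space.module_axioms W.module_axioms hom generators_subset])
    show "r \<in> lspan FX relation_generators" using that by (simp only: R_eq)
    show "submodule class_ring {\<zero>\<^bsub>W\<^esub>} W" by unfold_locales auto
  qed (use gen in simp)
  then have "?f r = \<zero>\<^bsub>W\<^esub>" if "r \<in> R" for r using that by blast
  from Q.quotient_lift[OF W.module_axioms hom this]
  obtain \<mu> where \<mu>: "\<mu> \<in> module_hom class_ring E W" "\<And>x. x \<in> carrier FX \<Longrightarrow> \<mu> (Q.proj x) = ?f x"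
    unfolding E_eq by blast
  have "\<mu> (t a w) = act a w" if "a \<in> carrier A" "w \<in> carrier W" for a w
    unfolding t_eq using that by (simp add: \<mu>(2) fs sm act_closed)
  with \<mu>(1) show thesis by (rule that)
qed

end

section \<open>Identification of V(z, \<rho>) with the representation space\<close>

context central_induction
begin

text \<open>The composite of \<mu> and \<open>\<iota>\<close> fixes every \<open>t a w\<close> by
  \<open>t_eq_\<iota>\<close>, and these span.\<close>

lemma \<iota>_surj: "e \<in> carrier E \<Longrightarrow> \<exists>w\<in>carrier W. e = \<iota> w"
proof -
  assume e: "e \<in> carrier E"
  obtain \<mu> where \<mu>: "\<mu> \<in> module_hom class_ring E W"
    "\<And>a w. \<lbrakk>a \<in> carrier A; w \<in> carrier W\<rbrakk> \<Longrightarrow> \<mu> (t a w) = act a w"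
    by (rule evaluation_exists) blast
  have "e = (\<iota> \<circ> \<mu>) e"
  proof (rule module_hom_eq_on_span[where f = "\<lambda>e. e", OF E.module_axioms E.module_axioms _ module_hom_compose[OF \<mu>(1) \<iota>_hom]])
    show "e \<in> E.span {t a w | a w. a \<in> carrier A \<and> w \<in> carrier W}"
      using e by (simp only: t_span)
  qed (auto simp: module_hom_def \<mu>(2) simp flip: t_eq_\<iota>)
  moreover have "\<mu> e \<in> carrier W" by (rule funcset_mem[OF module_hom_closed[OF \<mu>(1)] e])
  ultimately show ?thesis by auto
qed

lemma \<iota>_inj:
  assumes "w \<in> carrier W" "w' \<in> carrier W" "\<iota> w = \<iota> w'"
  shows "w = w'"
proof -
  obtain \<mu> where \<mu>: "\<And>a w. \<lbrakk>a \<in> carrier A; w \<in> carrier W\<rbrakk> \<Longrightarrow> \<mu> (t a w) = act a w"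
    by (rule evaluation_exists) blast
  have "w = \<mu> (\<iota> w)" using assms(1) by (simp add: \<mu> act_one)
  also have "\<dots> = \<mu> (\<iota> w')" by (simp only: assms(3))
  also have "\<dots> = w'" using assms(2) by (simp add: \<mu> act_one)
  finally show ?thesis .
qed

lemma centralizer_eq: "centralizer G z = carrier G"
  unfolding centralizer_def by (rule equalityI; rule subsetI) (simp_all only: mem_Collect_eq central)

lemma conjugate_z:
  assumes "h \<in> carrier G"
  shows "h \<otimes>\<^bsub>G\<^esub> z \<otimes>\<^bsub>G\<^esub> inv\<^bsub>G\<^esub> h = z"
  unfolding central[OF assms, symmetric] using assms z_closed by (simp add: G.m_assoc)

lemma V_simps:
  "carrier V = carrier E" "add V = add E" "zero V = zero E" "smult V = smult E"
  "component V x = E.span {t (\<delta> h) w | h w.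
     h \<in> carrier G \<and> w \<in> carrier W \<and> h \<otimes>\<^bsub>G\<^esub> z \<otimes>\<^bsub>G\<^esub> inv\<^bsub>G\<^esub> h = x}"
  "action V x = (THE \<phi>. \<phi> \<in> linear_maps E E \<and>
     (\<forall>a \<in> carrier A. \<forall>w \<in> carrier W. \<phi> (t a w) = t (\<delta> x \<otimes>\<^bsub>A\<^esub> a) w))"
  by (simp_all add: induced_yd_def Let_def centralizer_eq module.defs)

lemma V_vectorspace: "vectorspace class_ring V"
  by (rule vectorspace_transfer[OF E_vectorspace]) (simp_all only: V_simps)

text \<open>Conjugation fixes \<open>z\<close>, and every vector is some \<open>\<iota> w\<close>,
  which is a generator of this component: take h = 1.\<close>

lemma component_z: "component V z = carrier V"
proof -
  let ?S = "{t (\<delta> h) w | h w. h \<in> carrier G \<and> w \<in> carrier W \<and> h \<otimes>\<^bsub>G\<^esub> z \<otimes>\<^bsub>G\<^esub> inv\<^bsub>G\<^esub> h = z}"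
  have S: "?S \<subseteq> carrier E" by auto
  have "\<iota> w \<in> ?S" if "w \<in> carrier W" for w
    using that conjugate_z[OF G.one_closed] by (fastforce simp: monoid_algebra_simps)
  then have "carrier E \<subseteq> ?S" using \<iota>_surj by blast
  then have "carrier E = ?S" using S by blast
  then show ?thesis
    unfolding V_simps using E.in_own_span[OF S] E.span_is_subset2[OF S] by blast
qed

text \<open>No conjugate of \<open>z\<close> differs from \<open>z\<close>, so the component is the
  span of the empty set.\<close>

lemma component_other:
  assumes "h \<noteq> z" "v \<in> component V h"
  shows "v = \<zero>\<^bsub>V\<^esub>"
proof -
  have empty: "{t (\<delta> g) w | g w. g \<in> carrier G \<and> w \<in> carrier W \<and> g \<otimes>\<^bsub>G\<^esub> z \<otimes>\<^bsub>G\<^esub> inv\<^bsub>G\<^esub> g = h} = {}"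
    using assms(1) conjugate_z by auto
  have "v \<in> E.span {}" using assms(2) unfolding V_simps empty .
  moreover have "submodule class_ring {\<zero>\<^bsub>E\<^esub>} E" by unfold_locales auto
  ultimately show ?thesis
    using E.span_is_subset[of "{}" "{\<zero>\<^bsub>E\<^esub>}"] by (auto simp: V_simps)
qed

text \<open>The action is a definite description. Its witness transports \<rho>(x) along
  \<open>\<iota>\<close> and its inverse \<mu>; uniqueness holds because the \<open>t a w\<close>
  span.\<close>

lemma action_\<iota>:
  assumes x: "x \<in> carrier G" and w: "w \<in> carrier W"
  shows "action V x (\<iota> w) = \<iota> (\<rho> x w)"
proof -
  define spec where "spec \<phi> \<longleftrightarrow> \<phi> \<in> linear_maps E E \<and>
     (\<forall>a \<in> carrier A. \<forall>w \<in> carrier W. \<phi> (t a w) = t (\<delta> x \<otimes>\<^bsub>A\<^esub> a) w)" for \<phi>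
  obtain \<mu> where \<mu>: "\<mu> \<in> module_hom class_ring E W"
    "\<And>a w. \<lbrakk>a \<in> carrier A; w \<in> carrier W\<rbrakk> \<Longrightarrow> \<mu> (t a w) = act a w"
    by (rule evaluation_exists) blast
  let ?\<phi> = "\<lambda>e\<in>carrier E. \<iota> (\<rho> x (\<mu> e))"
  have "?\<phi> \<in> linear_maps E E"
    using module_hom_compose[OF module_hom_compose[OF \<mu>(1) linear[OF x]] \<iota>_hom] E.M.a_closed E.smult_closed
    by (auto simp: linear_maps_def module_hom_def Pi_iff)
  moreover have "?\<phi> (t a w) = t (\<delta> x \<otimes>\<^bsub>A\<^esub> a) w" if "a \<in> carrier A" "w \<in> carrier W" for a w
    using that x t_eq_\<iota>[of "\<delta> x \<otimes>\<^bsub>A\<^esub> a" w] by (simp add: \<mu>(2) act_mult act_\<delta> act_closed)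
  ultimately have ex: "spec ?\<phi>" by (simp add: spec_def)
  have uniq: "\<phi> = \<psi>" if "spec \<phi>" "spec \<psi>" for \<phi> \<psi>
  proof (rule extensionalityI)
    show "\<phi> \<in> extensional (carrier E)" "\<psi> \<in> extensional (carrier E)"
      using that by (auto simp: spec_def linear_maps_def)
    fix e assume e: "e \<in> carrier E"
    show "\<phi> e = \<psi> e"
    proof (rule module_hom_eq_on_span[where f = \<phi> and g = \<psi> and x = e, OF E.module_axioms E.module_axioms])
      show "\<phi> \<in> module_hom class_ring E E" "\<psi> \<in> module_hom class_ring E E"
        using that by (auto simp: spec_def linear_maps_def)
      show "e \<in> E.span {t a w | a w. a \<in> carrier A \<and> w \<in> carrier W}"
        using e by (simp only: t_span)
    qed (use that in \<open>auto simp: spec_def\<close>)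
  qed
  have "spec (action V x)"
    unfolding V_simps spec_def[symmetric]
    by (rule theI'[of spec], rule ex_ex1I, rule exI[of _ ?\<phi>], rule ex) (rule uniq)
  then have "action V x (\<iota> w) = t (\<delta> x \<otimes>\<^bsub>A\<^esub> \<one>\<^bsub>A\<^esub>) w"
    using w by (simp add: spec_def)
  then show ?thesis using x w t_eq_\<iota>[of "\<delta> x" w] by (simp add: act_\<delta>)
qed

lemma action_closed: "\<lbrakk>x \<in> carrier G; v \<in> carrier V\<rbrakk> \<Longrightarrow> action V x v \<in> carrier V"
proof -
  assume x: "x \<in> carrier G" and "v \<in> carrier V"
  then obtain w where "w \<in> carrier W" "v = \<iota> w" using \<iota>_surj by (auto simp: V_simps(1))
  then show ?thesis using action_\<iota>[OF x] rho_closed[OF x] by (simp add: V_simps(1))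
qed

lemma action_scalar:
  assumes "\<And>w. w \<in> carrier W \<Longrightarrow> \<rho> z w = \<epsilon> \<odot>\<^bsub>W\<^esub> w" and "v \<in> carrier V"
  shows "action V z v = \<epsilon> \<odot>\<^bsub>V\<^esub> v"
proof -
  obtain w where "w \<in> carrier W" "v = \<iota> w" using assms(2) \<iota>_surj by (auto simp: V_simps(1))
  then show ?thesis using assms(1) action_\<iota>[OF z_closed] by (simp add: t_smult V_simps(4))
qed

sublocale TV: tensor_space V
  using V_vectorspace by (simp add: tensor_space_def)

text \<open>The scaled flip satisfies the description of \<open>yd_braiding\<close> in every degree:
  in degree \<open>z\<close> because \<open>z\<close> acts by \<epsilon>, in the others because the
  component is zero.\<close>

lemma flip_braiding_induced:
  assumes \<epsilon>: "\<And>w. w \<in> carrier W \<Longrightarrow> \<rho> z w = \<epsilon> \<odot>\<^bsub>W\<^esub> w"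
  shows "flip_braiding V (yd_braiding G V) \<epsilon>"
proof -
  let ?T2 = "tensor_power V 2" and ?T = "tensor_algebra V"
  define spec where "spec c \<longleftrightarrow> c \<in> linear_maps ?T2 ?T2 \<and>
      (\<forall>h \<in> carrier G. \<forall>v \<in> component V h. \<forall>w \<in> carrier V.
        c (pure_tensor V [v, w]) = pure_tensor V [action V h w, v])" for c
  have "Transposition.transpose 0 (Suc 0) permutes {..<2::nat}"
    by (rule adjacent_transpose_permutes) simp
  then obtain P where P: "P \<in> module_hom class_ring ?T ?T"
    "\<And>x. x \<in> carrier ?T2 \<Longrightarrow> P x \<in> carrier ?T2"
    "\<And>vs. vs \<in> TV.words 2 \<Longrightarrow> P (pure_tensor V vs)
      = \<epsilon> \<odot>\<^bsub>?T\<^esub> pure_tensor V (permute_list (Transposition.transpose 0 (Suc 0)) vs)"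
    using TV.scaled_permutation_operator[where a = \<epsilon>] by blast
  define c where "c = restrict P (carrier ?T2)"
  have c_hom: "c \<in> linear_maps ?T2 ?T2"
    unfolding c_def by (rule TV.restrict_linear_map[OF P(1,2)])
  have c_pure: "c (pure_tensor V [v, w]) = \<epsilon> \<odot>\<^bsub>?T\<^esub> pure_tensor V [w, v]"
    if "v \<in> carrier V" "w \<in> carrier V" for v w
  proof -
    have "[v, w] \<in> TV.words 2" using that by (simp add: TV.words_def)
    then show ?thesis
      using P(3)[of "[v, w]"] permute_list_adjacent[of "[]" v w "[]"] TV.pure_in_Tn
      by (simp add: c_def)
  qed
  have ex: "spec c"
    unfolding spec_def
  proof (intro conjI ballI c_hom)
    fix h v w assume h: "h \<in> carrier G" and v: "v \<in> component V h" and w: "w \<in> carrier V"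
    show "c (pure_tensor V [v, w]) = pure_tensor V [action V h w, v]"
    proof (cases "h = z")
      case True
      then have "v \<in> carrier V" using v component_z by simp
      then show ?thesis
        using True w TV.pure_smult[of "[]" "[v]" w \<epsilon>]
        by (simp add: c_pure action_scalar[OF \<epsilon>])
    next
      case False
      \<comment> \<open>The condition is also imposed for h \<noteq> z. There \<open>v\<close> is
        zero, and both sides are tensors with a zero factor.\<close>
      then have v0: "v = \<zero>\<^bsub>V\<^esub>" by (rule component_other) (rule v)
      have zero: "pure_tensor V [y, \<zero>\<^bsub>V\<^esub>] = \<zero>\<^bsub>?T\<^esub>" if "y \<in> carrier V" for y
        using TV.pure_smult[of "[y]" "[]" "\<zero>\<^bsub>V\<^esub>" 0] that
        by (simp add: class_smult(4)[OF TV.V.module_axioms] class_smult(4)[OF TV.T.VS.module_axioms])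
      show ?thesis
        using w h v0 by (simp add: c_pure zero action_closed)
    qed
  qed
  have uniq: "c' = c" if "spec c'" for c'
  proof (rule extensionalityI)
    show "c' \<in> extensional (carrier ?T2)" "c \<in> extensional (carrier ?T2)"
      using that c_hom by (auto simp: spec_def linear_maps_def)
    fix x assume x: "x \<in> carrier ?T2"
    show "c' x = c x"
    proof (rule TV.Tn_hom_eqI[OF TV.Tn_module _ _ _ x])
      show "c' \<in> module_hom class_ring ?T2 ?T2" "c \<in> module_hom class_ring ?T2 ?T2"
        using that c_hom by (auto simp: spec_def linear_maps_def)
      fix vs assume "vs \<in> TV.words 2"
      then obtain v w where "vs = [v, w]" "v \<in> carrier V" "w \<in> carrier V"
        by (auto simp: TV.words_def numeral_2_eq_2 length_Suc_conv)
      \<comment> \<open>Degree \<open>z\<close> alone determines the map, as its component is the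
        whole space.\<close>
      then show "c' (pure_tensor V vs) = c (pure_tensor V vs)"
        using that ex z_closed component_z by (simp add: spec_def)
    qed
  qed
  have "yd_braiding G V = c"
    unfolding yd_braiding_def spec_def[symmetric] by (rule the_equality[of spec, OF ex]) (rule uniq)
  then show ?thesis
    using c_hom c_pure TV.tensor_space_axioms
    by (simp add: flip_braiding_def flip_braiding_axioms_def)
qed

lemma induced_nonzero:
  assumes "carrier W \<noteq> {\<zero>\<^bsub>W\<^esub>}"
  shows "carrier V \<noteq> {\<zero>\<^bsub>V\<^esub>}"
proof
  assume "carrier V = {\<zero>\<^bsub>V\<^esub>}"
  then have "carrier E = {\<zero>\<^bsub>E\<^esub>}" by (simp only: V_simps)
  then have "\<iota> w = \<zero>\<^bsub>E\<^esub>" if "w \<in> carrier W" for w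
    using t_closed[OF A.one_closed that] by auto
  then have "w = \<zero>\<^bsub>W\<^esub>" if "w \<in> carrier W" for w
    using \<iota>_inj[OF that W.M.zero_closed] that by simp
  then show False using assms W.M.zero_closed by blast
qed

lemma symmetric_induced_not_fin_dim:
  assumes "\<And>w. w \<in> carrier W \<Longrightarrow> \<rho> z w = w" and "carrier W \<noteq> {\<zero>\<^bsub>W\<^esub>}"
  shows "\<not> vectorspace.fin_dim class_ring (yd_nichols_algebra G V)"
proof -
  interpret flip_braiding V "yd_braiding G V" 1
    by (rule flip_braiding_induced) (simp add: assms class_smult[OF W.module_axioms])
  show ?thesis
    unfolding yd_nichols_algebra_def
    by (rule symmetric_not_fin_dim) (rule refl, rule induced_nonzero, rule assms(2))
qed

lemma alternating_induced_exterior: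
  assumes "\<And>w. w \<in> carrier W \<Longrightarrow> \<rho> z w = (- 1) \<odot>\<^bsub>W\<^esub> w"
  shows "yd_nichols_algebra G V = exterior_algebra V"
proof -
  interpret flip_braiding V "yd_braiding G V" "- 1"
    by (rule flip_braiding_induced) (rule assms)
  show ?thesis
    unfolding yd_nichols_algebra_def nichols_algebra_def exterior_algebra_def
    by (simp add: nichols_ideal_exterior)
qed

end

text \<open>Schur's lemma for a central involution needs no eigenvalue: one of its two eigenspaces is
  all of \<open>W\<close>.\<close>

lemma (in irreducible_representation) central_involution_scalar:
  assumes z: "z \<in> carrier G" "z \<otimes>\<^bsub>G\<^esub> z = \<one>\<^bsub>G\<^esub>"
    and central: "\<And>g. g \<in> carrier G \<Longrightarrow> z \<otimes>\<^bsub>G\<^esub> g = g \<otimes>\<^bsub>G\<^esub> z"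
  shows "(\<forall>w\<in>carrier W. \<rho> z w = w) \<or> (\<forall>w\<in>carrier W. \<rho> z w = (- 1) \<odot>\<^bsub>W\<^esub> w)"
proof -
  define U where "U = {w \<in> carrier W. \<rho> z w = w}"
  note closed = funcset_mem[OF module_hom_closed[OF linear]]
  have "subspace class_ring U W"
  proof (intro subspace.intro W.vectorspace_axioms submodule.intro W.module_axioms)
    show "\<zero>\<^bsub>W\<^esub> \<in> U"
      using module_hom_zero[OF W.module_axioms W.module_axioms linear[OF z(1)]] by (simp add: U_def)
  qed (use module_hom_add[OF linear[OF z(1)]] module_hom_smult[OF linear[OF z(1)]] in \<open>auto simp: U_def\<close>)
  moreover have "\<rho> g u \<in> U" if "g \<in> carrier G" "u \<in> U" for g u
    using that z(1) closed[of g] central[of g] mult[of z g u] mult[of g z u] by (auto simp: U_def)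
  ultimately consider "U = {\<zero>\<^bsub>W\<^esub>}" | "U = carrier W"
    using irreducible by blast
  then show ?thesis
  proof cases
    case 1
    have "\<rho> z w = (- 1) \<odot>\<^bsub>W\<^esub> w" if w: "w \<in> carrier W" for w
    proof -
      \<comment> \<open>Averaging over the involution: z w + w is always fixed by \<open>z\<close>,
        hence lies in \<open>U\<close>, which is zero in this case.\<close>
      have "\<rho> z (\<rho> z w \<oplus>\<^bsub>W\<^esub> w) = \<rho> z (\<rho> z w) \<oplus>\<^bsub>W\<^esub> \<rho> z w"
        using module_hom_add[OF linear[OF z(1)]] closed[OF z(1)] w by simp
      also have "\<dots> = \<rho> z w \<oplus>\<^bsub>W\<^esub> w"
        using mult[OF z(1,1) w] one[OF w] z(2) closed[OF z(1) w] w by (simp add: W.M.a_comm)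
      finally have "\<rho> z w \<oplus>\<^bsub>W\<^esub> w \<in> U" using closed[OF z(1) w] w by (simp add: U_def)
      then have "\<rho> z w \<oplus>\<^bsub>W\<^esub> w = \<zero>\<^bsub>W\<^esub>" using 1 by simp
      then show ?thesis
        using W.M.minus_equality[OF _ w closed[OF z(1) w]] w
        by (simp add: class_smult[OF W.module_axioms])
    qed
    then show ?thesis by blast
  qed (auto simp: U_def)
qed

theorem proposition3p3:
  fixes q :: nat
    and W :: "('k::{alg_closed_field, field_char_0}, 'w) module"
    and \<rho> :: "'f::{field, finite} mat \<Rightarrow> 'w \<Rightarrow> 'w"
  assumes "primepow q" and "odd q" and "q > 3" and "card (UNIV :: 'f set) = q"
    and "irreducible_representation (special_linear 2) W \<rho>"
  shows "\<not> vectorspace.fin_dim class_ring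
            (yd_nichols_algebra (special_linear 2) (induced_yd (special_linear 2) (1\<^sub>m 2) W \<rho>))
    \<and> (vectorspace.fin_dim class_ring
            (yd_nichols_algebra (special_linear 2) (induced_yd (special_linear 2) (- 1\<^sub>m 2) W \<rho>))
       \<longrightarrow> yd_nichols_algebra (special_linear 2) (induced_yd (special_linear 2) (- 1\<^sub>m 2) W \<rho>)
           = exterior_algebra (induced_yd (special_linear 2) (- 1\<^sub>m 2) W \<rho>))"
proof -
  let ?G = "special_linear 2 :: 'f mat monoid" and ?z = "- 1\<^sub>m 2 :: 'f mat"
  interpret irreducible_representation ?G W \<rho> by fact
  have G: "carrier ?G = {M \<in> carrier_mat 2 2. det M = 1}" "\<one>\<^bsub>?G\<^esub> = 1\<^sub>m 2" "mult ?G = (*)"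
    by (simp_all add: special_linear_def)
  interpret one: central_induction ?G W \<rho> "1\<^sub>m 2"
    by unfold_locales (auto simp: G)
  \<comment> \<open>Written as a scalar matrix, -I visibly has determinant (-1)^2 = 1, commutes with
    every matrix and squares to the identity.\<close>
  have z_eq: "?z = (- 1) \<cdot>\<^sub>m 1\<^sub>m 2" by (rule eq_matI) auto
  have z: "?z \<in> carrier ?G" unfolding z_eq by (simp add: G)
  have z_central: "?z \<otimes>\<^bsub>?G\<^esub> M = M \<otimes>\<^bsub>?G\<^esub> ?z" if "M \<in> carrier ?G" for M
    using that left_mult_one_mat[of M 2 2] right_mult_one_mat[of M 2 2] unfolding z_eq
    by (simp add: G mult_smult_distrib[of _ 2 2 _ 2] mult_smult_assoc_mat[of _ 2 2 _ 2])
  have smult_smult: "(- 1) \<cdot>\<^sub>m ((- 1) \<cdot>\<^sub>m M) = M" for M :: "'f mat"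
    by (rule eq_matI) auto
  have z_square: "?z \<otimes>\<^bsub>?G\<^esub> ?z = \<one>\<^bsub>?G\<^esub>"
    unfolding z_eq by (simp add: G mult_smult_distrib[of _ 2 2 _ 2] mult_smult_assoc_mat[of _ 2 2 _ 2] smult_smult)
  interpret minus: central_induction ?G W \<rho> ?z
    by unfold_locales (use z z_central in auto)
  from central_involution_scalar[OF z z_square z_central]
  have "(\<forall>w\<in>carrier W. \<rho> ?z w = w) \<or> (\<forall>w\<in>carrier W. \<rho> ?z w = (- 1) \<odot>\<^bsub>W\<^esub> w)" .
  \<comment> \<open>I acts trivially by the representation axiom, which settles the first claim. If
    -I acts by +1, the premise of the second claim fails for the same reason; if it acts by -1, the
    equality of algebras holds.\<close>
  then show ?thesis
    using one.symmetric_induced_not_fin_dim minus.symmetric_induced_not_fin_dim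
      minus.alternating_induced_exterior nonzero local.one G(2) by auto
qed

end
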